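(* Let $(X,\phi)$ be an arbitrary calibrated manifold, $p=\deg\phi$. Fix $S\in\mathcal D'_{p-1}(X)$ and $\lambda>0$. Then the following are equivalent. (i) There exists a $\Lambda_+(\phi)$-positive current $T\in\mathcal D'_p(X)$ with $S=\partial T$ and $M(T)\le\lambda$. (ii) $\int_S\alpha\ge-\lambda$ for all compactly supported forms $\alpha\in\mathcal D^{p-1}(X)$ such that $d\alpha+\phi$ is $\Lambda^+(\phi)$-positive.
   Context: A calibrated manifold $(X,\phi)$ is an oriented Riemannian manifold $X$ with a smooth $d$-closed $p$-form $\phi$ of comass one, i.e. $\phi(\xi)\le 1$ for every unit simple $p$-vector $\xi$. $G(\phi)$ denotes the set of $\phi$-planes, i.e. unit simple $p$-vectors $\xi$ with $\phi(\xi)=1$. $\mathcal D^k(X)$ is the space of smooth $k$-forms with compact support on $X$ and $\mathcal D'_k(X)$ is its topological dual, the space of $k$-dimensional currents on $X$ (not necessarily with compact support). $\int_S\alpha$ denotes $S(\alpha)$; the boundary is $(\partial T)(\alpha)=T(d\alpha)$; $M(T)$ is the mass of $T$ (the supremum of $T(\psi)$ over compactly supported smooth $p$-forms $\psi$ with pointwise comass at most $1$). A smooth $p$-form $\beta$ is $\Lambda^+(\phi)$-positive if $\beta(\xi)\ge0$ for all $\xi\in G(\phi)$. A $p$-dimensional current $T$ is $\Lambda_+(\phi)$-positive if $T(\beta)\ge 0$ for all compactly supported $\Lambda^+(\phi)$-positive $p$-forms $\beta$. *)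

theory Defs
  imports
    "HOL-Analysis.Analysis"
    "HOL-Library.Function_Algebras"
    "HOL-Library.FuncSet"
    "HOL-Combinatorics.Permutations"
begin

section \<open>Pointwise vector space structure on functions\<close>

instantiation "fun" :: (type, real_vector) real_vector
begin

definition scaleR_fun :: "real \<Rightarrow> ('a \<Rightarrow> 'b) \<Rightarrow> 'a \<Rightarrow> 'b"
  where "scaleR_fun r f = (\<lambda>x. r *\<^sub>R f x)"

instance
  by standard (simp_all add: scaleR_fun_def fun_eq_iff scaleR_add_right scaleR_add_left)

end

lemma scaleR_fun_apply [simp]: "(r *\<^sub>R f) x = r *\<^sub>R f x"
  by (simp add: scaleR_fun_def)


section \<open>Smooth maps between Euclidean spaces\<close>

primrec ck_on :: "nat \<Rightarrow> 'a::euclidean_space set \<Rightarrow> ('a \<Rightarrow> 'b::euclidean_space) \<Rightarrow> bool" where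
  "ck_on 0 S f \<longleftrightarrow> continuous_on S f"
| "ck_on (Suc k) S f \<longleftrightarrow>
     (\<forall>x\<in>S. f differentiable (at x)) \<and>
     (\<forall>u. ck_on k S (\<lambda>x. frechet_derivative f (at x) u))"

text \<open>Only used for open \<open>S\<close>.\<close>

definition smooth_on :: "'a::euclidean_space set \<Rightarrow> ('a \<Rightarrow> 'b::euclidean_space) \<Rightarrow> bool"
  where "smooth_on S f \<longleftrightarrow> (\<forall>k. ck_on k S f)"

primrec iter_deriv :: "'a::euclidean_space list \<Rightarrow> ('a \<Rightarrow> real) \<Rightarrow> 'a \<Rightarrow> real" where
  "iter_deriv [] h = h"
| "iter_deriv (u # us) h = (\<lambda>x. frechet_derivative (iter_deriv us h) (at x) u)"


section \<open>Oriented smooth manifolds\<close>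

text \<open>
  A chart is a pair of its domain and its coordinate map; the values of the coordinate map outside
  the domain are irrelevant.  A smooth structure together with an orientation is given by an atlas
  whose transition maps are smooth with positive Jacobian determinant; the atlas need not be
  maximal.
\<close>

type_synonym ('a, 'n) chart = "'a set \<times> ('a \<Rightarrow> real ^ 'n)"

definition chart_image :: "('a, 'n::finite) chart \<Rightarrow> (real ^ 'n) set"
  where "chart_image c = snd c ` fst c"

definition is_chart :: "'a topology \<Rightarrow> ('a, 'n::finite) chart \<Rightarrow> bool"
  where "is_chart X c \<longleftrightarrow>
    openin X (fst c) \<and> open (chart_image c) \<and>
    homeomorphic_map (subtopology X (fst c)) (top_of_set (chart_image c)) (snd c)"

definition transition :: "('a, 'n::finite) chart \<Rightarrow> ('a, 'n) chart \<Rightarrow> real ^ 'n \<Rightarrow> real ^ 'n"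
  where "transition c c' = snd c' \<circ> inv_into (fst c) (snd c)"

definition transition_deriv ::
    "('a, 'n::finite) chart \<Rightarrow> ('a, 'n) chart \<Rightarrow> 'a \<Rightarrow> real ^ 'n \<Rightarrow> real ^ 'n"
  where "transition_deriv c c' x = frechet_derivative (transition c c') (at (snd c x))"

definition oriented_manifold :: "'a topology \<Rightarrow> ('a, 'n::finite) chart set \<Rightarrow> bool"
  where "oriented_manifold X A \<longleftrightarrow>
    Hausdorff_space X \<and> second_countable X \<and>
    (\<forall>c\<in>A. is_chart X c) \<and> (\<Union>c\<in>A. fst c) = topspace X \<and>
    (\<forall>c\<in>A. \<forall>c'\<in>A. smooth_on (snd c ` (fst c \<inter> fst c')) (transition c c')) \<and>
    (\<forall>c\<in>A. \<forall>c'\<in>A. \<forall>x\<in>fst c \<inter> fst c'. det (matrix (transition_deriv c c' x)) > 0)"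


section \<open>Riemannian metrics\<close>

text \<open>
  Tensor fields are given by their coordinate representations in the charts of the atlas, which
  have to be related by the transition maps.  For a metric, \<open>g c y\<close> is the bilinear form at
  the coordinate point \<open>y\<close> in the chart \<open>c\<close>.
\<close>

type_synonym ('a, 'n) metric_field =
  "('a, 'n) chart \<Rightarrow> real ^ 'n \<Rightarrow> real ^ 'n \<Rightarrow> real ^ 'n \<Rightarrow> real"

definition riemannian_metric :: "('a, 'n::finite) chart set \<Rightarrow> ('a, 'n) metric_field \<Rightarrow> bool"
  where "riemannian_metric A g \<longleftrightarrow>
    (\<forall>c\<in>A. \<forall>y\<in>chart_image c.
       bilinear (g c y) \<and> (\<forall>u v. g c y u v = g c y v u) \<and> (\<forall>u. u \<noteq> 0 \<longrightarrow> g c y u u > 0)) \<and>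
    (\<forall>c\<in>A. \<forall>u v. smooth_on (chart_image c) (\<lambda>y. g c y u v)) \<and>
    (\<forall>c\<in>A. \<forall>c'\<in>A. \<forall>x\<in>fst c \<inter> fst c'. \<forall>u v.
       g c (snd c x) u v = g c' (snd c' x) (transition_deriv c c' x u) (transition_deriv c c' x v))"


section \<open>Differential forms\<close>

text \<open>
  An alternating \<open>k\<close>-linear form takes its arguments as a sequence, of which only the first
  \<open>k\<close> entries matter.
\<close>

definition alternating_form :: "nat \<Rightarrow> ((nat \<Rightarrow> real ^ 'n::finite) \<Rightarrow> real) \<Rightarrow> bool"
  where "alternating_form k w \<longleftrightarrow>
    (\<forall>v v'. (\<forall>i<k. v i = v' i) \<longrightarrow> w v = w v') \<and>
    (\<forall>v. \<forall>i<k. linear (\<lambda>u. w (v(i := u)))) \<and>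
    (\<forall>v. \<forall>i<k. \<forall>j<k. i \<noteq> j \<and> v i = v j \<longrightarrow> w v = 0)"

type_synonym ('a, 'n) form = "('a, 'n) chart \<Rightarrow> real ^ 'n \<Rightarrow> (nat \<Rightarrow> real ^ 'n) \<Rightarrow> real"

text \<open>
  The representation of a form is normalised to be \<open>0\<close> where it carries no information, so that
  equality and the vector space operations on forms are those of the function type.
\<close>

definition smooth_forms :: "('a, 'n::finite) chart set \<Rightarrow> nat \<Rightarrow> ('a, 'n) form set"
  where "smooth_forms A k = {\<omega>.
    (\<forall>c y. c \<notin> A \<or> y \<notin> chart_image c \<longrightarrow> \<omega> c y = 0) \<and>
    (\<forall>c\<in>A. \<forall>y\<in>chart_image c. alternating_form k (\<omega> c y)) \<and>
    (\<forall>c\<in>A. \<forall>v. smooth_on (chart_image c) (\<lambda>y. \<omega> c y v)) \<and>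
    (\<forall>c\<in>A. \<forall>c'\<in>A. \<forall>x\<in>fst c \<inter> fst c'. \<forall>v.
       \<omega> c (snd c x) v = \<omega> c' (snd c' x) (\<lambda>i. transition_deriv c c' x (v i)))}"

text \<open>
  In coordinates,
  \<open>(d\<omega>)\<^sub>y(v\<^sub>0, \<dots>, v\<^sub>k) = \<Sum>\<^sub>i (-1)^i D\<^sub>y(\<omega>(v\<^sub>0, \<dots>, v\<^sub>i omitted, \<dots>, v\<^sub>k))(v\<^sub>i)\<close>
  for a \<open>k\<close>-form \<open>\<omega>\<close>.
\<close>

definition ext_deriv :: "('a, 'n::finite) chart set \<Rightarrow> nat \<Rightarrow> ('a, 'n) form \<Rightarrow> ('a, 'n) form"
  where "ext_deriv A k \<omega> = (\<lambda>c y v.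
    if c \<in> A \<and> y \<in> chart_image c
    then \<Sum>i\<le>k. (-1) ^ i *
           frechet_derivative (\<lambda>z. \<omega> c z (\<lambda>j. if j < i then v j else v (Suc j))) (at y) (v i)
    else 0)"

definition form_support ::
    "'a topology \<Rightarrow> ('a, 'n::finite) chart set \<Rightarrow> ('a, 'n) form \<Rightarrow> 'a set"
  where "form_support X A \<omega> =
    X closure_of {x \<in> topspace X. \<exists>c\<in>A. x \<in> fst c \<and> \<omega> c (snd c x) \<noteq> 0}"

definition test_forms ::
    "'a topology \<Rightarrow> ('a, 'n::finite) chart set \<Rightarrow> nat \<Rightarrow> ('a, 'n) form set"
  where "test_forms X A k = {\<omega> \<in> smooth_forms A k. compactin X (form_support X A \<omega>)}"


section \<open>Currents\<close>

text \<open>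
  For compact \<open>K\<close>, the forms with support in \<open>K\<close> carry the topology of uniform convergence of
  all derivatives of all coefficients on compact subsets of charts.
\<close>

definition zero_nhd_in ::
    "'a topology \<Rightarrow> ('a, 'n::finite) chart set \<Rightarrow> nat \<Rightarrow> 'a set \<Rightarrow> ('a, 'n) form set \<Rightarrow> bool"
  where "zero_nhd_in X A k K W \<longleftrightarrow>
    (\<exists>F \<epsilon>. finite F \<and> \<epsilon> > 0 \<and>
       (\<forall>(c, L, us, v)\<in>F. c \<in> A \<and> compact L \<and> L \<subseteq> chart_image c) \<and>
       {\<omega> \<in> smooth_forms A k. form_support X A \<omega> \<subseteq> K \<and>
          (\<forall>(c, L, us, v)\<in>F. \<forall>y\<in>L. \<bar>iter_deriv us (\<lambda>z. \<omega> c z v) y\<bar> < \<epsilon>)} \<subseteq> W)"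

text \<open>
  The space of test forms carries the locally convex inductive limit topology: the convex
  balanced neighbourhoods of \<open>0\<close> are the convex balanced sets that trace a neighbourhood
  of \<open>0\<close> on the forms supported in \<open>K\<close>, for every compact \<open>K\<close>.
\<close>

definition convex_zero_nhds ::
    "'a topology \<Rightarrow> ('a, 'n::finite) chart set \<Rightarrow> nat \<Rightarrow> ('a, 'n) form set set"
  where "convex_zero_nhds X A k = {W. W \<subseteq> test_forms X A k \<and> convex W \<and>
    (\<forall>a::real. \<bar>a\<bar> \<le> 1 \<longrightarrow> (\<lambda>\<omega>. a *\<^sub>R \<omega>) ` W \<subseteq> W) \<and>
    (\<forall>K. compactin X K \<longrightarrow> zero_nhd_in X A k K W)}"

definition test_topology ::
    "'a topology \<Rightarrow> ('a, 'n::finite) chart set \<Rightarrow> nat \<Rightarrow> ('a, 'n) form topology"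
  where "test_topology X A k = topology (\<lambda>U. U \<subseteq> test_forms X A k \<and>
    (\<forall>\<omega>\<in>U. \<exists>W\<in>convex_zero_nhds X A k. (\<lambda>\<eta>. \<omega> + \<eta>) ` W \<subseteq> U))"

lemma zero_nhd_in_Int:
  assumes "zero_nhd_in X A k K W" "zero_nhd_in X A k K W'"
  shows "zero_nhd_in X A k K (W \<inter> W')"
proof -
  from assms(1) obtain F \<epsilon> where F: "finite F" "\<epsilon> > 0"
      "\<forall>(c, L, us, v)\<in>F. c \<in> A \<and> compact L \<and> L \<subseteq> chart_image c"
      "{\<omega> \<in> smooth_forms A k. form_support X A \<omega> \<subseteq> K \<and>
          (\<forall>(c, L, us, v)\<in>F. \<forall>y\<in>L. \<bar>iter_deriv us (\<lambda>z. \<omega> c z v) y\<bar> < \<epsilon>)} \<subseteq> W"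
    unfolding zero_nhd_in_def by blast
  from assms(2) obtain G \<delta> where G: "finite G" "\<delta> > 0"
      "\<forall>(c, L, us, v)\<in>G. c \<in> A \<and> compact L \<and> L \<subseteq> chart_image c"
      "{\<omega> \<in> smooth_forms A k. form_support X A \<omega> \<subseteq> K \<and>
          (\<forall>(c, L, us, v)\<in>G. \<forall>y\<in>L. \<bar>iter_deriv us (\<lambda>z. \<omega> c z v) y\<bar> < \<delta>)} \<subseteq> W'"
    unfolding zero_nhd_in_def by blast
  have "{\<omega> \<in> smooth_forms A k. form_support X A \<omega> \<subseteq> K \<and>
          (\<forall>(c, L, us, v)\<in>F \<union> G. \<forall>y\<in>L. \<bar>iter_deriv us (\<lambda>z. \<omega> c z v) y\<bar> < min \<epsilon> \<delta>)} \<subseteq> W \<inter> W'"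
    by (rule Int_greatest; rule subset_trans[OF _ F(4)] subset_trans[OF _ G(4)]) fastforce+
  moreover have "\<forall>(c, L, us, v)\<in>F \<union> G. c \<in> A \<and> compact L \<and> L \<subseteq> chart_image c"
    using F(3) G(3) by blast
  ultimately show ?thesis
    unfolding zero_nhd_in_def
    by (intro exI[of _ "F \<union> G"] exI[of _ "min \<epsilon> \<delta>"]) (use F(1,2) G(1,2) in auto)
qed

lemma convex_zero_nhds_Int:
  assumes "W \<in> convex_zero_nhds X A k" "W' \<in> convex_zero_nhds X A k"
  shows "W \<inter> W' \<in> convex_zero_nhds X A k"
  using assms unfolding convex_zero_nhds_def
  by (auto intro!: convex_Int zero_nhd_in_Int simp: image_subset_iff)

lemma openin_test_topology:
  "openin (test_topology X A k) U \<longleftrightarrow> U \<subseteq> test_forms X A k \<and>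
    (\<forall>\<omega>\<in>U. \<exists>W\<in>convex_zero_nhds X A k. (\<lambda>\<eta>. \<omega> + \<eta>) ` W \<subseteq> U)"
proof -
  let ?P = "\<lambda>U. U \<subseteq> test_forms X A k \<and>
    (\<forall>\<omega>\<in>U. \<exists>W\<in>convex_zero_nhds X A k. (\<lambda>\<eta>. \<omega> + \<eta>) ` W \<subseteq> U)"
  have "?P (U \<inter> V)" if U: "?P U" and V: "?P V" for U V
  proof (intro conjI ballI)
    show "U \<inter> V \<subseteq> test_forms X A k" using U by blast
    fix \<omega> assume "\<omega> \<in> U \<inter> V"
    then obtain W W' where "W \<in> convex_zero_nhds X A k" "(\<lambda>\<eta>. \<omega> + \<eta>) ` W \<subseteq> U"
      "W' \<in> convex_zero_nhds X A k" "(\<lambda>\<eta>. \<omega> + \<eta>) ` W' \<subseteq> V"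
      using U V by (meson IntD1 IntD2)
    then show "\<exists>W\<in>convex_zero_nhds X A k. (\<lambda>\<eta>. \<omega> + \<eta>) ` W \<subseteq> U \<inter> V"
      by (intro bexI[of _ "W \<inter> W'"] convex_zero_nhds_Int) blast+
  qed
  moreover have "?P (\<Union>\<U>)" if \<U>: "\<forall>U\<in>\<U>. ?P U" for \<U>
  proof (intro conjI ballI)
    show "\<Union>\<U> \<subseteq> test_forms X A k" using \<U> by blast
    fix \<omega> assume "\<omega> \<in> \<Union>\<U>"
    then obtain U where U: "U \<in> \<U>" "\<omega> \<in> U" by blast
    with \<U> obtain W where "W \<in> convex_zero_nhds X A k" "(\<lambda>\<eta>. \<omega> + \<eta>) ` W \<subseteq> U" by meson
    with U show "\<exists>W\<in>convex_zero_nhds X A k. (\<lambda>\<eta>. \<omega> + \<eta>) ` W \<subseteq> \<Union>\<U>" by blast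
  qed
  ultimately have "istopology ?P" unfolding istopology_def by blast
  then show ?thesis unfolding test_topology_def by (simp add: topology_inverse')
qed

text \<open>Currents are extensional, so that equality of currents is equality of functions.\<close>

definition currents ::
    "'a topology \<Rightarrow> ('a, 'n::finite) chart set \<Rightarrow> nat \<Rightarrow> (('a, 'n) form \<Rightarrow> real) set"
  where "currents X A k = {T \<in> extensional (test_forms X A k).
    (\<forall>\<omega>\<in>test_forms X A k. \<forall>\<eta>\<in>test_forms X A k. T (\<omega> + \<eta>) = T \<omega> + T \<eta>) \<and>
    (\<forall>\<omega>\<in>test_forms X A k. \<forall>a::real. T (a *\<^sub>R \<omega>) = a * T \<omega>) \<and>
    continuous_map (test_topology X A k) euclideanreal T}"

text \<open>The boundary of a current of dimension \<open>k + 1\<close>.\<close>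

definition boundary ::
    "'a topology \<Rightarrow> ('a, 'n::finite) chart set \<Rightarrow> nat \<Rightarrow>
      (('a, 'n) form \<Rightarrow> real) \<Rightarrow> ('a, 'n) form \<Rightarrow> real"
  where "boundary X A k T = restrict (\<lambda>\<alpha>. T (ext_deriv A k \<alpha>)) (test_forms X A k)"


section \<open>Comass, mass, calibrations and positivity\<close>

text \<open>
  A simple \<open>p\<close>-vector \<open>v\<^sub>0 \<and> \<dots> \<and> v\<^sub>p\<^sub>-\<^sub>1\<close> is represented by its factors; its squared norm is
  the Gram determinant of the factors, and a \<open>p\<close>-form is evaluated on it by evaluation on the
  factors.
\<close>

definition gram_det ::
    "('a, 'n::finite) metric_field \<Rightarrow> nat \<Rightarrow> ('a, 'n) chart \<Rightarrow> real ^ 'n \<Rightarrow>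
      (nat \<Rightarrow> real ^ 'n) \<Rightarrow> real"
  where "gram_det g p c y v =
    (\<Sum>\<sigma> | \<sigma> permutes {..<p}. of_int (sign \<sigma>) * (\<Prod>i<p. g c y (v i) (v (\<sigma> i))))"

definition unit_simple ::
    "('a, 'n::finite) metric_field \<Rightarrow> nat \<Rightarrow> ('a, 'n) chart \<Rightarrow> real ^ 'n \<Rightarrow>
      (nat \<Rightarrow> real ^ 'n) set"
  where "unit_simple g p c y = {v. gram_det g p c y v = 1}"

text \<open>
  Since the negative of a unit simple vector is again one (for \<open>p > 0\<close>), no absolute value is
  needed.
\<close>

definition comass_le_one ::
    "('a, 'n::finite) chart set \<Rightarrow> ('a, 'n) metric_field \<Rightarrow> nat \<Rightarrow> ('a, 'n) form \<Rightarrow> bool"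
  where "comass_le_one A g p \<psi> \<longleftrightarrow>
    (\<forall>c\<in>A. \<forall>y\<in>chart_image c. \<forall>v\<in>unit_simple g p c y. \<psi> c y v \<le> 1)"

definition mass ::
    "'a topology \<Rightarrow> ('a, 'n::finite) chart set \<Rightarrow> ('a, 'n) metric_field \<Rightarrow> nat \<Rightarrow>
      (('a, 'n) form \<Rightarrow> real) \<Rightarrow> ereal"
  where "mass X A g p T = (SUP \<psi>\<in>{\<psi> \<in> test_forms X A p. comass_le_one A g p \<psi>}. ereal (T \<psi>))"

definition calibrated_manifold ::
    "'a topology \<Rightarrow> ('a, 'n::finite) chart set \<Rightarrow> ('a, 'n) metric_field \<Rightarrow> nat \<Rightarrow>
      ('a, 'n) form \<Rightarrow> bool"
  where "calibrated_manifold X A g p \<phi> \<longleftrightarrow>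
    oriented_manifold X A \<and> riemannian_metric A g \<and>
    \<phi> \<in> smooth_forms A p \<and> ext_deriv A p \<phi> = 0 \<and> comass_le_one A g p \<phi>"

definition phi_planes ::
    "('a, 'n::finite) metric_field \<Rightarrow> nat \<Rightarrow> ('a, 'n) form \<Rightarrow> ('a, 'n) chart \<Rightarrow> real ^ 'n \<Rightarrow>
      (nat \<Rightarrow> real ^ 'n) set"
  where "phi_planes g p \<phi> c y = {\<xi> \<in> unit_simple g p c y. \<phi> c y \<xi> = 1}"

definition positive_form ::
    "('a, 'n::finite) chart set \<Rightarrow> ('a, 'n) metric_field \<Rightarrow> nat \<Rightarrow> ('a, 'n) form \<Rightarrow>
      ('a, 'n) form \<Rightarrow> bool"
  where "positive_form A g p \<phi> \<beta> \<longleftrightarrow> \<beta> \<in> smooth_forms A p \<and>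
    (\<forall>c\<in>A. \<forall>y\<in>chart_image c. \<forall>\<xi>\<in>phi_planes g p \<phi> c y. \<beta> c y \<xi> \<ge> 0)"

definition positive_current ::
    "'a topology \<Rightarrow> ('a, 'n::finite) chart set \<Rightarrow> ('a, 'n) metric_field \<Rightarrow> nat \<Rightarrow>
      ('a, 'n) form \<Rightarrow> (('a, 'n) form \<Rightarrow> real) \<Rightarrow> bool"
  where "positive_current X A g p \<phi> T \<longleftrightarrow> T \<in> currents X A p \<and>
    (\<forall>\<beta>\<in>test_forms X A p. positive_form A g p \<phi> \<beta> \<longrightarrow> T \<beta> \<ge> 0)"

end

theory Submission
  imports Defs
begin

text \<open>
  The two directions are of very different nature.

  Suppose \<open>S = \<partial>T\<close> with \<open>T\<close> positive of mass at most \<open>lam\<close>, and let \<open>d\<alpha> + \<phi>\<close> be positive.  The form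
  \<open>\<phi>\<close> need not have compact support, so \<open>T\<close> cannot be applied to \<open>d\<alpha> + \<phi>\<close> directly.  Take a cutoff
  function \<open>\<rho>\<close> with values in \<open>[0, 1]\<close> that is \<open>1\<close> on the support of \<open>\<alpha>\<close>.  Then
  \<open>\<rho>(d\<alpha> + \<phi>) = d\<alpha> + \<rho>\<phi>\<close> is a positive test form and \<open>\<rho>\<phi>\<close> has comass at most one, whence
  \<open>S(\<alpha>) = T(d\<alpha>) \<ge> - T(\<rho>\<phi>) \<ge> - lam\<close> (\<open>positive_form_cutoff\<close>, \<open>boundary_lower_bound\<close>).

  Conversely, \<open>T\<close> is found by the Hahn-Banach theorem (\<open>positive_current_with_boundary\<close>).  A linear
  functional \<open>T\<close> is nonnegative on positive forms and at most \<open>lam\<close> on forms of comass at most one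
  exactly if it is dominated by the sublinear functional that sends \<open>\<psi>\<close> to the infimum of
  \<open>lam * comass (\<psi> + \<beta>)\<close> over the positive test forms \<open>\<beta>\<close>.  So one has to extend the prescribed values
  \<open>T(d\<alpha>) = S(\<alpha>)\<close>, and what is needed is \<open>S(\<alpha>) \<le> lam * comass (d\<alpha> + \<beta>)\<close>.  After rescaling,
  \<open>lam * comass (d\<alpha> + \<beta>) \<le> lam\<close>; on a \<open>\<phi>\<close>-plane \<open>\<phi>\<close> takes the value \<open>1\<close>, so there
  \<open>\<phi> - d\<alpha> \<ge> \<beta> \<ge> 0\<close>, and the hypothesis applied to \<open>-\<alpha>\<close> gives \<open>S(\<alpha>) \<le> lam\<close>
  (\<open>dominated_on_exact_forms\<close>).  That \<open>S(\<alpha>)\<close> depends only on \<open>d\<alpha>\<close> is part of this inequality.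

  Three pieces of analysis carry this argument.  The exterior derivative has to map test forms to test
  forms; its compatibility with the transition maps rests on the symmetry of second derivatives
  (\<open>local_ext_deriv_pullback\<close>).  Cutoff functions are built from \<open>exp (-1/t)\<close> (\<open>cutoff\<close>).  Finally, the
  comass of a form with support in a fixed compact set is controlled by finitely many of its
  coefficients (\<open>comass_controlled_by_coefficients\<close>): this makes the dominating functional finite, and
  makes a functional that is bounded on the comass unit ball continuous.
\<close>

section \<open>Calculus of \<open>C\<^sup>k\<close> maps\<close>

lemma frechet_derivative_cong_open:
  assumes "open S" "x \<in> S" "\<And>y. y \<in> S \<Longrightarrow> f y = g y"
  shows "frechet_derivative f (at x) = frechet_derivative g (at x)"
proof -
  have "(f has_derivative D) (at x) \<longleftrightarrow> (g has_derivative D) (at x)" for D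
    using assms has_derivative_transform_within_open[of f D x UNIV S g]
      has_derivative_transform_within_open[of g D x UNIV S f] by auto
  then show ?thesis unfolding frechet_derivative_def by simp
qed

lemma differentiable_cong_open:
  assumes "open S" "x \<in> S" "\<And>y. y \<in> S \<Longrightarrow> f y = g y" "f differentiable (at x)"
  shows "g differentiable (at x)"
  using assms unfolding differentiable_def
  by (metis has_derivative_transform_within_open)

lemma ck_on_cong:
  assumes "open S" "\<And>y. y \<in> S \<Longrightarrow> f y = g y" "ck_on k S f"
  shows "ck_on k S g"
  using assms(2,3)
proof (induction k arbitrary: f g)
  case 0
  then show ?case by (metis ck_on.simps(1) continuous_on_cong)
next
  case (Suc k)
  have "g differentiable (at x)" if "x \<in> S" for x
    using differentiable_cong_open[OF assms(1) that, of f g] Suc.prems that by simp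
  moreover have "ck_on k S (\<lambda>x. frechet_derivative g (at x) u)" for u
  proof (rule Suc.IH)
    show "ck_on k S (\<lambda>x. frechet_derivative f (at x) u)" using Suc.prems by simp
    show "frechet_derivative f (at x) u = frechet_derivative g (at x) u" if "x \<in> S" for x
      using frechet_derivative_cong_open[OF assms(1) that, of f g] Suc.prems(1) by simp
  qed
  ultimately show ?case by simp
qed

lemma ck_on_SucI:
  assumes "open S" "\<And>x. x \<in> S \<Longrightarrow> (f has_derivative D x) (at x)" "\<And>u. ck_on k S (\<lambda>x. D x u)"
  shows "ck_on (Suc k) S f"
proof -
  have "frechet_derivative f (at x) = D x" if "x \<in> S" for x
    using assms(2)[OF that] frechet_derivative_at by metis
  then have "ck_on k S (\<lambda>x. frechet_derivative f (at x) u)" for u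
    by (intro ck_on_cong[OF assms(1) _ assms(3)[of u]]) simp
  then show ?thesis using assms(2) by (auto simp: differentiable_def)
qed

lemma ck_on_SucD:
  assumes "ck_on (Suc k) S f"
  shows "x \<in> S \<Longrightarrow> (f has_derivative frechet_derivative f (at x)) (at x)"
    and "ck_on k S (\<lambda>x. frechet_derivative f (at x) u)"
  using assms by (auto simp: frechet_derivative_works)

lemma ck_on_Suc_imp: "ck_on (Suc k) S f \<Longrightarrow> ck_on k S f"
proof (induction k arbitrary: f)
  case 0
  then show ?case
    by (auto intro!: continuous_at_imp_continuous_on differentiable_imp_continuous_within)
next
  case (Suc k)
  have "ck_on k S (\<lambda>x. frechet_derivative f (at x) u)" for u
    using Suc.IH Suc.prems ck_on.simps(2) by blast
  then show ?case using Suc.prems by simp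
qed

lemma ck_on_subset: "ck_on k S f \<Longrightarrow> T \<subseteq> S \<Longrightarrow> ck_on k T f"
  by (induction k arbitrary: f) (auto intro: continuous_on_subset)

lemma ck_on_Un:
  assumes "open S" "open T" "ck_on k S f" "ck_on k T f"
  shows "ck_on k (S \<union> T) f"
  using assms(3,4)
  by (induction k arbitrary: f) (auto intro: continuous_on_open_Un assms(1,2))

lemma ck_on_const: "ck_on k S (\<lambda>x. c)"
  by (induction k arbitrary: c) auto

lemma ck_on_add:
  assumes "open S" "ck_on k S f" "ck_on k S g"
  shows "ck_on k S (\<lambda>x. f x + g x)"
  using assms(2,3)
proof (induction k arbitrary: f g)
  case 0
  then show ?case by (simp add: continuous_on_add)
next
  case (Suc k)
  show ?case
    by (rule ck_on_SucI[OF assms(1) has_derivative_add[OF ck_on_SucD(1)[OF Suc.prems(1)]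
      ck_on_SucD(1)[OF Suc.prems(2)]]]) (auto intro!: Suc.IH ck_on_SucD(2)[OF Suc.prems(1)] ck_on_SucD(2)[OF Suc.prems(2)])
qed

lemma ck_on_sum:
  assumes "open S" "\<And>i. i \<in> I \<Longrightarrow> ck_on k S (f i)"
  shows "ck_on k S (\<lambda>x. \<Sum>i\<in>I. f i x)"
  using assms(2)
  by (induction I rule: infinite_finite_induct) (auto intro!: ck_on_const ck_on_add assms(1))

lemma ck_on_bounded_linear:
  assumes "open S" "bounded_linear h" "ck_on k S f"
  shows "ck_on k S (\<lambda>x. h (f x))"
  using assms(3)
proof (induction k arbitrary: f)
  case 0
  then show ?case by (simp add: assms(2) bounded_linear.continuous_on)
next
  case (Suc k)
  show ?case
    by (rule ck_on_SucI[OF assms(1) bounded_linear.has_derivative[OF assms(2) ck_on_SucD(1)[OF Suc.prems]]])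
      (auto intro!: Suc.IH ck_on_SucD(2)[OF Suc.prems])
qed

lemma ck_on_mult:
  fixes f g :: "'a::euclidean_space \<Rightarrow> real"
  assumes "open S" "ck_on k S f" "ck_on k S g"
  shows "ck_on k S (\<lambda>x. f x * g x)"
  using assms(2,3)
proof (induction k arbitrary: f g)
  case 0
  then show ?case by (simp add: continuous_on_mult)
next
  case (Suc k)
  show ?case
    by (rule ck_on_SucI[OF assms(1) has_derivative_mult[OF ck_on_SucD(1)[OF Suc.prems(1)]
      ck_on_SucD(1)[OF Suc.prems(2)]]])
     (auto intro!: ck_on_add[OF assms(1)] Suc.IH ck_on_SucD(2)[OF Suc.prems(1)] ck_on_SucD(2)[OF Suc.prems(2)]
        ck_on_Suc_imp[OF Suc.prems(1)] ck_on_Suc_imp[OF Suc.prems(2)])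
qed

lemma ck_on_ident: "ck_on k S (\<lambda>x. x)"
proof (cases k)
  case (Suc j)
  have "ck_on (Suc j) UNIV (\<lambda>x::'a. x)"
    by (rule ck_on_SucI[OF _ has_derivative_ident]) (auto intro: ck_on_const)
  then show ?thesis using ck_on_subset Suc by blast
qed (simp add: continuous_on_id)

text \<open>
  Expanding the inner derivative in the standard basis writes each directional derivative of a
  composition as a sum of products of a coefficient and a directional derivative of the outer map,
  again composed with the inner one; hence the induction varies the outer map.
\<close>
lemma ck_on_compose:
  fixes f :: "'b::euclidean_space \<Rightarrow> 'c::euclidean_space" and h :: "'a::euclidean_space \<Rightarrow> 'b"
  assumes "open S" "\<And>x. x \<in> S \<Longrightarrow> h x \<in> T" "ck_on k T f" "ck_on k S h"
  shows "ck_on k S (\<lambda>x. f (h x))"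
  using assms(3,4)
proof (induction k arbitrary: f)
  case 0
  then show ?case using assms(2) by (auto intro: continuous_on_compose2)
next
  case (Suc k)
  have lin: "linear (frechet_derivative f (at (h x)))" if "x \<in> S" for x
    using Suc.prems(1) assms(2)[OF that] by (intro linear_frechet_derivative) simp
  have der: "((\<lambda>x. f (h x)) has_derivative
      (\<lambda>u. \<Sum>b\<in>Basis. (frechet_derivative h (at x) u \<bullet> b) *\<^sub>R frechet_derivative f (at (h x)) b)) (at x)"
    if "x \<in> S" for x
  proof -
    have "((\<lambda>x. f (h x)) has_derivative
        (\<lambda>u. frechet_derivative f (at (h x)) (frechet_derivative h (at x) u))) (at x)"
      using has_derivative_compose[OF ck_on_SucD(1)[OF Suc.prems(2) that]
        ck_on_SucD(1)[OF Suc.prems(1) assms(2)[OF that]]] .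
    moreover have eq: "frechet_derivative f (at (h x)) w =
        (\<Sum>b\<in>Basis. (w \<bullet> b) *\<^sub>R frechet_derivative f (at (h x)) b)" for w
    proof -
      have "frechet_derivative f (at (h x)) w =
          frechet_derivative f (at (h x)) (\<Sum>b\<in>Basis. (w \<bullet> b) *\<^sub>R b)"
        by (simp add: euclidean_representation)
      also have "\<dots> = (\<Sum>b\<in>Basis. (w \<bullet> b) *\<^sub>R frechet_derivative f (at (h x)) b)"
        by (simp only: linear_sum[OF lin[OF that]] linear_scale[OF lin[OF that]])
      finally show ?thesis .
    qed
    ultimately show ?thesis by (subst (asm) eq)
  qed
  have "ck_on k S (\<lambda>x. (frechet_derivative h (at x) u \<bullet> b) *\<^sub>R frechet_derivative f (at (h x)) b)" for u b
  proof -
    have 1: "ck_on k S (\<lambda>x. frechet_derivative h (at x) u \<bullet> b)"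
      by (rule ck_on_bounded_linear[OF assms(1) bounded_linear_inner_left ck_on_SucD(2)[OF Suc.prems(2)]])
    have 2: "ck_on k S (\<lambda>x. frechet_derivative f (at (h x)) b)"
      using Suc.IH[OF ck_on_SucD(2)[OF Suc.prems(1)] ck_on_Suc_imp[OF Suc.prems(2)]] .
    have 3: "ck_on k S (\<lambda>x. ((frechet_derivative h (at x) u \<bullet> b) * (frechet_derivative f (at (h x)) b \<bullet> e)) *\<^sub>R e)" for e
      by (rule ck_on_bounded_linear[OF assms(1) bounded_linear_scaleR_left])
        (intro ck_on_mult assms(1) 1 ck_on_bounded_linear[OF assms(1) bounded_linear_inner_left 2])
    have "ck_on k S (\<lambda>x. \<Sum>e\<in>Basis. ((frechet_derivative h (at x) u \<bullet> b) * (frechet_derivative f (at (h x)) b \<bullet> e)) *\<^sub>R e)"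
      by (intro ck_on_sum assms(1) 3)
    then show ?thesis
      by (rule ck_on_cong[OF assms(1), rotated])
        (simp add: scaleR_scaleR[symmetric] scaleR_sum_right[symmetric] euclidean_representation del: scaleR_scaleR)
  qed
  then have sm: "ck_on k S (\<lambda>x. \<Sum>b\<in>Basis. (frechet_derivative h (at x) u \<bullet> b) *\<^sub>R frechet_derivative f (at (h x)) b)" for u
    by (intro ck_on_sum assms(1))
  show ?case
    by (rule ck_on_SucI[OF assms(1) der sm])
qed

lemma smooth_on_open_cong:
  assumes "open S" "\<And>y. y \<in> S \<Longrightarrow> f y = g y" "smooth_on S f"
  shows "smooth_on S g"
  using assms ck_on_cong unfolding smooth_on_def by blast

lemma smooth_onD:
  assumes "smooth_on S f"
  shows "x \<in> S \<Longrightarrow> f differentiable (at x)"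
    and "smooth_on S (\<lambda>x. frechet_derivative f (at x) u)"
    and "continuous_on S f"
proof -
  have 1: "ck_on (Suc k) S f" for k using assms unfolding smooth_on_def by blast
  show "x \<in> S \<Longrightarrow> f differentiable (at x)" using 1[of 0] by simp
  show "smooth_on S (\<lambda>x. frechet_derivative f (at x) u)"
    unfolding smooth_on_def using ck_on_SucD(2)[OF 1] by blast
  show "continuous_on S f" using ck_on_Suc_imp[OF 1[of 0]] by simp
qed

section \<open>Symmetry of second derivatives and the product rule\<close>

lemma has_derivative_along_line:
  assumes "f differentiable (at (x + s *\<^sub>R u))"
  shows "((\<lambda>s. f (x + s *\<^sub>R u)) has_derivative
      (\<lambda>r. r *\<^sub>R frechet_derivative f (at (x + s *\<^sub>R u)) u)) (at s within I)"
proof -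
  have 1: "((\<lambda>s. x + s *\<^sub>R u) has_derivative (\<lambda>r. r *\<^sub>R u)) (at s within I)"
    by (auto intro!: derivative_eq_intros)
  have "(f has_derivative frechet_derivative f (at (x + s *\<^sub>R u))) (at (x + s *\<^sub>R u))"
    using assms by (simp add: frechet_derivative_works)
  from has_derivative_compose[OF 1 this]
  show ?thesis
    using linear_scale[OF linear_frechet_derivative[OF assms]] by simp
qed

text \<open>
  The mean value theorem, applied in the direction \<open>u\<close> and then in the direction \<open>v\<close>, finds a mixed
  second derivative in the second difference.  The second difference is symmetric in \<open>u\<close> and \<open>v\<close>, and
  so letting \<open>h\<close> tend to zero will identify the two mixed derivatives.
\<close>
lemma second_difference_mean_value:
  fixes f :: "'a::euclidean_space \<Rightarrow> real"
  assumes f: "ck_on 2 S f" and h: "h > 0"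
    and S: "\<And>s t. 0 \<le> s \<Longrightarrow> s \<le> h \<Longrightarrow> 0 \<le> t \<Longrightarrow> t \<le> h \<Longrightarrow> x + s *\<^sub>R u + t *\<^sub>R v \<in> S"
  shows "\<exists>s t. 0 \<le> s \<and> s \<le> h \<and> 0 \<le> t \<and> t \<le> h \<and>
    f (x + h *\<^sub>R u + h *\<^sub>R v) - f (x + h *\<^sub>R u) - f (x + h *\<^sub>R v) + f x =
    h * h * frechet_derivative (\<lambda>z. frechet_derivative f (at z) u) (at (x + s *\<^sub>R u + t *\<^sub>R v)) v"
proof -
  have d1: "f differentiable (at z)" if "z \<in> S" for z using f that by (simp add: numeral_2_eq_2)
  have d2: "(\<lambda>z. frechet_derivative f (at z) u) differentiable (at z)" if "z \<in> S" for z
    using f that by (simp add: numeral_2_eq_2)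
  let ?g = "\<lambda>s. f ((x + h *\<^sub>R v) + s *\<^sub>R u) - f (x + s *\<^sub>R u)"
  let ?g' = "\<lambda>s r. r *\<^sub>R frechet_derivative f (at ((x + h *\<^sub>R v) + s *\<^sub>R u)) u
      - r *\<^sub>R frechet_derivative f (at (x + s *\<^sub>R u)) u"
  have "\<exists>s\<in>{0<..<h}. ?g h - ?g 0 = ?g' s (h - 0)"
  proof (rule mvt_simple[OF h])
    fix s assume s: "0 \<le> s" "s \<le> h"
    have "x + h *\<^sub>R v + s *\<^sub>R u \<in> S" "x + s *\<^sub>R u \<in> S"
      using S[of s h] S[of s 0] s h by (auto simp: algebra_simps)
    then show "(?g has_derivative ?g' s) (at s within {0..h})"
      by (intro has_derivative_diff has_derivative_along_line d1)
  qed
  then obtain s where s: "0 < s" "s < h" "?g h - ?g 0 = ?g' s h" by auto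
  let ?k = "\<lambda>t. frechet_derivative f (at ((x + s *\<^sub>R u) + t *\<^sub>R v)) u"
  let ?k' = "\<lambda>t r. r *\<^sub>R frechet_derivative (\<lambda>z. frechet_derivative f (at z) u) (at ((x + s *\<^sub>R u) + t *\<^sub>R v)) v"
  have "\<exists>t\<in>{0<..<h}. ?k h - ?k 0 = ?k' t (h - 0)"
  proof (rule mvt_simple[OF h])
    fix t assume t: "0 \<le> t" "t \<le> h"
    have "x + s *\<^sub>R u + t *\<^sub>R v \<in> S" using S[of s t] s t by auto
    from has_derivative_along_line[OF d2[OF this]]
    show "(?k has_derivative ?k' t) (at t within {0..h})" .
  qed
  then obtain t where t: "0 < t" "t < h" "?k h - ?k 0 = ?k' t h" by auto
  have "f (x + h *\<^sub>R u + h *\<^sub>R v) - f (x + h *\<^sub>R u) - f (x + h *\<^sub>R v) + f x = ?g h - ?g 0"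
    by (simp add: algebra_simps)
  also have "\<dots> = h * (?k h - ?k 0)" unfolding s(3) by (simp add: algebra_simps)
  also have "\<dots> = h * ?k' t h" using t(3) by simp
  finally show ?thesis using s t by (intro exI[of _ s] exI[of _ t]) auto
qed

lemma second_derivative_symmetric_real:
  fixes f :: "'a::euclidean_space \<Rightarrow> real"
  assumes f: "ck_on 2 S f" and S: "open S" "x \<in> S"
  shows "frechet_derivative (\<lambda>z. frechet_derivative f (at z) u) (at x) v =
    frechet_derivative (\<lambda>z. frechet_derivative f (at z) v) (at x) u"
proof -
  let ?D = "\<lambda>u v z. frechet_derivative (\<lambda>z. frechet_derivative f (at z) u) (at z) v"
  have cont: "isCont (?D u v) x" for u v
    using f S by (simp add: numeral_2_eq_2 continuous_on_eq_continuous_at)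
  have "dist (?D u v x) (?D v u x) \<le> e + e" if e: "e > 0" for e :: real
  proof -
    obtain d1 where d1: "d1 > 0" "\<And>z. dist z x < d1 \<Longrightarrow> dist (?D u v z) (?D u v x) < e"
      using cont[of u v] e unfolding continuous_at_eps_delta by blast
    obtain d2 where d2: "d2 > 0" "\<And>z. dist z x < d2 \<Longrightarrow> dist (?D v u z) (?D v u x) < e"
      using cont[of v u] e unfolding continuous_at_eps_delta by blast
    obtain d3 where d3: "d3 > 0" "ball x d3 \<subseteq> S" using S open_contains_ball by blast
    define d where "d = min d1 (min d2 d3)"
    have d: "d > 0" using d1 d2 d3 by (simp add: d_def)
    \<comment> \<open>This step keeps the whole parallelogram spanned by \<open>h u\<close> and \<open>h v\<close> within distance \<open>d\<close> of \<open>x\<close>.\<close>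
  define h where "h = d / (2 * (norm u + norm v + 1))"
    have np: "norm u + norm v + 1 > 0" using norm_ge_zero[of u] norm_ge_zero[of v] by linarith
    have h: "h > 0" using d np by (simp add: h_def)
    have near: "dist (x + s *\<^sub>R u + t *\<^sub>R v) x < d" if "0 \<le> s" "s \<le> h" "0 \<le> t" "t \<le> h" for s t
    proof -
      have "dist (x + s *\<^sub>R u + t *\<^sub>R v) x = norm (s *\<^sub>R u + t *\<^sub>R v)" by (simp add: dist_norm)
      also have "\<dots> \<le> s * norm u + t * norm v" 
        using norm_triangle_ineq[of "s *\<^sub>R u" "t *\<^sub>R v"] that by simp
      also have "\<dots> \<le> h * norm u + h * norm v" using that by (intro add_mono mult_right_mono) auto
      also have "\<dots> \<le> h * (norm u + norm v + 1)" using h by (simp add: algebra_simps)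
      also have "\<dots> = d / 2" using np unfolding h_def by (simp add: field_simps)
      also have "\<dots> < d" using d by simp
      finally show ?thesis .
    qed
    have inS: "x + s *\<^sub>R u + t *\<^sub>R v \<in> S" if "0 \<le> s" "s \<le> h" "0 \<le> t" "t \<le> h" for s t
      using near[OF that] d3(2) by (auto simp: d_def dist_commute subset_eq)
    have inS': "x + s *\<^sub>R v + t *\<^sub>R u \<in> S" if "0 \<le> s" "s \<le> h" "0 \<le> t" "t \<le> h" for s t
      using inS[of t s] that by (simp add: algebra_simps)
    from second_difference_mean_value[OF f h inS] obtain s t where st:
      "0 \<le> s" "s \<le> h" "0 \<le> t" "t \<le> h"
      "f (x + h *\<^sub>R u + h *\<^sub>R v) - f (x + h *\<^sub>R u) - f (x + h *\<^sub>R v) + f x =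
        h * h * ?D u v (x + s *\<^sub>R u + t *\<^sub>R v)" by auto
    from second_difference_mean_value[OF f h inS'] obtain s' t' where st':
      "0 \<le> s'" "s' \<le> h" "0 \<le> t'" "t' \<le> h"
      "f (x + h *\<^sub>R v + h *\<^sub>R u) - f (x + h *\<^sub>R v) - f (x + h *\<^sub>R u) + f x =
        h * h * ?D v u (x + s' *\<^sub>R v + t' *\<^sub>R u)" by auto
    have "f (x + h *\<^sub>R v + h *\<^sub>R u) = f (x + h *\<^sub>R u + h *\<^sub>R v)" by (simp add: algebra_simps)
    then have "h * h * ?D u v (x + s *\<^sub>R u + t *\<^sub>R v) = h * h * ?D v u (x + s' *\<^sub>R v + t' *\<^sub>R u)"
      using st(5) st'(5) by linarith
    then have eq: "?D u v (x + s *\<^sub>R u + t *\<^sub>R v) = ?D v u (x + s' *\<^sub>R v + t' *\<^sub>R u)"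
      using h by simp
    have "dist (x + s' *\<^sub>R v + t' *\<^sub>R u) x < d" using near[of t' s'] st' by (simp add: algebra_simps)
    then have "dist (?D v u (x + s' *\<^sub>R v + t' *\<^sub>R u)) (?D v u x) < e" using d2 by (simp add: d_def)
    moreover have "dist (?D u v (x + s *\<^sub>R u + t *\<^sub>R v)) (?D u v x) < e"
      using near[OF st(1-4)] d1 by (simp add: d_def)
    ultimately show ?thesis using eq by (simp add: dist_real_def)
  qed
  then have "dist (?D u v x) (?D v u x) \<le> 0 + e" if "e > 0" for e :: real
    using that by (metis add_0 field_sum_of_halves half_gt_zero)
  then have "dist (?D u v x) (?D v u x) \<le> 0" by (rule field_le_epsilon)
  then show ?thesis by simp
qed

lemma second_derivative_symmetric:
  fixes f :: "'a::euclidean_space \<Rightarrow> 'b::euclidean_space"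
  assumes f: "ck_on 2 S f" and S: "open S" "x \<in> S"
  shows "frechet_derivative (\<lambda>z. frechet_derivative f (at z) u) (at x) v =
    frechet_derivative (\<lambda>z. frechet_derivative f (at z) v) (at x) u"
proof (rule euclidean_eqI)
  fix b :: 'b assume "b \<in> Basis"
  have comp: "frechet_derivative (\<lambda>z. h z \<bullet> b) (at z) w = frechet_derivative h (at z) w \<bullet> b"
    if "h differentiable (at z)" for h :: "'a \<Rightarrow> 'b" and z w
    using bounded_linear.has_derivative[OF bounded_linear_inner_left, of h "frechet_derivative h (at z)" "at z" b]
      that frechet_derivative_at frechet_derivative_works by metis
  have fb: "ck_on 2 S (\<lambda>z. f z \<bullet> b)"
    by (rule ck_on_bounded_linear[OF S(1) bounded_linear_inner_left f])
  have d1: "f differentiable (at z)" if "z \<in> S" for z using f that by (simp add: numeral_2_eq_2)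
  have d2: "(\<lambda>z. frechet_derivative f (at z) u) differentiable (at x)" for u
    using f S by (simp add: numeral_2_eq_2)
  have "frechet_derivative (\<lambda>z. frechet_derivative (\<lambda>z. f z \<bullet> b) (at z) u) (at x) v =
      frechet_derivative (\<lambda>z. frechet_derivative f (at z) u) (at x) v \<bullet> b" for u v
    using frechet_derivative_cong_open[OF S, of "\<lambda>z. frechet_derivative (\<lambda>z. f z \<bullet> b) (at z) u"
        "\<lambda>z. frechet_derivative f (at z) u \<bullet> b"] comp[OF d1] comp[OF d2] by simp
  then show "frechet_derivative (\<lambda>z. frechet_derivative f (at z) u) (at x) v \<bullet> b =
    frechet_derivative (\<lambda>z. frechet_derivative f (at z) v) (at x) u \<bullet> b"
    using second_derivative_symmetric_real[OF fb S] by metis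
qed

lemma linear_expand_basis:
  fixes h :: "'b::euclidean_space \<Rightarrow> real"
  assumes "linear h"
  shows "h w = (\<Sum>b\<in>Basis. (w \<bullet> b) * h b)"
proof -
  have "h w = h (\<Sum>b\<in>Basis. (w \<bullet> b) *\<^sub>R b)" by (simp add: euclidean_representation)
  also have "\<dots> = (\<Sum>b\<in>Basis. (w \<bullet> b) * h b)"
    using assms by (simp add: linear_sum linear_scale)
  finally show ?thesis .
qed

text \<open>
  The product rule for \<open>z \<mapsto> f z (W 0 z, \<dots>, W (k-1) z)\<close>.  Only \<open>f\<close> with constant arguments is known to be
  differentiable, so the arguments \<open>W i\<close> are made to vary one at a time: expanding \<open>W m\<close> in the
  standard basis reduces slot \<open>m\<close> to a constant basis vector and a scalar coefficient, to which the
  ordinary product rule applies.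
\<close>
lemma has_derivative_multilinear:
  fixes f :: "'a::euclidean_space \<Rightarrow> (nat \<Rightarrow> 'b::euclidean_space) \<Rightarrow> real"
    and W :: "nat \<Rightarrow> 'a \<Rightarrow> 'b"
  assumes U: "open U" "y \<in> U"
    and lin: "\<And>z v i. z \<in> U \<Longrightarrow> i < k \<Longrightarrow> linear (\<lambda>u. f z (v(i := u)))"
    and f': "\<And>v. ((\<lambda>z. f z v) has_derivative f' v) (at y)"
    and W': "\<And>i. i < k \<Longrightarrow> (W i has_derivative W' i) (at y)"
  shows "m \<le> k \<Longrightarrow> ((\<lambda>z. f z (\<lambda>i. if i < m then W i z else w i)) has_derivative
    (\<lambda>u. f' (\<lambda>i. if i < m then W i y else w i) u +
      (\<Sum>j<m. f y ((\<lambda>i. if i < m then W i y else w i)(j := W' j u))))) (at y)"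
proof (induction m arbitrary: w)
  case 0
  then show ?case using f' by simp
next
  case (Suc m)
  then have m: "m < k" by simp
  define V where "V = (\<lambda>z i. if i < Suc m then W i z else w i)"
  have V_upd: "(\<lambda>i. if i < m then W i z else (w(m := b)) i) = (V z)(m := b)" for z b
    by (auto simp: V_def)
  have V_m: "V z m = W m z" for z by (simp add: V_def)
  have f'_expand: "f' (V y) u = (\<Sum>b\<in>Basis. (W m y \<bullet> b) * f' ((V y)(m := b)) u)" for u
  proof -
    have "((\<lambda>z. \<Sum>b\<in>Basis. (W m y \<bullet> b) * f z ((V y)(m := b))) has_derivative
        (\<lambda>u. \<Sum>b\<in>Basis. (W m y \<bullet> b) * f' ((V y)(m := b)) u)) (at y)"
      by (intro has_derivative_sum has_derivative_mult_right f')
    moreover have eq: "(\<Sum>b\<in>Basis. (W m y \<bullet> b) * f z ((V y)(m := b))) = f z (V y)" if "z \<in> U" for z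
      using linear_expand_basis[OF lin[OF that m, of "V y"], of "W m y"]
      unfolding V_m[symmetric] fun_upd_triv by simp
    ultimately have "((\<lambda>z. f z (V y)) has_derivative
        (\<lambda>u. \<Sum>b\<in>Basis. (W m y \<bullet> b) * f' ((V y)(m := b)) u)) (at y)"
      by (rule has_derivative_transform_within_open[OF _ U]) (simp only: eq)
    then show ?thesis using has_derivative_unique[OF f'[of "V y"]] by metis
  qed
  have fz_expand: "f z (V z) = (\<Sum>b\<in>Basis. (W m z \<bullet> b) * f z ((V z)(m := b)))" if "z \<in> U" for z
    using linear_expand_basis[OF lin[OF that m, of "V z"], of "W m z"]
    unfolding V_m[symmetric] fun_upd_triv by simp
  have Wb: "((\<lambda>z. W m z \<bullet> b) has_derivative (\<lambda>u. W' m u \<bullet> b)) (at y)" for b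
    by (rule bounded_linear.has_derivative[OF bounded_linear_inner_left W'[OF m]])
  have IH: "((\<lambda>z. f z ((V z)(m := b))) has_derivative
      (\<lambda>u. f' ((V y)(m := b)) u + (\<Sum>j<m. f y ((V y)(m := b, j := W' j u))))) (at y)" for b
    using Suc.IH[of "w(m := b)"] Suc.prems unfolding V_upd by (simp add: fun_upd_def)
  have "((\<lambda>z. \<Sum>b\<in>Basis. (W m z \<bullet> b) * f z ((V z)(m := b))) has_derivative
      (\<lambda>u. \<Sum>b\<in>Basis. (W m y \<bullet> b) * (f' ((V y)(m := b)) u + (\<Sum>j<m. f y ((V y)(m := b, j := W' j u))))
         + (W' m u \<bullet> b) * f y ((V y)(m := b)))) (at y)"
    by (intro has_derivative_sum has_derivative_mult Wb IH)
  then have "((\<lambda>z. f z (V z)) has_derivative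
      (\<lambda>u. \<Sum>b\<in>Basis. (W m y \<bullet> b) * (f' ((V y)(m := b)) u + (\<Sum>j<m. f y ((V y)(m := b, j := W' j u))))
         + (W' m u \<bullet> b) * f y ((V y)(m := b)))) (at y)"
    by (rule has_derivative_transform_within_open[OF _ U]) (simp add: fz_expand)
  moreover have "(\<Sum>b\<in>Basis. (W m y \<bullet> b) * (f' ((V y)(m := b)) u + (\<Sum>j<m. f y ((V y)(m := b, j := W' j u))))
         + (W' m u \<bullet> b) * f y ((V y)(m := b)))
      = f' (V y) u + (\<Sum>j<Suc m. f y ((V y)(j := W' j u)))" for u
  proof -
    have 1: "(\<Sum>b\<in>Basis. (W m y \<bullet> b) * f y ((V y)(m := b, j := W' j u))) = f y ((V y)(j := W' j u))"
      if "j < m" for j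
    proof -
      have e1: "(V y)(j := W' j u, m := W m y) = (V y)(j := W' j u)"
        using that by (auto simp: V_m fun_eq_iff)
      have e2: "(V y)(m := b, j := W' j u) = (V y)(j := W' j u, m := b)" for b
        using that by (simp add: fun_upd_twist)
      show ?thesis
        unfolding e2 using linear_expand_basis[OF lin[OF U(2) m, of "(V y)(j := W' j u)"], of "W m y"]
        unfolding e1 by (rule sym)
    qed
    have 2: "(\<Sum>b\<in>Basis. (W' m u \<bullet> b) * f y ((V y)(m := b))) = f y ((V y)(m := W' m u))"
      by (rule linear_expand_basis[OF lin[OF U(2) m, of "V y"], symmetric])
    have "(\<Sum>b\<in>Basis. (W m y \<bullet> b) * (\<Sum>j<m. f y ((V y)(m := b, j := W' j u)))) =
        (\<Sum>j<m. \<Sum>b\<in>Basis. (W m y \<bullet> b) * f y ((V y)(m := b, j := W' j u)))"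
      unfolding sum_distrib_left by (rule sum.swap)
    also have "\<dots> = (\<Sum>j<m. f y ((V y)(j := W' j u)))" by (intro sum.cong refl 1) simp
    finally show ?thesis
      by (simp add: distrib_left sum.distrib f'_expand 2)
  qed
  ultimately show ?case unfolding V_def by (simp only:)
qed

section \<open>Extension of dominated linear functionals\<close>

lemma subspace_pair_diff:
  assumes "subspace G" "(x, a) \<in> G" "(x, b) \<in> G"
  shows "(0, a - b) \<in> G"
  using subspace_diff[OF assms] by simp

text \<open>
  Partial functionals are represented by their graphs, which are subspaces of \<open>E \<times> \<real>\<close>, and the
  dominating sublinear functional by a convex cone \<open>D\<close> of pairs \<open>(x, s)\<close>, to be read as "its value at
  \<open>x\<close> is at most \<open>s\<close>".  The value \<open>a\<close> at the new point \<open>x0\<close> has to lie above all \<open>b - s\<close> with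
  \<open>(x - x0, s)\<close> in \<open>D\<close> and below all \<open>s - b\<close> with \<open>(x + x0, s)\<close> in \<open>D\<close>; adding the two pairs shows that
  this is possible.
\<close>
lemma dominated_extension_step:
  fixes G D :: "('v::real_vector \<times> real) set"
  assumes E: "subspace E" "x0 \<in> E"
    and D_add: "\<And>x s y t. (x, s) \<in> D \<Longrightarrow> (y, t) \<in> D \<Longrightarrow> (x + y, s + t) \<in> D"
    and D_scale: "\<And>r x s. r > 0 \<Longrightarrow> (x, s) \<in> D \<Longrightarrow> (r *\<^sub>R x, r * s) \<in> D"
    and D_total: "\<And>x. x \<in> E \<Longrightarrow> \<exists>s. (x, s) \<in> D"
    and G: "subspace G" "fst ` G \<subseteq> E" "\<And>x a s. (x, a) \<in> G \<Longrightarrow> (x, s) \<in> D \<Longrightarrow> a \<le> s"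
  shows "\<exists>G'. subspace G' \<and> G \<subseteq> G' \<and> x0 \<in> fst ` G' \<and> fst ` G' \<subseteq> E \<and>
    (\<forall>x a s. (x, a) \<in> G' \<longrightarrow> (x, s) \<in> D \<longrightarrow> a \<le> s)"
proof -
  define L where "L = {b - s |x b s. (x, b) \<in> G \<and> (x - x0, s) \<in> D}"
  have G0: "(0, 0) \<in> G" using subspace_0[OF G(1)] by (simp add: zero_prod_def)
  have up: "l \<le> s - b" if l: "l \<in> L" and b: "(x, b) \<in> G" "(x + x0, s) \<in> D" for l x b s
  proof -
    obtain x' b' s' where l': "l = b' - s'" "(x', b') \<in> G" "(x' - x0, s') \<in> D"
      using l unfolding L_def by blast
    have "(x' + x, b' + b) \<in> G" using subspace_add[OF G(1) l'(2) b(1)] by simp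
    moreover have "(x' + x, s' + s) \<in> D" using D_add[OF l'(3) b(2)] by simp
    ultimately have "b' + b \<le> s' + s" by (rule G(3))
    then show ?thesis using l'(1) by simp
  qed
  obtain s1 where s1: "(0 - x0, s1) \<in> D" using D_total[of "0 - x0"] E subspace_neg by fastforce
  obtain s2 where s2: "(0 + x0, s2) \<in> D" using D_total[of "0 + x0"] E by fastforce
  have L_ne: "L \<noteq> {}" using G0 s1 unfolding L_def by blast
  have L_bdd: "bdd_above L" by (rule bdd_aboveI[OF up[OF _ G0 s2]])
  define a where "a = Sup L"
  have a_up: "a \<le> s - b" if "(x, b) \<in> G" "(x + x0, s) \<in> D" for x b s
    unfolding a_def using cSup_least[OF L_ne] up[OF _ that] by blast
  have a_lo: "b - s \<le> a" if "(x, b) \<in> G" "(x - x0, s) \<in> D" for x b s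
    unfolding a_def using that by (intro cSup_upper L_bdd) (auto simp: L_def)
  define G' where "G' = {w + r *\<^sub>R (x0, a) |w r. w \<in> G}"
  have "subspace G'"
  proof (rule subspaceI)
    have "0 = 0 + 0 *\<^sub>R (x0, a)" by (simp add: zero_prod_def)
    then show "0 \<in> G'" unfolding G'_def using subspace_0[OF G(1)] by blast
    fix y z assume "y \<in> G'" "z \<in> G'"
    then obtain w r w' r' where wr: "y = w + r *\<^sub>R (x0, a)" "w \<in> G" "z = w' + r' *\<^sub>R (x0, a)" "w' \<in> G"
      unfolding G'_def by blast
    have "y + z = (w + w') + (r + r') *\<^sub>R (x0, a)"
      unfolding wr by (simp only: scaleR_left_distrib add.assoc add.left_commute add.commute)
    then show "y + z \<in> G'" unfolding G'_def using subspace_add[OF G(1) wr(2,4)] by blast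
  next
    fix c y assume "y \<in> G'"
    then obtain w r where wr: "y = w + r *\<^sub>R (x0, a)" "w \<in> G" unfolding G'_def by blast
    have "c *\<^sub>R y = c *\<^sub>R w + (c * r) *\<^sub>R (x0, a)" unfolding wr by (simp only: scaleR_right_distrib scaleR_scaleR)
    then show "c *\<^sub>R y \<in> G'" unfolding G'_def using subspace_scale[OF G(1) wr(2)] by blast
  qed
  moreover have "w \<in> G'" if "w \<in> G" for w
  proof -
    have "w = w + 0 *\<^sub>R (x0, a)" by (simp only: scaleR_zero_left add_0_right)
    then show ?thesis unfolding G'_def using that by blast
  qed
  then have "G \<subseteq> G'" by blast
  moreover have "(0, 0) + (1::real) *\<^sub>R (x0, a) \<in> G'" unfolding G'_def using G0 by blast
  then have "x0 \<in> fst ` G'" by force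
  moreover have "fst ` G' \<subseteq> E"
    using G(2) E unfolding G'_def by (force simp: subspace_add subspace_scale)
  moreover have "c \<le> s" if "(z, c) \<in> G'" "(z, s) \<in> D" for z c s
  proof -
    from that(1) obtain x b r where x: "(x, b) \<in> G" "z = x + r *\<^sub>R x0" "c = b + r * a"
      unfolding G'_def by auto
    have sc: "((1/t) *\<^sub>R x, b / t) \<in> G" for t
      using subspace_scale[OF G(1) x(1), of "1/t"] by simp
    consider "r = 0" | "r > 0" | "r < 0" by linarith
    then show ?thesis
    proof cases
      case 1
      then show ?thesis using x that(2) G(3) by simp
    next
      case 2
      have "((1/r) *\<^sub>R x + x0, s / r) \<in> D"
        using D_scale[OF _ that(2), of "1/r"] 2 x(2) by (simp add: scaleR_right_distrib)
      from a_up[OF sc this] have "a \<le> (s - b) / r" by (simp add: diff_divide_distrib)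
      then show ?thesis using 2 x(3) by (simp add: field_simps)
    next
      case 3
      have "((1/(-r)) *\<^sub>R x - x0, s / (-r)) \<in> D"
        using D_scale[OF _ that(2), of "1/(-r)"] 3 x(2) by (simp add: scaleR_right_distrib)
      from a_lo[OF sc this] have "(b - s) / (-r) \<le> a" by (simp add: diff_divide_distrib)
      then show ?thesis using 3 x(3) by (simp add: field_simps)
    qed
  qed
  ultimately show ?thesis by blast
qed

text \<open>
  Zorn's lemma gives a maximal dominated graph, whose domain is \<open>E\<close> by the extension step.  Graphs need
  not be required to be single-valued: since \<open>(0, 0)\<close> is in \<open>D\<close>, a dominated subspace contains no
  \<open>(0, b)\<close> with \<open>b \<noteq> 0\<close>.
\<close>
lemma hahn_banach_cone:
  fixes G0 D :: "('v::real_vector \<times> real) set"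
  assumes E: "subspace E"
    and D_0: "(0, 0) \<in> D"
    and D_add: "\<And>x s y t. (x, s) \<in> D \<Longrightarrow> (y, t) \<in> D \<Longrightarrow> (x + y, s + t) \<in> D"
    and D_scale: "\<And>r x s. r > 0 \<Longrightarrow> (x, s) \<in> D \<Longrightarrow> (r *\<^sub>R x, r * s) \<in> D"
    and D_total: "\<And>x. x \<in> E \<Longrightarrow> \<exists>s. (x, s) \<in> D"
    and G0: "subspace G0" "fst ` G0 \<subseteq> E" "\<And>x a s. (x, a) \<in> G0 \<Longrightarrow> (x, s) \<in> D \<Longrightarrow> a \<le> s"
  obtains T where "\<And>x y. x \<in> E \<Longrightarrow> y \<in> E \<Longrightarrow> T (x + y) = T x + T y"
    "\<And>x r. x \<in> E \<Longrightarrow> T (r *\<^sub>R x) = r * T x"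
    "\<And>x a. (x, a) \<in> G0 \<Longrightarrow> T x = a"
    "\<And>x s. x \<in> E \<Longrightarrow> (x, s) \<in> D \<Longrightarrow> T x \<le> s"
proof -
  define \<A> where "\<A> = {G. subspace G \<and> G0 \<subseteq> G \<and> fst ` G \<subseteq> E \<and>
    (\<forall>x a s. (x, a) \<in> G \<longrightarrow> (x, s) \<in> D \<longrightarrow> a \<le> s)}"
  have "\<exists>M\<in>\<A>. \<forall>G\<in>\<A>. M \<subseteq> G \<longrightarrow> G = M"
  proof (rule subset_Zorn_nonempty)
    show "\<A> \<noteq> {}" using G0 unfolding \<A>_def by blast
    fix C assume C: "C \<noteq> {}" "subset.chain \<A> C"
    have CA: "C \<subseteq> \<A>" and lin: "\<And>G H. G \<in> C \<Longrightarrow> H \<in> C \<Longrightarrow> G \<subseteq> H \<or> H \<subseteq> G"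
      using C(2) unfolding subset_chain_def by blast+
    have C_sub: "subspace G" if "G \<in> C" for G using CA that unfolding \<A>_def by blast
    have "subspace (\<Union>C)"
    proof (rule subspaceI)
      show "0 \<in> \<Union>C" using C(1) subspace_0[OF C_sub] by blast
      fix x y assume "x \<in> \<Union>C" "y \<in> \<Union>C"
      then obtain G where "G \<in> C" "x \<in> G" "y \<in> G" using lin by (meson UnionE subsetD)
      then show "x + y \<in> \<Union>C" using subspace_add[OF C_sub] by blast
    next
      fix c x assume "x \<in> \<Union>C"
      then show "c *\<^sub>R x \<in> \<Union>C" using subspace_scale[OF C_sub] by blast
    qed
    moreover have "G0 \<subseteq> \<Union>C" using C(1) CA unfolding \<A>_def by blast
    moreover have "fst ` \<Union>C \<subseteq> E" using CA unfolding \<A>_def by blast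
    moreover have "\<forall>x a s. (x, a) \<in> \<Union>C \<longrightarrow> (x, s) \<in> D \<longrightarrow> a \<le> s" using CA unfolding \<A>_def by blast
    ultimately show "\<Union>C \<in> \<A>" unfolding \<A>_def by blast
  qed
  then obtain M where M: "M \<in> \<A>" "\<And>G. G \<in> \<A> \<Longrightarrow> M \<subseteq> G \<Longrightarrow> G = M" by blast
  have MA: "subspace M" "G0 \<subseteq> M" "fst ` M \<subseteq> E" "\<And>x a s. (x, a) \<in> M \<Longrightarrow> (x, s) \<in> D \<Longrightarrow> a \<le> s"
    using M(1) unfolding \<A>_def by blast+
  have total: "\<exists>a. (x, a) \<in> M" if x: "x \<in> E" for x
  proof -
    obtain G' where G': "subspace G'" "M \<subseteq> G'" "x \<in> fst ` G'" "fst ` G' \<subseteq> E"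
        "\<forall>x a s. (x, a) \<in> G' \<longrightarrow> (x, s) \<in> D \<longrightarrow> a \<le> s"
      using dominated_extension_step[of E x D M] E x D_add D_scale D_total MA(1,3,4) by blast
    then have "G' \<in> \<A>" using MA(2) unfolding \<A>_def by blast
    then have "G' = M" using M(2) G'(2) by blast
    then show ?thesis using G'(3) by force
  qed
  have unique: "a = b" if "(x, a) \<in> M" "(x, b) \<in> M" for x a b
    using MA(4)[OF subspace_pair_diff[OF MA(1) that] D_0]
      MA(4)[OF subspace_pair_diff[OF MA(1) that(2,1)] D_0] by simp
  define T where "T = (\<lambda>x. THE a. (x, a) \<in> M)"
  have T_eq: "T x = a" if "(x, a) \<in> M" for x a
    unfolding T_def using that unique by blast
  have T_in: "(x, T x) \<in> M" if "x \<in> E" for x using total[OF that] T_eq by metis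
  show thesis
  proof (rule that)
    show "T (x + y) = T x + T y" if "x \<in> E" "y \<in> E" for x y
      using subspace_add[OF MA(1) T_in[OF that(1)] T_in[OF that(2)]] by (intro T_eq) simp
    show "T (r *\<^sub>R x) = r * T x" if "x \<in> E" for x r
      using subspace_scale[OF MA(1) T_in[OF that], of r] by (intro T_eq) simp
    show "T x = a" if "(x, a) \<in> G0" for x a using T_eq that MA(2) by blast
    show "T x \<le> s" if "x \<in> E" "(x, s) \<in> D" for x s using MA(4) T_in that by blast
  qed
qed

section \<open>Bump functions\<close>

text \<open>
  The family \<open>exp (-1/t) / t^n\<close> is closed under differentiation up to linear combinations, which makes
  its smoothness a plain induction.
\<close>
definition exp_recip :: "nat \<Rightarrow> real \<Rightarrow> real"
  where "exp_recip n t = (if t > 0 then exp (- 1 / t) / t ^ n else 0)"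

lemma exp_recip_tendsto_0: "(exp_recip n \<longlongrightarrow> 0) (at 0)"
proof -
  have "((\<lambda>s. s ^ n / exp s) \<longlongrightarrow> (0::real)) at_top" by (rule tendsto_power_div_exp_0)
  from filterlim_compose[OF this filterlim_inverse_at_top_right]
  have "((\<lambda>t. (inverse t) ^ n / exp (inverse t)) \<longlongrightarrow> (0::real)) (at_right 0)" .
  moreover have "\<forall>\<^sub>F t in at_right 0. (inverse t) ^ n / exp (inverse t) = exp_recip n t"
    unfolding eventually_at_right_field
    by (intro exI[of _ 1]) (auto simp: exp_recip_def exp_minus field_simps)
  ultimately have "(exp_recip n \<longlongrightarrow> 0) (at_right 0)" by (rule Lim_transform_eventually)
  moreover have "\<forall>\<^sub>F t in at_left 0. 0 = exp_recip n t"
    unfolding eventually_at_left_field by (intro exI[of _ "-1"]) (auto simp: exp_recip_def)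
  then have "(exp_recip n \<longlongrightarrow> 0) (at_left 0)" by (rule Lim_transform_eventually[OF tendsto_const])
  ultimately show ?thesis by (simp add: filterlim_split_at)
qed

lemma exp_recip_has_derivative:
  "(exp_recip n has_derivative (\<lambda>u. u * (exp_recip (n + 2) t - n * exp_recip (n + 1) t))) (at t)"
proof -
  consider "t > 0" | "t < 0" | "t = 0" by linarith
  then have "(exp_recip n has_real_derivative (exp_recip (n + 2) t - n * exp_recip (n + 1) t)) (at t)"
  proof cases
    case 1
    have n1: "real n * t ^ n = real n * t ^ (n - 1) * t" by (cases n) auto
    have "((\<lambda>t. exp (- 1 / t) / t ^ n) has_real_derivative
        (exp (- 1 / t) * (1 / t\<^sup>2) * t ^ n - exp (- 1 / t) * (real n * t ^ (n - 1))) / (t ^ n * t ^ n)) (at t)"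
      using 1 by (auto intro!: derivative_eq_intros simp: power2_eq_square)
    also have "(exp (- 1 / t) * (1 / t\<^sup>2) * t ^ n - exp (- 1 / t) * (real n * t ^ (n - 1))) / (t ^ n * t ^ n)
        = exp_recip (n + 2) t - n * exp_recip (n + 1) t"
      using 1 n1 by (simp add: exp_recip_def field_simps power2_eq_square)
    finally show ?thesis
      by (rule has_field_derivative_transform_within_open[of _ _ _ "{0<..}"])
        (use 1 in \<open>auto simp: exp_recip_def\<close>)
  next
    case 2
    have "((\<lambda>t. 0) has_real_derivative 0) (at t)" by simp
    then have "(exp_recip n has_real_derivative 0) (at t)"
      by (rule has_field_derivative_transform_within_open[of _ _ _ "{..<0}"])
        (use 2 in \<open>auto simp: exp_recip_def\<close>)
    then show ?thesis using 2 by (simp add: exp_recip_def)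
  next
    case 3
    have "(\<lambda>h. (exp_recip n (0 + h) - exp_recip n 0) / h) = exp_recip (n + 1)"
      by (auto simp: exp_recip_def fun_eq_iff)
    then have "(exp_recip n has_real_derivative 0) (at 0)"
      unfolding DERIV_def using exp_recip_tendsto_0 by simp
    then show ?thesis using 3 by (simp add: exp_recip_def)
  qed
  then show ?thesis unfolding has_field_derivative_def by (simp add: mult.commute[of _ "_ - _"])
qed

lemma ck_on_exp_recip: "ck_on k UNIV (exp_recip n)"
proof (induction k arbitrary: n)
  case 0
  have "isCont (exp_recip n) t" for t
    using exp_recip_has_derivative has_derivative_continuous by blast
  then show ?case by (simp add: continuous_on_eq_continuous_at)
next
  case (Suc k)
  have "ck_on k UNIV (\<lambda>t. u * (exp_recip (n + 2) t + (- real n) * exp_recip (n + 1) t))" for u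
    by (intro ck_on_mult ck_on_const ck_on_add Suc.IH open_UNIV)
  then show ?case
    by (intro ck_on_SucI[OF open_UNIV exp_recip_has_derivative]) simp
qed

lemma ck_on_inverse:
  fixes f :: "'a::euclidean_space \<Rightarrow> real"
  assumes "open S" "\<And>x. x \<in> S \<Longrightarrow> f x \<noteq> 0" "ck_on k S f"
  shows "ck_on k S (\<lambda>x. inverse (f x))"
  using assms(3)
proof (induction k)
  case 0
  then show ?case using assms(2) by (auto intro: continuous_on_inverse)
next
  case (Suc k)
  have "ck_on k S (\<lambda>x. (- 1) * (inverse (f x) * frechet_derivative f (at x) u * inverse (f x)))" for u
    by (intro ck_on_mult assms(1) ck_on_const Suc.IH ck_on_Suc_imp[OF Suc.prems] ck_on_SucD(2)[OF Suc.prems])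
  then show ?case
    by (intro ck_on_SucI[OF assms(1) Deriv.has_derivative_inverse[OF assms(2) ck_on_SucD(1)[OF Suc.prems]]]) auto
qed

text \<open>
  A smooth transition from \<open>0\<close> on \<open>t \<le> 0\<close> to \<open>1\<close> on \<open>t \<ge> 1\<close>.
\<close>
definition smooth_step :: "real \<Rightarrow> real"
  where "smooth_step t = exp_recip 0 t * inverse (exp_recip 0 t + exp_recip 0 (1 - t))"

lemma exp_recip_0_sum_pos: "exp_recip 0 t + exp_recip 0 (1 - t) > 0"
  by (auto simp: exp_recip_def intro: add_pos_pos)

lemma smooth_step_bounds: "0 \<le> smooth_step t" "smooth_step t \<le> 1"
proof -
  have nn: "exp_recip 0 s \<ge> 0" for s by (simp add: exp_recip_def)
  show "0 \<le> smooth_step t"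
    unfolding smooth_step_def using nn[of t] exp_recip_0_sum_pos[of t] by simp
  show "smooth_step t \<le> 1"
    unfolding smooth_step_def divide_inverse[symmetric]
    using nn[of "1 - t"] exp_recip_0_sum_pos[of t] by (simp add: divide_le_eq_1)
qed

lemma smooth_step_eq_0: "t \<le> 0 \<Longrightarrow> smooth_step t = 0"
  by (simp add: smooth_step_def exp_recip_def)

lemma smooth_step_eq_1: "t \<ge> 1 \<Longrightarrow> smooth_step t = 1"
  by (simp add: smooth_step_def exp_recip_def)

lemma ck_on_smooth_step: "ck_on k UNIV smooth_step"
proof -
  have "ck_on k UNIV (\<lambda>t::real. 1 + (- 1) * t)"
    by (intro ck_on_add ck_on_mult ck_on_const ck_on_ident open_UNIV)
  then have "ck_on k UNIV (\<lambda>t. exp_recip 0 (1 + (- 1) * t))"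
    by (rule ck_on_compose[OF open_UNIV UNIV_I ck_on_exp_recip])
  then have "ck_on k UNIV (\<lambda>t. exp_recip 0 t + exp_recip 0 (1 - t))"
    by (intro ck_on_add ck_on_exp_recip open_UNIV) simp
  moreover have "exp_recip 0 t + exp_recip 0 (1 - t) \<noteq> 0" for t
    using exp_recip_0_sum_pos[of t] by simp
  ultimately have "ck_on k UNIV (\<lambda>t. inverse (exp_recip 0 t + exp_recip 0 (1 - t)))"
    by (intro ck_on_inverse open_UNIV) auto
  then show ?thesis
    unfolding smooth_step_def[abs_def] by (intro ck_on_mult ck_on_exp_recip open_UNIV)
qed

definition bump :: "'a::euclidean_space \<Rightarrow> real \<Rightarrow> 'a \<Rightarrow> real"
  where "bump y0 r y = smooth_step (2 - (y - y0) \<bullet> (y - y0) / r\<^sup>2)"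

lemma bump_bounds: "0 \<le> bump y0 r y" "bump y0 r y \<le> 1"
  by (simp_all add: bump_def smooth_step_bounds)

lemma bump_eq_1:
  assumes "r > 0" "dist y0 y \<le> r"
  shows "bump y0 r y = 1"
proof -
  have "(y - y0) \<bullet> (y - y0) \<le> r\<^sup>2"
    using assms by (simp add: dist_norm norm_minus_commute power2_norm_eq_inner[symmetric] power_mono)
  then show ?thesis unfolding bump_def using assms by (intro smooth_step_eq_1) (simp add: divide_le_eq_1)
qed

lemma bump_eq_0:
  assumes "r > 0" "dist y0 y \<ge> 2 * r"
  shows "bump y0 r y = 0"
proof -
  have "(2 * r)\<^sup>2 \<le> (norm (y - y0))\<^sup>2"
    using assms by (intro power_mono) (auto simp: dist_norm norm_minus_commute)
  then have "4 * r\<^sup>2 \<le> (y - y0) \<bullet> (y - y0)"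
    by (simp add: power2_norm_eq_inner power_mult_distrib)
  moreover have "0 \<le> r\<^sup>2" by simp
  ultimately have "2 * r\<^sup>2 \<le> (y - y0) \<bullet> (y - y0)" by linarith
  then show ?thesis unfolding bump_def using assms by (intro smooth_step_eq_0) (simp add: le_divide_eq)
qed

lemma smooth_on_bump: "smooth_on UNIV (bump y0 r)"
  unfolding smooth_on_def
proof
  fix k
  have c: "ck_on k UNIV (\<lambda>y. (y + - y0) \<bullet> b)" for b :: 'a
    by (rule ck_on_bounded_linear[OF open_UNIV bounded_linear_inner_left])
      (intro ck_on_add ck_on_ident ck_on_const open_UNIV)
  have "ck_on k UNIV (\<lambda>y. 2 + (- (1 / r\<^sup>2)) * (\<Sum>b\<in>Basis. ((y + - y0) \<bullet> b) * ((y + - y0) \<bullet> b)))"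
    by (intro ck_on_add ck_on_mult ck_on_sum ck_on_const c open_UNIV)
  then have "ck_on k UNIV (\<lambda>y. smooth_step (2 + (- (1 / r\<^sup>2)) * (\<Sum>b\<in>Basis. ((y + - y0) \<bullet> b) * ((y + - y0) \<bullet> b))))"
    by (rule ck_on_compose[OF open_UNIV UNIV_I ck_on_smooth_step])
  moreover have "(2 + (- (1 / r\<^sup>2)) * (\<Sum>b\<in>Basis. ((y + - y0) \<bullet> b) * ((y + - y0) \<bullet> b))) =
      2 - (y - y0) \<bullet> (y - y0) / r\<^sup>2" for y
    by (subst (3) euclidean_inner) simp
  ultimately show "ck_on k UNIV (bump y0 r)"
    unfolding bump_def[abs_def] by (simp only:)
qed

section \<open>Alternating forms and the exterior derivative in coordinates\<close>

lemma alternating_form_cong: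
  "alternating_form k w \<Longrightarrow> (\<And>i. i < k \<Longrightarrow> v i = v' i) \<Longrightarrow> w v = w v'"
  unfolding alternating_form_def by (elim conjE, drule spec, drule spec, erule mp) simp

lemma alternating_form_linear:
  "alternating_form k w \<Longrightarrow> i < k \<Longrightarrow> linear (\<lambda>u. w (v(i := u)))"
  by (simp add: alternating_form_def)

lemma alternating_form_zero:
  "alternating_form k w \<Longrightarrow> i < k \<Longrightarrow> j < k \<Longrightarrow> i \<noteq> j \<Longrightarrow> v i = v j \<Longrightarrow> w v = 0"
  unfolding alternating_form_def by metis

lemma alternating_form_add:
  "alternating_form k w \<Longrightarrow> i < k \<Longrightarrow> w (v(i := a + b)) = w (v(i := a)) + w (v(i := b))"
  using linear_add[OF alternating_form_linear] .

lemma alternating_form_scale: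
  "alternating_form k w \<Longrightarrow> i < k \<Longrightarrow> w (v(i := r *\<^sub>R a)) = r * w (v(i := a))"
  using linear_scale[OF alternating_form_linear] by force

lemma alternating_form_swap:
  assumes w: "alternating_form k w" and ij: "i < k" "j < k" "i \<noteq> j"
  shows "w (v(i := a, j := b)) = - w (v(i := b, j := a))"
proof -
  have add_i: "w (v(i := x + y, j := z)) = w (v(i := x, j := z)) + w (v(i := y, j := z))" for x y z
    using alternating_form_add[OF w ij(1), of "v(j := z)"] ij(3) by (simp add: fun_upd_twist)
  have z: "w (v(i := x, j := x)) = 0" for x using alternating_form_zero[OF w ij] ij(3) by simp
  have "0 = w (v(i := a + b, j := a + b))" using z by simp
  also have "\<dots> = w (v(i := a, j := a)) + w (v(i := a, j := b)) + (w (v(i := b, j := a)) + w (v(i := b, j := b)))"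
    by (simp only: alternating_form_add[OF w ij(2)] add_i)
  finally show ?thesis by (simp only: z)
qed

text \<open>
  The enumeration of the natural numbers other than \<open>i\<close>: \<open>v \<circ> skip i\<close> is the sequence \<open>v\<close> with entry \<open>i\<close>
  omitted.
\<close>
definition skip :: "nat \<Rightarrow> nat \<Rightarrow> nat"
  where "skip i j = (if j < i then j else Suc j)"

lemma skip_inj: "skip i j = skip i j' \<longleftrightarrow> j = j'" by (auto simp: skip_def split: if_splits)

lemma skip_neq: "skip i j \<noteq> i" by (simp add: skip_def)

lemma skip_bij: "i \<le> k \<Longrightarrow> bij_betw (skip i) {..<k} ({..k} - {i})"
proof (rule bij_betw_imageI)
  show "inj_on (skip i) {..<k}" by (simp add: inj_on_def skip_inj)
  assume "i \<le> k"
  have "l \<in> skip i ` {..<k}" if "l \<le> k" "l \<noteq> i" for l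
  proof (rule image_eqI)
    show "l = skip i (if l < i then l else l - 1)" using that by (auto simp: skip_def)
    show "(if l < i then l else l - 1) \<in> {..<k}" using that \<open>i \<le> k\<close> by auto
  qed
  then show "skip i ` {..<k} = {..k} - {i}" by (auto simp: skip_def)
qed

lemma skip_surj:
  assumes "i \<le> k" "l \<le> k" "l \<noteq> i"
  obtains j where "j < k" "skip i j = l"
proof -
  have "l \<in> skip i ` {..<k}"
    using bij_betw_imp_surj_on[OF skip_bij[OF assms(1)]] assms by blast
  then show thesis using that by blast
qed

lemma upd_skip: "v(skip i j := u) \<circ> skip i = (v \<circ> skip i)(j := u)"
  by (auto simp: fun_eq_iff skip_inj)

lemma upd_skip_same: "v(i := u) \<circ> skip i = v \<circ> skip i"
  by (auto simp: fun_eq_iff skip_neq)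

text \<open>
  If \<open>v a = v b\<close>, omitting entry \<open>a\<close> and omitting entry \<open>b\<close> give sequences that differ by moving the
  common entry over \<open>b - a - 1\<close> others, that is, by the sign \<open>(-1) ^ (b - a - 1)\<close>.  This cancellation is
  used twice: for the exterior derivative being alternating, and for the second derivatives dropping
  out of its pullback.
\<close>
lemma alternating_form_skip:
  assumes w: "alternating_form k w"
  shows "a < b \<Longrightarrow> b \<le> k \<Longrightarrow> v a = v b \<Longrightarrow> (-1) ^ a * w (v \<circ> skip a) + (-1) ^ b * w (v \<circ> skip b) = 0"
proof (induction "b - a" arbitrary: a v)
  case 0
  then show ?case by simp
next
  case (Suc n)
  show ?case
  proof (cases "b = Suc a")
    case True
    have "v \<circ> skip a = v \<circ> skip b"
      using Suc.prems True by (auto simp: fun_eq_iff skip_def less_Suc_eq)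
    then show ?thesis using True by simp
  next
    case False
    \<comment> \<open>Moving the common entry from \<open>a\<close> to \<open>a + 1\<close> does not change what is left after omitting it.\<close>
    let ?v = "v(a := v (Suc a), Suc a := v a)"
    have "(-1) ^ Suc a * w (?v \<circ> skip (Suc a)) + (-1) ^ b * w (?v \<circ> skip b) = 0"
      using Suc.hyps(2) Suc.prems False by (intro Suc.hyps(1)) auto
    moreover have "?v \<circ> skip (Suc a) = v \<circ> skip a"
      by (auto simp: fun_eq_iff skip_def less_Suc_eq)
    moreover have "?v \<circ> skip b = (v \<circ> skip b)(a := v (Suc a), Suc a := v a)"
      using Suc.prems False by (auto simp: fun_eq_iff skip_def)
    moreover have "w ((v \<circ> skip b)(a := v (Suc a), Suc a := v a)) =
        - w ((v \<circ> skip b)(a := v a, Suc a := v (Suc a)))"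
      using Suc.prems False by (intro alternating_form_swap[OF w]) auto
    moreover have "(v \<circ> skip b)(a := v a, Suc a := v (Suc a)) = v \<circ> skip b"
      using Suc.prems False by (auto simp: fun_eq_iff skip_def)
    ultimately show ?thesis by simp
  qed
qed

text \<open>
  The exterior derivative of a form on an open set of a vector space.
\<close>
definition local_ext_deriv ::
    "nat \<Rightarrow> ('b::real_normed_vector \<Rightarrow> (nat \<Rightarrow> 'b) \<Rightarrow> real) \<Rightarrow> 'b \<Rightarrow> (nat \<Rightarrow> 'b) \<Rightarrow> real"
  where "local_ext_deriv k f y v =
    (\<Sum>i\<le>k. (-1) ^ i * frechet_derivative (\<lambda>z. f z (v \<circ> skip i)) (at y) (v i))"

lemma ext_deriv_eq_local:
  assumes "c \<in> A" "y \<in> chart_image c"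
  shows "ext_deriv A k \<omega> c y v = local_ext_deriv k (\<omega> c) y v"
proof -
  have "(\<lambda>j. if j < i then v j else v (Suc j)) = v \<circ> skip i" for i
    by (auto simp: fun_eq_iff skip_def)
  then show ?thesis using assms by (simp add: ext_deriv_def local_ext_deriv_def)
qed

lemma frechet_derivative_add:
  "f differentiable (at x) \<Longrightarrow> g differentiable (at x) \<Longrightarrow>
   frechet_derivative (\<lambda>z. f z + g z) (at x) u = frechet_derivative f (at x) u + frechet_derivative g (at x) u"
  by (subst frechet_derivative_at[OF has_derivative_add, symmetric])
    (auto simp: frechet_derivative_works[symmetric])

lemma frechet_derivative_scaleR:
  "f differentiable (at x) \<Longrightarrow>
   frechet_derivative (\<lambda>z. r *\<^sub>R f z) (at x) u = r *\<^sub>R frechet_derivative f (at x) u"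
  by (subst frechet_derivative_at[OF has_derivative_scaleR_right, symmetric])
    (auto simp: frechet_derivative_works[symmetric])

lemma local_ext_deriv_cong:
  assumes "open U" "y \<in> U" "\<And>z v. z \<in> U \<Longrightarrow> f z v = h z v"
  shows "local_ext_deriv k f y v = local_ext_deriv k h y v"
  unfolding local_ext_deriv_def
  by (simp add: frechet_derivative_cong_open[OF assms(1,2) assms(3)])

lemma local_ext_deriv_add:
  assumes "\<And>v. (\<lambda>z. f z v) differentiable (at y)" "\<And>v. (\<lambda>z. h z v) differentiable (at y)"
  shows "local_ext_deriv k (\<lambda>z v. f z v + h z v) y v = local_ext_deriv k f y v + local_ext_deriv k h y v"
  unfolding local_ext_deriv_def
  by (simp add: frechet_derivative_add[OF assms] distrib_left sum.distrib)

lemma local_ext_deriv_scale: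
  assumes "\<And>v. (\<lambda>z. f z v) differentiable (at y)"
  shows "local_ext_deriv k (\<lambda>z v. r * f z v) y v = r * local_ext_deriv k f y v"
  unfolding local_ext_deriv_def
  using frechet_derivative_scaleR[OF assms, of r]
  by (simp add: sum_distrib_left mult.left_commute)

text \<open>
  If \<open>v i = v j\<close>, the terms that omit neither of the two entries vanish because the form is alternating,
  and the two others cancel by \<open>alternating_form_skip\<close>.
\<close>
lemma alternating_form_local_ext_deriv:
  fixes f :: "real ^ 'n::finite \<Rightarrow> (nat \<Rightarrow> real ^ 'n) \<Rightarrow> real"
  assumes U: "open U" "y \<in> U"
    and alt: "\<And>z. z \<in> U \<Longrightarrow> alternating_form k (f z)"
    and diff: "\<And>v. (\<lambda>z. f z v) differentiable (at y)"
  shows "alternating_form (Suc k) (local_ext_deriv k f y)"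
proof -
  let ?D = "\<lambda>s. frechet_derivative (\<lambda>z. f z s) (at y)"
  have D_lin: "linear (?D s)" for s by (rule linear_frechet_derivative[OF diff])
  have D_cong: "?D s = ?D s'" if "\<And>z. z \<in> U \<Longrightarrow> f z s = f z s'" for s s'
    by (rule frechet_derivative_cong_open[OF U that])
  have D_slot: "linear (\<lambda>u. ?D (s(j := u)) x)" if j: "j < k" for s j x
  proof (rule linearI)
    fix a b r
    have "?D (s(j := a + b)) = frechet_derivative (\<lambda>z. f z (s(j := a)) + f z (s(j := b))) (at y)"
      using alternating_form_add[OF alt j] by (intro frechet_derivative_cong_open[OF U])
    then show "?D (s(j := a + b)) x = ?D (s(j := a)) x + ?D (s(j := b)) x"
      using frechet_derivative_add[OF diff diff] by simp
    have "?D (s(j := r *\<^sub>R a)) = frechet_derivative (\<lambda>z. r *\<^sub>R f z (s(j := a))) (at y)"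
      using alternating_form_scale[OF alt j] by (intro frechet_derivative_cong_open[OF U]) simp
    then show "?D (s(j := r *\<^sub>R a)) x = r *\<^sub>R ?D (s(j := a)) x"
      using frechet_derivative_scaleR[OF diff] by simp
  qed
  have D_zero: "?D s x = 0" if "\<And>z. z \<in> U \<Longrightarrow> f z s = 0" for s x
    using frechet_derivative_cong_open[OF U, of "\<lambda>z. f z s" "\<lambda>z. 0"] that by simp
  show ?thesis
    unfolding alternating_form_def
  proof (intro conjI allI impI)
    fix v v' :: "nat \<Rightarrow> real ^ 'n" assume eq: "\<forall>i<Suc k. v i = v' i"
    have "?D (v \<circ> skip i) = ?D (v' \<circ> skip i)" for i
      using eq by (intro D_cong alternating_form_cong[OF alt]) (auto simp: skip_def)
    then show "local_ext_deriv k f y v = local_ext_deriv k f y v'"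
      unfolding local_ext_deriv_def using eq by (intro sum.cong) auto
  next
    fix v :: "nat \<Rightarrow> real ^ 'n" and i assume i: "i < Suc k"
    have "linear (\<lambda>u. (-1) ^ l * ?D (v(i := u) \<circ> skip l) ((v(i := u)) l))" if l: "l \<le> k" for l
    proof (cases "l = i")
      case True
      have "linear (\<lambda>u. (-1) ^ l *\<^sub>R ?D (v \<circ> skip i) u)"
        by (rule linear_compose_scale_right[OF D_lin])
      then show ?thesis using True by (simp add: upd_skip_same)
    next
      case False
      then obtain j where j: "j < k" "skip l j = i" using skip_surj[of l k i] l i by auto
      have "linear (\<lambda>u. (-1) ^ l *\<^sub>R ?D ((v \<circ> skip l)(j := u)) (v l))"
        by (rule linear_compose_scale_right[OF D_slot[OF j(1)]])
      then show ?thesis using False unfolding j(2)[symmetric] upd_skip by (simp add: skip_neq)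
    qed
    then show "linear (\<lambda>u. local_ext_deriv k f y (v(i := u)))"
      unfolding local_ext_deriv_def by (intro linear_compose_sum) auto
  next
    fix v :: "nat \<Rightarrow> real ^ 'n" and i j
    assume i: "i < Suc k" and j: "j < Suc k" and ij: "i \<noteq> j \<and> v i = v j"
    have main: "local_ext_deriv k f y v = 0" if i: "i \<le> k" and j: "j \<le> k" and ij: "i < j" "v i = v j" for i j
    proof -
      have "?D (v \<circ> skip l) x = 0" if l: "l \<le> k" "l \<noteq> i" "l \<noteq> j" for l x
      proof (rule D_zero)
        fix z assume z: "z \<in> U"
        obtain i' j' where "i' < k" "skip l i' = i" "j' < k" "skip l j' = j"
          using skip_surj[of l k i] skip_surj[of l k j] l i j by metis
        then show "f z (v \<circ> skip l) = 0"
          using ij by (intro alternating_form_zero[OF alt[OF z], of i' j']) auto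
      qed
      then have "local_ext_deriv k f y v = (\<Sum>l\<in>{i, j}. (-1) ^ l * ?D (v \<circ> skip l) (v l))"
        unfolding local_ext_deriv_def using i j by (intro sum.mono_neutral_right) auto
      also have "\<dots> = (-1) ^ i *\<^sub>R ?D (v \<circ> skip i) (v i) + (-1) ^ j *\<^sub>R ?D (v \<circ> skip j) (v i)"
        using ij by simp
      also have "\<dots> = frechet_derivative
          (\<lambda>z. (-1) ^ i *\<^sub>R f z (v \<circ> skip i) + (-1) ^ j *\<^sub>R f z (v \<circ> skip j)) (at y) (v i)"
        by (subst frechet_derivative_add) (simp_all only: frechet_derivative_scaleR[OF diff]
            differentiable_scaleR differentiable_const diff)
      also have "\<dots> = frechet_derivative (\<lambda>z. 0) (at y) (v i)"
        using alternating_form_skip[OF alt ij(1) j ij(2)]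
        by (subst frechet_derivative_cong_open[OF U, of _ "\<lambda>z. 0"]) simp_all
      finally show ?thesis by simp
    qed
    show "local_ext_deriv k f y v = 0"
      using main[of i j] main[of j i] i j ij by (cases "i < j") auto
  qed
qed

text \<open>
  Differentiating the pullback produces, besides the pullback of the exterior derivative, for each
  pair \<open>i \<noteq> l\<close> a term with \<open>D\<^sup>2\<tau>(v i, v l)\<close> in place of the argument \<open>v l\<close>.  The term for \<open>(i, l)\<close> and the
  term for \<open>(l, i)\<close> omit one of two entries that may both be taken to be \<open>D\<^sup>2\<tau>(v i, v l)\<close>, by symmetry of
  the second derivative; hence they cancel by \<open>alternating_form_skip\<close>.
\<close>
lemma local_ext_deriv_pullback:
  fixes f :: "real ^ 'n::finite \<Rightarrow> (nat \<Rightarrow> real ^ 'n) \<Rightarrow> real" and \<tau> :: "real ^ 'n \<Rightarrow> real ^ 'n"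
  assumes U: "open U" "y \<in> U" and \<tau>: "ck_on 2 U \<tau>" "\<And>z. z \<in> U \<Longrightarrow> \<tau> z \<in> V"
    and alt: "\<And>z. z \<in> V \<Longrightarrow> alternating_form k (f z)"
    and diff: "\<And>v. (\<lambda>z. f z v) differentiable (at (\<tau> y))"
  shows "local_ext_deriv k (\<lambda>z v. f (\<tau> z) (\<lambda>i. frechet_derivative \<tau> (at z) (v i))) y v =
    local_ext_deriv k f (\<tau> y) (\<lambda>i. frechet_derivative \<tau> (at y) (v i))"
proof -
  define T where "T = (\<lambda>z. frechet_derivative \<tau> (at z))"
  define B where "B = (\<lambda>u w. frechet_derivative (\<lambda>z. T z w) (at y) u)"
  define V' where "V' = (\<lambda>i. T y (v i))"
  define F where "F = f (\<tau> y)"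
  have F: "alternating_form k F" unfolding F_def by (rule alt[OF \<tau>(2)[OF U(2)]])
  have B_sym: "B u w = B w u" for u w
    unfolding B_def T_def by (rule second_derivative_symmetric[OF \<tau>(1) U, symmetric])
  have dT: "((\<lambda>z. T z w) has_derivative (\<lambda>u. B u w)) (at y)" for w
    using \<tau>(1) U(2) unfolding B_def T_def
    by (auto simp: numeral_2_eq_2 frechet_derivative_works[symmetric])
  have d\<tau>: "(\<tau> has_derivative T y) (at y)"
    using \<tau>(1) U(2) unfolding T_def by (auto simp: numeral_2_eq_2 frechet_derivative_works[symmetric])
  have df: "((\<lambda>z. f (\<tau> z) s) has_derivative (\<lambda>u. frechet_derivative (\<lambda>z. f z s) (at (\<tau> y)) (T y u))) (at y)" for s
    using has_derivative_compose[OF d\<tau>] diff[of s] by (simp add: frechet_derivative_works)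
  have lin: "linear (\<lambda>u. f (\<tau> z) (s(i := u)))" if "z \<in> U" "i < k" for z s i
    by (rule alternating_form_linear[OF alt[OF \<tau>(2)[OF that(1)]] that(2)])
  have der: "frechet_derivative (\<lambda>z. f (\<tau> z) (\<lambda>j. T z (s j))) (at y) u =
      frechet_derivative (\<lambda>z. f z (\<lambda>j. T y (s j))) (at (\<tau> y)) (T y u) +
      (\<Sum>j<k. F ((\<lambda>j. T y (s j))(j := B u (s j))))" for s u
  proof -
    have "((\<lambda>z. f (\<tau> z) (\<lambda>i. if i < k then T z (s i) else T y (s i))) has_derivative
      (\<lambda>u. frechet_derivative (\<lambda>z. f z (\<lambda>i. if i < k then T y (s i) else T y (s i))) (at (\<tau> y)) (T y u) +
        (\<Sum>j<k. f (\<tau> y) ((\<lambda>i. if i < k then T y (s i) else T y (s i))(j := B u (s j)))))) (at y)"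
      by (rule has_derivative_multilinear[OF U lin df dT]) auto
    then have "((\<lambda>z. f (\<tau> z) (\<lambda>i. if i < k then T z (s i) else T y (s i))) has_derivative
      (\<lambda>u. frechet_derivative (\<lambda>z. f z (\<lambda>j. T y (s j))) (at (\<tau> y)) (T y u) +
        (\<Sum>j<k. F ((\<lambda>j. T y (s j))(j := B u (s j)))))) (at y)"
      unfolding F_def if_cancel .
    then have "((\<lambda>z. f (\<tau> z) (\<lambda>j. T z (s j))) has_derivative
      (\<lambda>u. frechet_derivative (\<lambda>z. f z (\<lambda>j. T y (s j))) (at (\<tau> y)) (T y u) +
        (\<Sum>j<k. F ((\<lambda>j. T y (s j))(j := B u (s j)))))) (at y)"
      by (rule has_derivative_transform_within_open[OF _ U])
        (rule alternating_form_cong[OF alt[OF \<tau>(2)]], auto)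
    from frechet_derivative_at[OF this, symmetric] show ?thesis by simp
  qed
  define t where "t = (\<lambda>i l. if l = i then 0 else (-1) ^ i * F (V'(l := B (v i) (v l)) \<circ> skip i))"
  have t_anti: "t i l = - t l i" if "i \<le> k" "l \<le> k" for i l
  proof -
    have main: "t i l + t l i = 0" if "i < l" "l \<le> k" for i l
    proof -
      \<comment> \<open>Entry \<open>i\<close> is omitted in the first sequence below and entry \<open>l\<close> in the second, so both may be reset.\<close>
      define s where "s = V'(i := B (v i) (v l), l := B (v i) (v l))"
      have "(-1) ^ i * F (s \<circ> skip i) + (-1) ^ l * F (s \<circ> skip l) = 0"
        using that by (intro alternating_form_skip[OF F]) (auto simp: s_def)
      moreover have "s \<circ> skip i = V'(l := B (v i) (v l)) \<circ> skip i"
        unfolding s_def using that by (auto simp: fun_eq_iff skip_neq)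
      moreover have "s \<circ> skip l = V'(i := B (v l) (v i)) \<circ> skip l"
        unfolding s_def B_sym[of "v l"] by (auto simp: fun_eq_iff skip_neq)
      ultimately show ?thesis unfolding t_def using that by simp
    qed
    show ?thesis
    proof (cases i l rule: linorder_cases)
      case less
      then show ?thesis using main[of i l] that by simp
    next
      case equal
      then show ?thesis by (simp add: t_def)
    next
      case greater
      then show ?thesis using main[of l i] that by simp
    qed
  qed
  have "(\<Sum>i\<le>k. \<Sum>l\<le>k. t i l) = (\<Sum>i\<le>k. \<Sum>l\<le>k. - t l i)"
    by (intro sum.cong refl t_anti) auto
  also have "\<dots> = - (\<Sum>i\<le>k. \<Sum>l\<le>k. t i l)"
    by (subst sum.swap) (simp add: sum_negf)
  finally have t_sum: "(\<Sum>i\<le>k. \<Sum>l\<le>k. t i l) = 0" by simp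
  have inner: "(-1) ^ i * (\<Sum>j<k. F ((\<lambda>j. T y ((v \<circ> skip i) j))(j := B (v i) ((v \<circ> skip i) j)))) = (\<Sum>l\<le>k. t i l)"
    if i: "i \<le> k" for i
  proof -
    have "(\<Sum>l\<le>k. t i l) = (\<Sum>l\<in>{..k} - {i}. t i l)"
      by (intro sum.mono_neutral_right) (auto simp: t_def)
    also have "\<dots> = (\<Sum>j<k. t i (skip i j))"
      by (rule sum.reindex_bij_betw[OF skip_bij[OF i], symmetric])
    also have "\<dots> = (\<Sum>j<k. (-1) ^ i * F ((\<lambda>j. T y ((v \<circ> skip i) j))(j := B (v i) ((v \<circ> skip i) j))))"
    proof (rule sum.cong[OF refl])
      fix j
      have "V' \<circ> skip i = (\<lambda>j. T y ((v \<circ> skip i) j))" by (auto simp: V'_def fun_eq_iff)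
      then show "t i (skip i j) = (-1) ^ i * F ((\<lambda>j. T y ((v \<circ> skip i) j))(j := B (v i) ((v \<circ> skip i) j)))"
        unfolding t_def upd_skip by (simp add: skip_neq)
    qed
    finally show ?thesis by (simp add: sum_distrib_left)
  qed
  have "local_ext_deriv k (\<lambda>z v. f (\<tau> z) (\<lambda>i. T z (v i))) y v =
      (\<Sum>i\<le>k. (-1) ^ i * frechet_derivative (\<lambda>z. f z (V' \<circ> skip i)) (at (\<tau> y)) (V' i)) +
      (\<Sum>i\<le>k. (-1) ^ i * (\<Sum>j<k. F ((\<lambda>j. T y ((v \<circ> skip i) j))(j := B (v i) ((v \<circ> skip i) j)))))"
    unfolding local_ext_deriv_def der by (simp add: distrib_left sum.distrib V'_def o_def)
  also have "\<dots> = local_ext_deriv k f (\<tau> y) V'"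
    using inner t_sum unfolding local_ext_deriv_def by simp
  finally show ?thesis unfolding V'_def T_def .
qed

section \<open>Forms on the manifold\<close>

lemma chart_inj: "is_chart X c \<Longrightarrow> inj_on (snd c) (fst c)"
  unfolding is_chart_def
  by (metis homeomorphic_imp_injective_map openin_subset topspace_subtopology_subset)

lemma chart_subset: "is_chart X c \<Longrightarrow> fst c \<subseteq> topspace X"
  unfolding is_chart_def by (simp add: openin_subset)

lemma chart_open_image:
  assumes c: "is_chart X c" and W: "openin X W"
  shows "open (snd c ` (fst c \<inter> W))"
proof -
  have "openin (subtopology X (fst c)) (fst c \<inter> W)"
    using W by (auto simp: openin_subtopology)
  moreover have "fst c \<inter> W \<subseteq> topspace (subtopology X (fst c))"
    using chart_subset[OF c] by auto
  ultimately have "openin (top_of_set (chart_image c)) (snd c ` (fst c \<inter> W))"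
    using c homeomorphic_map_openness unfolding is_chart_def by blast
  then show ?thesis using c openin_open_eq unfolding is_chart_def by blast
qed

lemma chart_open_vimage:
  assumes c: "is_chart X c" and V: "open V"
  shows "openin X {x \<in> fst c. snd c x \<in> V}"
proof -
  have "continuous_map (subtopology X (fst c)) (top_of_set (chart_image c)) (snd c)"
    using c homeomorphic_imp_continuous_map unfolding is_chart_def by blast
  moreover have "openin (top_of_set (chart_image c)) (chart_image c \<inter> V)"
    using V by (rule openin_open_Int)
  ultimately have "openin (subtopology X (fst c))
      {x \<in> topspace (subtopology X (fst c)). snd c x \<in> chart_image c \<inter> V}"
    by (rule openin_continuous_map_preimage)
  moreover have "{x \<in> topspace (subtopology X (fst c)). snd c x \<in> chart_image c \<inter> V} = {x \<in> fst c. snd c x \<in> V}"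
    using chart_subset[OF c] by (auto simp: chart_image_def)
  ultimately show ?thesis
    using c openin_trans_full unfolding is_chart_def by metis
qed

lemma chart_compact_vimage:
  assumes c: "is_chart X c" and L: "compact L" "L \<subseteq> chart_image c"
  shows "compactin X {x \<in> fst c. snd c x \<in> L}"
proof -
  let ?K = "{x \<in> fst c. snd c x \<in> L}"
  have im: "snd c ` ?K = L" using L(2) unfolding chart_image_def by blast
  have "compactin (top_of_set (chart_image c)) (snd c ` ?K)"
    unfolding im using L by (simp add: compactin_subtopology)
  moreover have "?K \<subseteq> topspace (subtopology X (fst c))" using chart_subset[OF c] by auto
  ultimately have "compactin (subtopology X (fst c)) ?K"
    using c homeomorphic_map_compactness unfolding is_chart_def by blast
  then show ?thesis by (simp add: compactin_subtopology)
qed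

lemma chart_inverse: "is_chart X c \<Longrightarrow> x \<in> fst c \<Longrightarrow> inv_into (fst c) (snd c) (snd c x) = x"
  by (simp add: chart_inj)

lemma transition_apply: "is_chart X c \<Longrightarrow> x \<in> fst c \<Longrightarrow> transition c c' (snd c x) = snd c' x"
  by (simp add: transition_def chart_inverse)

lemma oriented_manifoldD:
  assumes "oriented_manifold X A"
  shows "c \<in> A \<Longrightarrow> is_chart X c" "c \<in> A \<Longrightarrow> open (chart_image c)"
    "x \<in> topspace X \<Longrightarrow> \<exists>c\<in>A. x \<in> fst c"
    "c \<in> A \<Longrightarrow> c' \<in> A \<Longrightarrow> smooth_on (snd c ` (fst c \<inter> fst c')) (transition c c')"
    "c \<in> A \<Longrightarrow> c' \<in> A \<Longrightarrow> open (snd c ` (fst c \<inter> fst c'))"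
    "Hausdorff_space X"
proof -
  note A = assms[unfolded oriented_manifold_def]
  show *: "is_chart X c" if "c \<in> A" for c using A that by blast
  show "c \<in> A \<Longrightarrow> open (chart_image c)" using * unfolding is_chart_def by blast
  show "x \<in> topspace X \<Longrightarrow> \<exists>c\<in>A. x \<in> fst c" using A by blast
  show "c \<in> A \<Longrightarrow> c' \<in> A \<Longrightarrow> smooth_on (snd c ` (fst c \<inter> fst c')) (transition c c')" using A by blast
  show "c \<in> A \<Longrightarrow> c' \<in> A \<Longrightarrow> open (snd c ` (fst c \<inter> fst c'))"
    using chart_open_image[OF *] * unfolding is_chart_def by blast
  show "Hausdorff_space X" using A by blast
qed

lemma smooth_formsD:
  assumes "\<omega> \<in> smooth_forms A k"
  shows "c \<notin> A \<or> y \<notin> chart_image c \<Longrightarrow> \<omega> c y = 0"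
    "c \<in> A \<Longrightarrow> y \<in> chart_image c \<Longrightarrow> alternating_form k (\<omega> c y)"
    "c \<in> A \<Longrightarrow> smooth_on (chart_image c) (\<lambda>y. \<omega> c y v)"
    "c \<in> A \<Longrightarrow> c' \<in> A \<Longrightarrow> x \<in> fst c \<Longrightarrow> x \<in> fst c' \<Longrightarrow>
      \<omega> c (snd c x) v = \<omega> c' (snd c' x) (\<lambda>i. transition_deriv c c' x (v i))"
  using assms unfolding smooth_forms_def mem_Collect_eq by blast+

lemma smooth_on_add:
  "open S \<Longrightarrow> smooth_on S f \<Longrightarrow> smooth_on S g \<Longrightarrow> smooth_on S (\<lambda>x. f x + g x)"
  unfolding smooth_on_def by (blast intro: ck_on_add)

lemma smooth_on_mult:
  fixes f g :: "'a::euclidean_space \<Rightarrow> real"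
  shows "open S \<Longrightarrow> smooth_on S f \<Longrightarrow> smooth_on S g \<Longrightarrow> smooth_on S (\<lambda>x. f x * g x)"
  unfolding smooth_on_def by (blast intro: ck_on_mult)

lemma smooth_on_const: "smooth_on S (\<lambda>x. c)"
  unfolding smooth_on_def by (blast intro: ck_on_const)

lemma alternating_form_zero_form: "alternating_form k (\<lambda>v. 0)"
  unfolding alternating_form_def by (simp add: linear_zero)

lemma alternating_form_plus:
  "alternating_form k w \<Longrightarrow> alternating_form k w' \<Longrightarrow> alternating_form k (\<lambda>v. w v + w' v)"
  unfolding alternating_form_def by (auto intro!: linear_compose_add arg_cong2[of _ _ _ _ "(+)"])

lemma alternating_form_times:
  "alternating_form k w \<Longrightarrow> alternating_form k (\<lambda>v. r * w v)"
  unfolding alternating_form_def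
proof (intro conjI allI impI; (elim conjE)?)
  fix v i assume "\<forall>v. \<forall>i<k. linear (\<lambda>u. w (v(i := u)))" "i < k"
  then have "linear (\<lambda>u. r *\<^sub>R w (v(i := u)))" by (intro linear_compose_scale_right) blast
  then show "linear (\<lambda>u. r * w (v(i := u)))" by simp
qed (metis, metis mult_zero_right)

lemma zero_in_smooth_forms: "0 \<in> smooth_forms A k"
  unfolding smooth_forms_def
  using alternating_form_zero_form by (auto simp: zero_fun_def smooth_on_const)

lemma smooth_forms_add:
  assumes M: "oriented_manifold X A" and \<omega>: "\<omega> \<in> smooth_forms A k" and \<eta>: "\<eta> \<in> smooth_forms A k"
  shows "\<omega> + \<eta> \<in> smooth_forms A k"
  unfolding smooth_forms_def mem_Collect_eq
proof (intro conjI allI ballI impI)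
  fix c y assume "c \<notin> A \<or> y \<notin> chart_image c"
  then show "(\<omega> + \<eta>) c y = 0" using smooth_formsD(1)[OF \<omega>] smooth_formsD(1)[OF \<eta>] by simp
next
  fix c y assume cy: "c \<in> A" "y \<in> chart_image c"
  show "alternating_form k ((\<omega> + \<eta>) c y)"
    using alternating_form_plus[OF smooth_formsD(2)[OF \<omega> cy] smooth_formsD(2)[OF \<eta> cy]]
    by (simp add: plus_fun_def)
next
  fix c v assume c: "c \<in> A"
  show "smooth_on (chart_image c) (\<lambda>y. (\<omega> + \<eta>) c y v)"
    using smooth_on_add[OF oriented_manifoldD(2)[OF M c] smooth_formsD(3)[OF \<omega> c] smooth_formsD(3)[OF \<eta> c]]
    by simp
next
  fix c c' x v assume "c \<in> A" "c' \<in> A" "x \<in> fst c \<inter> fst c'"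
  then show "(\<omega> + \<eta>) c (snd c x) v = (\<omega> + \<eta>) c' (snd c' x) (\<lambda>i. transition_deriv c c' x (v i))"
    using smooth_formsD(4)[OF \<omega>, of c c' x v] smooth_formsD(4)[OF \<eta>, of c c' x v] by simp
qed

definition smooth_fun :: "('a, 'n::finite) chart set \<Rightarrow> ('a \<Rightarrow> real) \<Rightarrow> bool"
  where "smooth_fun A \<rho> \<longleftrightarrow>
    (\<forall>c\<in>A. smooth_on (chart_image c) (\<lambda>y. \<rho> (inv_into (fst c) (snd c) y)))"

definition mult_form :: "('a \<Rightarrow> real) \<Rightarrow> ('a, 'n::finite) form \<Rightarrow> ('a, 'n) form"
  where "mult_form \<rho> \<omega> = (\<lambda>c y v. \<rho> (inv_into (fst c) (snd c) y) * \<omega> c y v)"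

lemma mult_form_in_smooth_forms:
  assumes M: "oriented_manifold X A" and \<rho>: "smooth_fun A \<rho>" and \<omega>: "\<omega> \<in> smooth_forms A k"
  shows "mult_form \<rho> \<omega> \<in> smooth_forms A k"
  unfolding smooth_forms_def mem_Collect_eq
proof (intro conjI allI ballI impI)
  fix c y assume "c \<notin> A \<or> y \<notin> chart_image c"
  then show "mult_form \<rho> \<omega> c y = 0"
    using smooth_formsD(1)[OF \<omega>] by (simp add: mult_form_def fun_eq_iff)
next
  fix c y assume cy: "c \<in> A" "y \<in> chart_image c"
  show "alternating_form k (mult_form \<rho> \<omega> c y)"
    unfolding mult_form_def by (rule alternating_form_times[OF smooth_formsD(2)[OF \<omega> cy]])
next
  fix c v assume c: "c \<in> A"
  show "smooth_on (chart_image c) (\<lambda>y. mult_form \<rho> \<omega> c y v)"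
    unfolding mult_form_def
    using \<rho> c by (intro smooth_on_mult oriented_manifoldD(2)[OF M c] smooth_formsD(3)[OF \<omega> c])
      (auto simp: smooth_fun_def)
next
  fix c c' x v assume "c \<in> A" "c' \<in> A" "x \<in> fst c \<inter> fst c'"
  then show "mult_form \<rho> \<omega> c (snd c x) v = mult_form \<rho> \<omega> c' (snd c' x) (\<lambda>i. transition_deriv c c' x (v i))"
    using smooth_formsD(4)[OF \<omega>, of c c' x v] chart_inverse[OF oriented_manifoldD(1)[OF M]]
    by (simp add: mult_form_def)
qed

lemma smooth_forms_scale:
  assumes M: "oriented_manifold X A" and \<omega>: "\<omega> \<in> smooth_forms A k"
  shows "r *\<^sub>R \<omega> \<in> smooth_forms A k"
proof -
  have "r *\<^sub>R \<omega> = mult_form (\<lambda>x. r) \<omega>" by (simp add: mult_form_def fun_eq_iff)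
  then show ?thesis
    using mult_form_in_smooth_forms[OF M _ \<omega>, of "\<lambda>x. r"] by (simp add: smooth_fun_def smooth_on_const)
qed

lemma form_support_outside:
  assumes M: "oriented_manifold X A" and c: "c \<in> A" "x \<in> fst c" and x: "x \<notin> form_support X A \<omega>"
  shows "\<omega> c (snd c x) = 0"
proof (rule ccontr)
  assume "\<omega> c (snd c x) \<noteq> 0"
  then have "x \<in> {x \<in> topspace X. \<exists>c\<in>A. x \<in> fst c \<and> \<omega> c (snd c x) \<noteq> 0}"
    using c chart_subset[OF oriented_manifoldD(1)[OF M]] by blast
  then show False
    using x closure_of_subset[of "{x \<in> topspace X. \<exists>c\<in>A. x \<in> fst c \<and> \<omega> c (snd c x) \<noteq> 0}" X]
    unfolding form_support_def by blast
qed

lemma form_support_subset: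
  assumes "closedin X K"
    and "\<And>c x. c \<in> A \<Longrightarrow> x \<in> fst c \<Longrightarrow> x \<in> topspace X \<Longrightarrow> x \<notin> K \<Longrightarrow> \<omega> c (snd c x) = 0"
  shows "form_support X A \<omega> \<subseteq> K"
  unfolding form_support_def using assms by (intro closure_of_minimal) blast+

lemma closedin_form_support: "closedin X (form_support X A \<omega>)"
  unfolding form_support_def by (rule closedin_closure_of)

lemma test_formsI:
  assumes M: "oriented_manifold X A" and \<omega>: "\<omega> \<in> smooth_forms A k" and K: "compactin X K"
    and zero: "\<And>c x. c \<in> A \<Longrightarrow> x \<in> fst c \<Longrightarrow> x \<notin> K \<Longrightarrow> \<omega> c (snd c x) = 0"
  shows "\<omega> \<in> test_forms X A k"
proof -
  have *: "form_support X A \<omega> \<subseteq> K"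
    using compactin_imp_closedin[OF oriented_manifoldD(6)[OF M] K] zero by (rule form_support_subset)
  show ?thesis
    unfolding test_forms_def using \<omega> closed_compactin[OF K * closedin_form_support] by simp
qed

lemma test_formsD:
  assumes "\<omega> \<in> test_forms X A k"
  shows "\<omega> \<in> smooth_forms A k" "compactin X (form_support X A \<omega>)"
  using assms by (simp_all add: test_forms_def)

lemma subspace_test_forms:
  assumes M: "oriented_manifold X A"
  shows "subspace (test_forms X A k)"
proof (rule subspaceI)
  show "0 \<in> test_forms X A k"
    by (rule test_formsI[OF M zero_in_smooth_forms compactin_empty]) simp
  fix \<omega> \<eta> assume \<omega>: "\<omega> \<in> test_forms X A k" and \<eta>: "\<eta> \<in> test_forms X A k"
  show "\<omega> + \<eta> \<in> test_forms X A k"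
  proof (rule test_formsI[OF M smooth_forms_add[OF M test_formsD(1)[OF \<omega>] test_formsD(1)[OF \<eta>]]
        compactin_Un[OF test_formsD(2)[OF \<omega>] test_formsD(2)[OF \<eta>]]])
    fix c x assume "c \<in> A" "x \<in> fst c" "x \<notin> form_support X A \<omega> \<union> form_support X A \<eta>"
    then show "(\<omega> + \<eta>) c (snd c x) = 0"
      using form_support_outside[OF M, of c x \<omega>] form_support_outside[OF M, of c x \<eta>] by simp
  qed
next
  fix r \<omega> assume \<omega>: "\<omega> \<in> test_forms X A k"
  show "r *\<^sub>R \<omega> \<in> test_forms X A k"
    by (rule test_formsI[OF M smooth_forms_scale[OF M test_formsD(1)[OF \<omega>]] test_formsD(2)[OF \<omega>]])
      (simp add: form_support_outside[OF M] fun_eq_iff)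
qed

lemma smooth_form_differentiable:
  assumes M: "oriented_manifold X A" and \<omega>: "\<omega> \<in> smooth_forms A k" and c: "c \<in> A" "y \<in> chart_image c"
  shows "(\<lambda>z. \<omega> c z v) differentiable (at y)"
  using smooth_onD(1)[OF smooth_formsD(3)[OF \<omega> c(1)] c(2)] .

lemma ext_deriv_add:
  assumes M: "oriented_manifold X A" and \<omega>: "\<omega> \<in> smooth_forms A k" and \<eta>: "\<eta> \<in> smooth_forms A k"
  shows "ext_deriv A k (\<omega> + \<eta>) = ext_deriv A k \<omega> + ext_deriv A k \<eta>"
proof (intro ext)
  fix c y v
  show "ext_deriv A k (\<omega> + \<eta>) c y v = (ext_deriv A k \<omega> + ext_deriv A k \<eta>) c y v"
  proof (cases "c \<in> A \<and> y \<in> chart_image c")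
    case True
    then have "local_ext_deriv k (\<lambda>z v. \<omega> c z v + \<eta> c z v) y v =
        local_ext_deriv k (\<omega> c) y v + local_ext_deriv k (\<eta> c) y v"
      using smooth_form_differentiable[OF M \<omega>] smooth_form_differentiable[OF M \<eta>]
      by (intro local_ext_deriv_add) blast+
    then show ?thesis using True by (simp add: ext_deriv_eq_local plus_fun_def)
  qed (auto simp: ext_deriv_def)
qed

lemma ext_deriv_scale:
  assumes M: "oriented_manifold X A" and \<omega>: "\<omega> \<in> smooth_forms A k"
  shows "ext_deriv A k (r *\<^sub>R \<omega>) = r *\<^sub>R ext_deriv A k \<omega>"
proof (intro ext)
  fix c y v
  show "ext_deriv A k (r *\<^sub>R \<omega>) c y v = (r *\<^sub>R ext_deriv A k \<omega>) c y v"
  proof (cases "c \<in> A \<and> y \<in> chart_image c")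
    case True
    then have "local_ext_deriv k (\<lambda>z v. r * \<omega> c z v) y v = r * local_ext_deriv k (\<omega> c) y v"
      using smooth_form_differentiable[OF M \<omega>] by (intro local_ext_deriv_scale) blast
    then show ?thesis using True by (simp add: ext_deriv_eq_local scaleR_fun_def)
  qed (auto simp: ext_deriv_def)
qed

lemma ext_deriv_in_smooth_forms:
  assumes M: "oriented_manifold X A" and \<omega>: "\<omega> \<in> smooth_forms A k"
  shows "ext_deriv A k \<omega> \<in> smooth_forms A (Suc k)"
  unfolding smooth_forms_def mem_Collect_eq
proof (intro conjI allI ballI impI)
  fix c y assume "c \<notin> A \<or> y \<notin> chart_image c"
  then show "ext_deriv A k \<omega> c y = 0" by (auto simp: ext_deriv_def fun_eq_iff)
next
  fix c y assume cy: "c \<in> A" "y \<in> chart_image c"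
  have "alternating_form (Suc k) (local_ext_deriv k (\<omega> c) y)"
    by (rule alternating_form_local_ext_deriv[OF oriented_manifoldD(2)[OF M cy(1)] cy(2)
        smooth_formsD(2)[OF \<omega> cy(1)] smooth_form_differentiable[OF M \<omega> cy]])
  moreover have "ext_deriv A k \<omega> c y = local_ext_deriv k (\<omega> c) y"
    using ext_deriv_eq_local[OF cy] by (intro ext)
  ultimately show "alternating_form (Suc k) (ext_deriv A k \<omega> c y)" by simp
next
  fix c v assume c: "c \<in> A"
  note o = oriented_manifoldD(2)[OF M c]
  have D: "ck_on m (chart_image c) (\<lambda>y. frechet_derivative (\<lambda>z. \<omega> c z (v \<circ> skip i)) (at y) (v i))" for m i
    using smooth_onD(2)[OF smooth_formsD(3)[OF \<omega> c]] unfolding smooth_on_def by blast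
  have "ck_on m (chart_image c) (\<lambda>y. local_ext_deriv k (\<omega> c) y v)" for m
    unfolding local_ext_deriv_def by (intro ck_on_sum ck_on_mult ck_on_const D o)
  then have "smooth_on (chart_image c) (\<lambda>y. local_ext_deriv k (\<omega> c) y v)"
    unfolding smooth_on_def by blast
  then show "smooth_on (chart_image c) (\<lambda>y. ext_deriv A k \<omega> c y v)"
    by (rule smooth_on_open_cong[OF o, rotated]) (simp add: ext_deriv_eq_local[OF c])
next
  fix c c' x v assume c: "c \<in> A" "c' \<in> A" and x: "x \<in> fst c \<inter> fst c'"
  note C = oriented_manifoldD(1)[OF M c(1)]
  let ?U = "snd c ` (fst c \<inter> fst c')" and ?\<tau> = "transition c c'"
  have U: "open ?U" "snd c x \<in> ?U" using oriented_manifoldD(5)[OF M c] x by auto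
  have \<tau>: "ck_on 2 ?U ?\<tau>" using oriented_manifoldD(4)[OF M c] unfolding smooth_on_def by blast
  have \<tau>_im: "?\<tau> z \<in> chart_image c'" if "z \<in> ?U" for z
  proof -
    from that obtain x' where x': "z = snd c x'" "x' \<in> fst c" "x' \<in> fst c'" by blast
    then show ?thesis using transition_apply[OF C x'(2), of c'] unfolding chart_image_def by simp
  qed
  have \<tau>x: "?\<tau> (snd c x) = snd c' x" using transition_apply[OF C] x by auto
  have y: "snd c x \<in> chart_image c" "snd c' x \<in> chart_image c'" using x unfolding chart_image_def by auto
  have eq: "\<omega> c z v = \<omega> c' (?\<tau> z) (\<lambda>i. frechet_derivative ?\<tau> (at z) (v i))" if "z \<in> ?U" for z v
  proof -
    from that obtain x' where x': "z = snd c x'" "x' \<in> fst c" "x' \<in> fst c'" by blast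
    show ?thesis
      using smooth_formsD(4)[OF \<omega> c x'(2,3), of v] transition_apply[OF C x'(2), of c']
      unfolding x'(1) transition_deriv_def by simp
  qed
  have "ext_deriv A k \<omega> c (snd c x) v = local_ext_deriv k (\<omega> c) (snd c x) v"
    by (rule ext_deriv_eq_local[OF c(1) y(1)])
  also have "\<dots> = local_ext_deriv k (\<lambda>z v. \<omega> c' (?\<tau> z) (\<lambda>i. frechet_derivative ?\<tau> (at z) (v i))) (snd c x) v"
    by (rule local_ext_deriv_cong[OF U eq])
  also have "\<dots> = local_ext_deriv k (\<omega> c') (?\<tau> (snd c x)) (\<lambda>i. frechet_derivative ?\<tau> (at (snd c x)) (v i))"
    using smooth_form_differentiable[OF M \<omega> c(2)] y(2) \<tau>x
    by (intro local_ext_deriv_pullback[OF U \<tau> \<tau>_im smooth_formsD(2)[OF \<omega> c(2)]]) auto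
  also have "\<dots> = ext_deriv A k \<omega> c' (snd c' x) (\<lambda>i. transition_deriv c c' x (v i))"
    unfolding \<tau>x transition_deriv_def[symmetric] by (rule ext_deriv_eq_local[OF c(2) y(2), symmetric])
  finally show "ext_deriv A k \<omega> c (snd c x) v =
      ext_deriv A k \<omega> c' (snd c' x) (\<lambda>i. transition_deriv c c' x (v i))" .
qed

lemma ext_deriv_outside_support:
  assumes M: "oriented_manifold X A" and c: "c \<in> A" "x \<in> fst c" and x: "x \<notin> form_support X A \<omega>"
  shows "ext_deriv A k \<omega> c (snd c x) = 0"
proof (rule ext)
  fix v
  note C = oriented_manifoldD(1)[OF M c(1)]
  let ?W = "topspace X - form_support X A \<omega>"
  have U: "open (snd c ` (fst c \<inter> ?W))"
    by (rule chart_open_image[OF C openin_diff[OF openin_topspace closedin_form_support]])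
  have xU: "snd c x \<in> snd c ` (fst c \<inter> ?W)" using c x chart_subset[OF C] by blast
  have zero: "\<omega> c z v = 0" if "z \<in> snd c ` (fst c \<inter> ?W)" for z v
    using that form_support_outside[OF M c(1)] by (auto simp: fun_eq_iff)
  have "ext_deriv A k \<omega> c (snd c x) v = local_ext_deriv k (\<omega> c) (snd c x) v"
    using c by (intro ext_deriv_eq_local) (auto simp: chart_image_def)
  also have "\<dots> = local_ext_deriv k (\<lambda>z v. 0) (snd c x) v"
    by (rule local_ext_deriv_cong[OF U xU zero])
  finally show "ext_deriv A k \<omega> c (snd c x) v = 0 v" by (simp add: local_ext_deriv_def)
qed

lemma ext_deriv_in_test_forms:
  assumes M: "oriented_manifold X A" and \<omega>: "\<omega> \<in> test_forms X A k"
  shows "ext_deriv A k \<omega> \<in> test_forms X A (Suc k)"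
  using test_formsD[OF \<omega>]
  by (intro test_formsI[OF M ext_deriv_in_smooth_forms[OF M] _ ext_deriv_outside_support[OF M]])

section \<open>Cutoff functions\<close>

text \<open>
  A bump function in a chart, extended by zero.  It is smooth in every other chart because the chart
  domain and the complement of the compact support form an open cover; the complement is open
  since \<open>X\<close> is Hausdorff.
\<close>
lemma local_cutoff:
  assumes M: "oriented_manifold X A" and x: "x \<in> topspace X"
  shows "\<exists>\<rho> U K. openin X U \<and> x \<in> U \<and> compactin X K \<and> smooth_fun A \<rho> \<and>
    (\<forall>z. 0 \<le> \<rho> z \<and> \<rho> z \<le> 1) \<and> (\<forall>z\<in>U. \<rho> z = 1) \<and> (\<forall>z. z \<notin> K \<longrightarrow> \<rho> z = 0)"
proof -
  obtain c where c: "c \<in> A" "x \<in> fst c" using oriented_manifoldD(3)[OF M x] by blast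
  note C = oriented_manifoldD(1)[OF M c(1)]
  define y0 where "y0 = snd c x"
  have "y0 \<in> chart_image c" using c unfolding y0_def chart_image_def by blast
  then obtain e where e: "e > 0" "cball y0 e \<subseteq> chart_image c"
    using oriented_manifoldD(2)[OF M c(1)] open_contains_cball by blast
  define r where "r = e / 2"
  have r: "r > 0" "cball y0 (2 * r) \<subseteq> chart_image c" using e by (simp_all add: r_def)
  define \<rho> where "\<rho> = (\<lambda>z. if z \<in> fst c then bump y0 r (snd c z) else 0)"
  define U where "U = {z \<in> fst c. snd c z \<in> ball y0 r}"
  define K where "K = {z \<in> fst c. snd c z \<in> cball y0 (2 * r)}"
  have K: "compactin X K" unfolding K_def by (rule chart_compact_vimage[OF C compact_cball r(2)])
  have off_K: "\<rho> z = 0" if "z \<notin> K" for z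
    using that bump_eq_0[OF r(1), of y0 "snd c z"] by (auto simp: \<rho>_def K_def)
  have "smooth_fun A \<rho>"
    unfolding smooth_fun_def
  proof
    fix c' assume c': "c' \<in> A"
    note C' = oriented_manifoldD(1)[OF M c']
    let ?f = "\<lambda>y. \<rho> (inv_into (fst c') (snd c') y)"
    let ?S = "snd c' ` (fst c' \<inter> fst c)" and ?T = "snd c' ` (fst c' \<inter> (topspace X - K))"
    have S: "open ?S" by (rule oriented_manifoldD(5)[OF M c' c(1)])
    have T: "open ?T"
      by (rule chart_open_image[OF C' openin_diff[OF openin_topspace
        compactin_imp_closedin[OF oriented_manifoldD(6)[OF M] K]]])
    have "ck_on k (?S \<union> ?T) ?f" for k
    proof (rule ck_on_Un[OF S T])
      have "ck_on k ?S (\<lambda>y. bump y0 r (transition c' c y))"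
        using oriented_manifoldD(4)[OF M c' c(1)] smooth_on_bump[of y0 r] ck_on_compose[OF S UNIV_I]
        unfolding smooth_on_def by blast
      moreover have "bump y0 r (transition c' c y) = ?f y" if "y \<in> ?S" for y
        using that by (auto simp: \<rho>_def transition_apply[OF C'] chart_inverse[OF C'])
      ultimately show "ck_on k ?S ?f" by (rule ck_on_cong[OF S, rotated])
      have "0 = ?f y" if "y \<in> ?T" for y
        using that off_K by (auto simp: chart_inverse[OF C'])
      then show "ck_on k ?T ?f" by (rule ck_on_cong[OF T _ ck_on_const])
    qed
    moreover have "chart_image c' = ?S \<union> ?T"
      using chart_subset[OF C'] unfolding chart_image_def K_def by blast
    ultimately show "smooth_on (chart_image c') ?f" unfolding smooth_on_def by simp
  qed
  moreover have "openin X U" unfolding U_def by (rule chart_open_vimage[OF C open_ball])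
  moreover have "x \<in> U" using c r by (simp add: U_def y0_def)
  moreover have "\<forall>z\<in>U. \<rho> z = 1" by (auto simp: U_def \<rho>_def intro!: bump_eq_1[OF r(1)])
  moreover have "\<forall>z. 0 \<le> \<rho> z \<and> \<rho> z \<le> 1" by (simp add: \<rho>_def bump_bounds)
  ultimately show ?thesis using K off_K by blast
qed

lemma smooth_fun_one_minus:
  assumes "oriented_manifold X A" "smooth_fun A \<rho>"
  shows "smooth_fun A (\<lambda>x. 1 - \<rho> x)"
  unfolding smooth_fun_def
proof
  fix c assume c: "c \<in> A"
  have "smooth_on (chart_image c) (\<lambda>y. 1 + (- 1) * \<rho> (inv_into (fst c) (snd c) y))"
    using assms(2) c unfolding smooth_fun_def
    by (intro smooth_on_add smooth_on_mult smooth_on_const oriented_manifoldD(2)[OF assms(1) c]) blast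
  then show "smooth_on (chart_image c) (\<lambda>y. 1 - \<rho> (inv_into (fst c) (snd c) y))" by simp
qed

lemma smooth_fun_prod:
  assumes "oriented_manifold X A" "\<And>i. i \<in> I \<Longrightarrow> smooth_fun A (\<rho> i)"
  shows "smooth_fun A (\<lambda>x. \<Prod>i\<in>I. \<rho> i x)"
  unfolding smooth_fun_def
proof
  fix c assume c: "c \<in> A"
  have "smooth_on (chart_image c) (\<lambda>y. \<Prod>i\<in>J. \<rho> i (inv_into (fst c) (snd c) y))" if "J \<subseteq> I" for J
    using that
  proof (induction J rule: infinite_finite_induct)
    case (insert i J)
    then show ?case
      using assms(2)[of i] c unfolding smooth_fun_def
      by (auto intro!: smooth_on_mult oriented_manifoldD(2)[OF assms(1) c])
  qed (simp_all add: smooth_on_const)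
  then show "smooth_on (chart_image c) (\<lambda>y. \<Prod>i\<in>I. \<rho> i (inv_into (fst c) (snd c) y))" by blast
qed

lemma finite_subcover_by_points:
  assumes K: "compactin X K" and U: "\<And>x. x \<in> K \<Longrightarrow> openin X (U x) \<and> x \<in> U x"
  obtains I where "finite I" "I \<subseteq> K" "K \<subseteq> (\<Union>x\<in>I. U x)"
proof -
  have "\<exists>\<F>. finite \<F> \<and> \<F> \<subseteq> U ` K \<and> K \<subseteq> \<Union>\<F>"
    using U by (intro compactinD[OF K]) auto
  then show thesis using that finite_subset_image by metis
qed

text \<open>
  From finitely many local cutoff functions \<open>\<rho> x\<close>, the function \<open>1 - (\<Prod>x. 1 - \<rho> x)\<close> is \<open>1\<close> wherever
  one of them is, and stays in \<open>[0, 1]\<close>.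
\<close>
lemma cutoff:
  assumes M: "oriented_manifold X A" and K: "compactin X K"
  obtains \<rho> K' where "compactin X K'" "smooth_fun A \<rho>" "\<And>x. 0 \<le> \<rho> x" "\<And>x. \<rho> x \<le> 1"
    "\<And>x. x \<in> K \<Longrightarrow> \<rho> x = 1" "\<And>x. x \<notin> K' \<Longrightarrow> \<rho> x = 0"
proof -
  have "\<forall>x\<in>K. \<exists>\<rho> U L. openin X U \<and> x \<in> U \<and> compactin X L \<and> smooth_fun A \<rho> \<and>
    (\<forall>z. 0 \<le> \<rho> z \<and> \<rho> z \<le> 1) \<and> (\<forall>z\<in>U. \<rho> z = 1) \<and> (\<forall>z. z \<notin> L \<longrightarrow> \<rho> z = 0)"
    using local_cutoff[OF M] compactin_subset_topspace[OF K] by blast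
  then have "\<exists>\<rho> U L. \<forall>x\<in>K. openin X (U x) \<and> x \<in> U x \<and> compactin X (L x) \<and> smooth_fun A (\<rho> x) \<and>
    (\<forall>z. 0 \<le> \<rho> x z \<and> \<rho> x z \<le> 1) \<and> (\<forall>z\<in>U x. \<rho> x z = 1) \<and> (\<forall>z. z \<notin> L x \<longrightarrow> \<rho> x z = 0)"
    by (simp only: bchoice_iff)
  then obtain \<rho> U L where \<rho>UL: "\<forall>x\<in>K. openin X (U x) \<and> x \<in> U x \<and> compactin X (L x) \<and> smooth_fun A (\<rho> x) \<and>
    (\<forall>z. 0 \<le> \<rho> x z \<and> \<rho> x z \<le> 1) \<and> (\<forall>z\<in>U x. \<rho> x z = 1) \<and> (\<forall>z. z \<notin> L x \<longrightarrow> \<rho> x z = 0)"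
    by (elim exE)
  then have loc: "\<And>x. x \<in> K \<Longrightarrow> openin X (U x) \<and> x \<in> U x"
      "\<And>x. x \<in> K \<Longrightarrow> compactin X (L x)" "\<And>x. x \<in> K \<Longrightarrow> smooth_fun A (\<rho> x)"
      "\<And>x z. x \<in> K \<Longrightarrow> 0 \<le> \<rho> x z \<and> \<rho> x z \<le> 1" "\<And>x z. x \<in> K \<Longrightarrow> z \<in> U x \<Longrightarrow> \<rho> x z = 1"
      "\<And>x z. x \<in> K \<Longrightarrow> z \<notin> L x \<Longrightarrow> \<rho> x z = 0"
    by simp_all
  obtain I where I: "finite I" "I \<subseteq> K" "K \<subseteq> (\<Union>x\<in>I. U x)"
    using finite_subcover_by_points[OF K loc(1)] .
  define \<psi> where "\<psi> = (\<lambda>z. 1 - (\<Prod>x\<in>I. 1 - \<rho> x z))"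
  show thesis
  proof (rule that)
    show "compactin X (\<Union>x\<in>I. L x)" using I loc(2) by (intro compactin_Union) auto
    show "smooth_fun A \<psi>" unfolding \<psi>_def
      using I loc(3) by (intro smooth_fun_one_minus[OF M] smooth_fun_prod[OF M]) auto
    show "0 \<le> \<psi> z" "\<psi> z \<le> 1" for z
      using I loc(4) unfolding \<psi>_def by (auto intro!: prod_le_1 prod_nonneg)
    show "\<psi> z = 1" if z: "z \<in> K" for z
    proof -
      obtain x where "x \<in> I" "z \<in> U x" using z I by blast
      then have "(\<Prod>x\<in>I. 1 - \<rho> x z) = 0" using I loc(5)[of x z] by (intro prod_zero bexI[of _ x]) auto
      then show ?thesis by (simp add: \<psi>_def)
    qed
    show "\<psi> z = 0" if "z \<notin> (\<Union>x\<in>I. L x)" for z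
      using that I loc(6) unfolding \<psi>_def by (simp add: subset_eq)
  qed
qed

section \<open>Comass estimates\<close>

text \<open>
  The determinant of the matrix of the \<open>G (v i) (u j)\<close>.  Keeping two families of vectors apart makes it
  an alternating form in the first one, so that facts on alternating forms apply to Gram determinants.
\<close>
definition mixed_gram_det ::
    "('b \<Rightarrow> 'b \<Rightarrow> real) \<Rightarrow> nat \<Rightarrow> (nat \<Rightarrow> 'b) \<Rightarrow> (nat \<Rightarrow> 'b) \<Rightarrow> real"
  where "mixed_gram_det G p v u =
    (\<Sum>\<sigma> | \<sigma> permutes {..<p}. of_int (sign \<sigma>) * (\<Prod>i<p. G (v i) (u (\<sigma> i))))"

lemma gram_det_eq_mixed: "gram_det g p c y v = mixed_gram_det (g c y) p v v"
  by (simp add: gram_det_def mixed_gram_det_def)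

lemma mixed_gram_det_sym:
  assumes "\<And>u v. G u v = G v u"
  shows "mixed_gram_det G p v u = mixed_gram_det G p u v"
proof -
  have "mixed_gram_det G p v u =
      (\<Sum>\<sigma> | \<sigma> permutes {..<p}. of_int (sign (inv \<sigma>)) * (\<Prod>i<p. G (v i) (u (inv \<sigma> i))))"
    unfolding mixed_gram_det_def by (rule sum_permutations_inverse)
  also have "\<dots> = (\<Sum>\<sigma> | \<sigma> permutes {..<p}. of_int (sign \<sigma>) * (\<Prod>i<p. G (u i) (v (\<sigma> i))))"
  proof (rule sum.cong[OF refl])
    fix \<sigma> assume "\<sigma> \<in> {\<sigma>. \<sigma> permutes {..<p}}"
    then have \<sigma>: "\<sigma> permutes {..<p}" by simp
    have "(\<Prod>i<p. G (v i) (u (inv \<sigma> i))) = (\<Prod>i<p. G (v (\<sigma> i)) (u (inv \<sigma> (\<sigma> i))))"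
      using prod.permute[OF \<sigma>, of "\<lambda>i. G (v i) (u (inv \<sigma> i))"] by (simp add: o_def)
    also have "\<dots> = (\<Prod>i<p. G (u i) (v (\<sigma> i)))"
      using permutes_inverses(2)[OF \<sigma>] assms by simp
    finally show "of_int (sign (inv \<sigma>)) * (\<Prod>i<p. G (v i) (u (inv \<sigma> i))) =
        of_int (sign \<sigma>) * (\<Prod>i<p. G (u i) (v (\<sigma> i)))"
      using sign_inverse[of \<sigma>] permutes_imp_permutation[OF _ \<sigma>] by simp
  qed
  finally show ?thesis by (simp add: mixed_gram_det_def)
qed

text \<open>
  If two of the vectors agree, precomposing the permutations with their transposition changes the sign
  of each summand only.
\<close>
lemma alternating_form_mixed_gram_det:
  fixes G :: "real ^ 'n::finite \<Rightarrow> real ^ 'n \<Rightarrow> real"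
  assumes G: "bilinear G"
  shows "alternating_form p (\<lambda>v. mixed_gram_det G p v u)"
  unfolding alternating_form_def
proof (intro conjI allI impI)
  fix v v' :: "nat \<Rightarrow> real ^ 'n" assume "\<forall>i<p. v i = v' i"
  then show "mixed_gram_det G p v u = mixed_gram_det G p v' u"
    unfolding mixed_gram_det_def by (intro sum.cong refl arg_cong2[of _ _ _ _ "(*)"] prod.cong) auto
next
  fix v :: "nat \<Rightarrow> real ^ 'n" and j assume j: "j < p"
  have "linear (\<lambda>x. of_int (sign \<sigma>) * (\<Prod>i<p. G ((v(j := x)) i) (u (\<sigma> i))))" for \<sigma>
  proof -
    have "(\<Prod>i<p. G ((v(j := x)) i) (u (\<sigma> i))) =
        G x (u (\<sigma> j)) * (\<Prod>i\<in>{..<p} - {j}. G (v i) (u (\<sigma> i)))" for x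
      using j by (subst prod.remove[of _ j]) auto
    moreover have "linear (\<lambda>x. (of_int (sign \<sigma>) * (\<Prod>i\<in>{..<p} - {j}. G (v i) (u (\<sigma> i)))) *\<^sub>R G x (u (\<sigma> j)))"
      using G unfolding bilinear_def by (intro linear_compose_scale_right) blast
    ultimately show ?thesis by (simp add: mult_ac)
  qed
  then show "linear (\<lambda>x. mixed_gram_det G p (v(j := x)) u)"
    unfolding mixed_gram_det_def by (intro linear_compose_sum) blast
next
  fix v :: "nat \<Rightarrow> real ^ 'n" and a b assume ab: "a < p" "b < p" "a \<noteq> b \<and> v a = v b"
  let ?t = "Transposition.transpose a b"
  have t: "?t permutes {..<p}" using ab by (intro permutes_swap_id) auto
  have "mixed_gram_det G p v u =
      (\<Sum>\<sigma> | \<sigma> permutes {..<p}. of_int (sign (\<sigma> \<circ> ?t)) * (\<Prod>i<p. G (v i) (u ((\<sigma> \<circ> ?t) i))))"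
    unfolding mixed_gram_det_def by (rule sum_permutations_compose_right[OF t])
  also have "\<dots> = (\<Sum>\<sigma> | \<sigma> permutes {..<p}. - (of_int (sign \<sigma>) * (\<Prod>i<p. G (v i) (u (\<sigma> i)))))"
  proof (rule sum.cong[OF refl])
    fix \<sigma> assume "\<sigma> \<in> {\<sigma>. \<sigma> permutes {..<p}}"
    then have \<sigma>: "permutation \<sigma>" by (auto intro: permutes_imp_permutation)
    have "(\<Prod>i<p. G (v i) (u (\<sigma> i))) = (\<Prod>i<p. G (v (?t i)) (u (\<sigma> (?t i))))"
      using prod.permute[OF t, of "\<lambda>i. G (v i) (u (\<sigma> i))"] by (simp add: o_def)
    also have "\<dots> = (\<Prod>i<p. G (v i) (u ((\<sigma> \<circ> ?t) i)))"
      using ab(3) by (intro prod.cong) (auto simp: Transposition.transpose_def)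
    finally have "(\<Prod>i<p. G (v i) (u ((\<sigma> \<circ> ?t) i))) = (\<Prod>i<p. G (v i) (u (\<sigma> i)))" ..
    moreover have "sign (\<sigma> \<circ> ?t) = - sign \<sigma>"
      using sign_compose[OF \<sigma> permutation_swap_id[of a b]] ab(3) by (simp add: sign_swap_id)
    ultimately show "of_int (sign (\<sigma> \<circ> ?t)) * (\<Prod>i<p. G (v i) (u ((\<sigma> \<circ> ?t) i))) =
        - (of_int (sign \<sigma>) * (\<Prod>i<p. G (v i) (u (\<sigma> i))))"
      by simp
  qed
  also have "\<dots> = - mixed_gram_det G p v u" by (simp add: sum_negf mixed_gram_det_def)
  finally show "mixed_gram_det G p v u = 0" by simp
qed

text \<open>
  Only the identity permutation contributes.
\<close>
lemma mixed_gram_det_orthogonal: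
  assumes "\<And>i j. i < p \<Longrightarrow> j < p \<Longrightarrow> i \<noteq> j \<Longrightarrow> G (v i) (v j) = 0"
  shows "mixed_gram_det G p v v = (\<Prod>i<p. G (v i) (v i))"
proof -
  have "mixed_gram_det G p v v = (\<Sum>\<sigma>\<in>{id}. of_int (sign \<sigma>) * (\<Prod>i<p. G (v i) (v (\<sigma> i))))"
    unfolding mixed_gram_det_def
  proof (rule sum.mono_neutral_right)
    show "finite {\<sigma>. \<sigma> permutes {..<p}}" by (simp add: finite_permutations)
    show "{id} \<subseteq> {\<sigma>. \<sigma> permutes {..<p}}" by (simp add: permutes_id)
    show "\<forall>\<sigma>\<in>{\<sigma>. \<sigma> permutes {..<p}} - {id}. of_int (sign \<sigma>) * (\<Prod>i<p. G (v i) (v (\<sigma> i))) = 0"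
    proof
      fix \<sigma> assume "\<sigma> \<in> {\<sigma>. \<sigma> permutes {..<p}} - {id}"
      then have \<sigma>: "\<sigma> permutes {..<p}" "\<sigma> \<noteq> id" by auto
      then obtain i where i: "\<sigma> i \<noteq> i" by (auto simp: fun_eq_iff)
      then have "i < p" using \<sigma>(1) by (auto simp: permutes_def)
      moreover have "\<sigma> i < p" using permutes_in_image[OF \<sigma>(1), of i] \<open>i < p\<close> by simp
      ultimately have "(\<Prod>i<p. G (v i) (v (\<sigma> i))) = 0"
        using assms[of i "\<sigma> i"] i by (intro prod_zero) auto
      then show "of_int (sign \<sigma>) * (\<Prod>i<p. G (v i) (v (\<sigma> i))) = 0" by simp
    qed
  qed
  then show ?thesis by simp
qed

lemma alternating_form_add_combination:
  assumes w: "alternating_form p w" and m: "m < p"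
  shows "w (v(m := v m - (\<Sum>i<m. r i *\<^sub>R v i))) = w v"
proof -
  note lin = alternating_form_linear[OF w m, of v]
  have "w (v(m := v m - (\<Sum>i<m. r i *\<^sub>R v i))) = w (v(m := v m)) - (\<Sum>i<m. r i * w (v(m := v i)))"
    using linear_diff[OF lin, of "v m" "\<Sum>i<m. r i *\<^sub>R v i"] linear_sum[OF lin, of "\<lambda>i. r i *\<^sub>R v i" "{..<m}"]
      linear_scale[OF lin] by simp
  moreover have "w (v(m := v i)) = 0" if "i < m" for i
    using that m by (intro alternating_form_zero[OF w, of i m]) auto
  ultimately show ?thesis by simp
qed

text \<open>
  Gram-Schmidt without normalisation.  Every step subtracts from one vector a combination of others,
  and this changes no alternating form, whatever the form is.  So one orthogonal family serves for
  the given form and, in both slots, for the Gram determinant.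
\<close>
lemma orthogonalise:
  fixes G :: "real ^ 'n::finite \<Rightarrow> real ^ 'n \<Rightarrow> real"
  assumes G: "bilinear G" "\<And>u v. G u v = G v u" "\<And>u. u \<noteq> 0 \<Longrightarrow> G u u > 0"
  shows "m \<le> p \<Longrightarrow> \<exists>v'. (\<forall>w. alternating_form p w \<longrightarrow> w v' = w v) \<and>
    (\<forall>i<m. \<forall>j<m. i \<noteq> j \<longrightarrow> G (v' i) (v' j) = 0)"
proof (induction m)
  case 0
  then show ?case by auto
next
  case (Suc m)
  then obtain v' where v': "\<And>w. alternating_form p w \<Longrightarrow> w v' = w v"
      "\<And>i j. i < m \<Longrightarrow> j < m \<Longrightarrow> i \<noteq> j \<Longrightarrow> G (v' i) (v' j) = 0"
    by auto
  define r where "r = (\<lambda>i. G (v' m) (v' i) / G (v' i) (v' i))"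
  define x where "x = v' m - (\<Sum>i<m. r i *\<^sub>R v' i)"
  have lin: "linear (\<lambda>u. G u z)" for z using G(1) unfolding bilinear_def by blast
  have x_orth: "G x (v' j) = 0" if j: "j < m" for j
  proof -
    have "G x (v' j) = G (v' m) (v' j) - (\<Sum>i<m. r i * G (v' i) (v' j))"
      unfolding x_def by (simp add: linear_diff[OF lin] linear_sum[OF lin] linear_scale[OF lin])
    also have "(\<Sum>i<m. r i * G (v' i) (v' j)) = (\<Sum>i<m. if i = j then r j * G (v' j) (v' j) else 0)"
      using v'(2) j by (intro sum.cong) auto
    also have "\<dots> = r j * G (v' j) (v' j)" using j by simp
    also have "\<dots> = G (v' m) (v' j)"
    proof (cases "v' j = 0")
      case True
      then show ?thesis using linear_0[OF lin] G(2)[of _ 0] by simp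
    next
      case False
      then show ?thesis using G(3)[of "v' j"] by (simp add: r_def)
    qed
    finally show ?thesis by simp
  qed
  have "w (v'(m := x)) = w v" if "alternating_form p w" for w
    using alternating_form_add_combination[OF that, of m v' r] v'(1)[OF that] Suc.prems
    by (simp add: x_def)
  moreover have "G ((v'(m := x)) i) ((v'(m := x)) j) = 0" if "i < Suc m" "j < Suc m" "i \<noteq> j" for i j
    using that v'(2)[of i j] x_orth[of i] x_orth[of j] G(2)[of "v' i" x] by (auto simp: less_Suc_eq)
  ultimately show ?case by blast
qed

lemma alternating_form_bound_basis:
  fixes w :: "(nat \<Rightarrow> real ^ 'n::finite) \<Rightarrow> real"
  assumes w: "alternating_form p w"
    and e: "\<And>s. (\<And>i. i < p \<Longrightarrow> s i \<in> Basis) \<Longrightarrow> \<bar>w s\<bar> \<le> e"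
  shows "m \<le> p \<Longrightarrow> (\<And>i. m \<le> i \<Longrightarrow> i < p \<Longrightarrow> v i \<in> Basis) \<Longrightarrow>
    \<bar>w v\<bar> \<le> e * (\<Prod>i<m. \<Sum>b\<in>Basis. \<bar>v i \<bullet> b\<bar>)"
proof (induction m arbitrary: v)
  case 0
  then show ?case using e by simp
next
  case (Suc m)
  then have m: "m < p" by simp
  let ?P = "\<Prod>i<m. \<Sum>b\<in>Basis. \<bar>v i \<bullet> b\<bar>"
  have "\<bar>w (v(m := b))\<bar> \<le> e * ?P" if "b \<in> Basis" for b
  proof -
    have "\<bar>w (v(m := b))\<bar> \<le> e * (\<Prod>i<m. \<Sum>b'\<in>Basis. \<bar>(v(m := b)) i \<bullet> b'\<bar>)"
      using Suc.prems that by (intro Suc.IH) (auto simp: Suc_le_eq)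
    then show ?thesis by simp
  qed
  then have "(\<Sum>b\<in>Basis. \<bar>v m \<bullet> b\<bar> * \<bar>w (v(m := b))\<bar>) \<le> (\<Sum>b\<in>Basis. \<bar>v m \<bullet> b\<bar> * (e * ?P))"
    by (intro sum_mono mult_left_mono) auto
  moreover have "w v = (\<Sum>b\<in>Basis. (v m \<bullet> b) * w (v(m := b)))"
    using linear_expand_basis[OF alternating_form_linear[OF w m, of v], of "v m"] by simp
  then have "\<bar>w v\<bar> \<le> (\<Sum>b\<in>Basis. \<bar>v m \<bullet> b\<bar> * \<bar>w (v(m := b))\<bar>)"
    using sum_abs[of "\<lambda>b. (v m \<bullet> b) * w (v(m := b))" Basis] by (simp add: abs_mult)
  moreover have "(\<Sum>b\<in>Basis. \<bar>v m \<bullet> b\<bar> * (e * ?P)) = e * (\<Prod>i<Suc m. \<Sum>b\<in>Basis. \<bar>v i \<bullet> b\<bar>)"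
    unfolding sum_distrib_right[symmetric] by simp
  ultimately show ?case by linarith
qed

text \<open>
  Once \<open>v\<close> is orthogonal, its Gram determinant is the product of the \<open>G (v i) (v i)\<close>, so the latter
  product is \<open>1\<close>.  Expanding \<open>w v\<close> in the standard basis bounds it by \<open>e\<close> times a product of norms,
  each at most a multiple of \<open>sqrt (G (v i) (v i))\<close>.
\<close>
lemma alternating_form_bound_gram:
  fixes w :: "(nat \<Rightarrow> real ^ 'n::finite) \<Rightarrow> real"
  assumes G: "bilinear G" "\<And>u v. G u v = G v u" and r: "r > 0" "\<And>u. r * (norm u)\<^sup>2 \<le> G u u"
    and w: "alternating_form p w"
    and e: "\<And>s. (\<And>i. i < p \<Longrightarrow> s i \<in> Basis) \<Longrightarrow> \<bar>w s\<bar> \<le> e" "e \<ge> 0"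
    and v: "mixed_gram_det G p v v = 1"
  shows "\<bar>w v\<bar> \<le> (DIM(real ^ 'n) / sqrt r) ^ p * e"
proof -
  have pos: "G u u > 0" if "u \<noteq> 0" for u
    using r(2)[of u] r(1) that by (smt (verit) mult_pos_pos zero_less_norm_iff zero_less_power)
  obtain v' where v': "\<And>w. alternating_form p w \<Longrightarrow> w v' = w v"
      "\<And>i j. i < p \<Longrightarrow> j < p \<Longrightarrow> i \<noteq> j \<Longrightarrow> G (v' i) (v' j) = 0"
    using orthogonalise[OF G pos order_refl, of p v] by blast
  have "mixed_gram_det G p v' v' = mixed_gram_det G p v v'"
    by (rule v'(1)[OF alternating_form_mixed_gram_det[OF G(1)]])
  also have "\<dots> = mixed_gram_det G p v' v" by (rule mixed_gram_det_sym[OF G(2)])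
  also have "\<dots> = mixed_gram_det G p v v"
    by (rule v'(1)[OF alternating_form_mixed_gram_det[OF G(1)]])
  finally have prod1: "(\<Prod>i<p. G (v' i) (v' i)) = 1"
    using v mixed_gram_det_orthogonal[of p G v', OF v'(2)] by simp
  have nn: "0 \<le> G u u" for u using pos[of u] r(2)[of 0] by (cases "u = 0") auto
  have norm_le: "(\<Sum>b\<in>Basis. \<bar>u \<bullet> b\<bar>) \<le> DIM(real ^ 'n) / sqrt r * sqrt (G u u)" for u :: "real ^ 'n"
  proof -
    have "(\<Sum>b\<in>Basis. \<bar>u \<bullet> b\<bar>) \<le> (\<Sum>b\<in>(Basis :: (real ^ 'n) set). norm u)"
      by (intro sum_mono Basis_le_norm)
    also have "\<dots> = DIM(real ^ 'n) * norm u" by simp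
    also have "norm u = sqrt ((norm u)\<^sup>2)" by simp
    also have "\<dots> \<le> sqrt (G u u / r)"
      using r(1) r(2)[of u] by (intro real_sqrt_le_mono) (simp add: field_simps)
    finally show ?thesis by (simp add: real_sqrt_divide mult_left_mono)
  qed
  have "w v = w v'" using v'(1)[OF w] by simp
  also have "\<bar>\<dots>\<bar> \<le> e * (\<Prod>i<p. \<Sum>b\<in>Basis. \<bar>v' i \<bullet> b\<bar>)"
    by (rule alternating_form_bound_basis[OF w e(1)]) auto
  also have "\<dots> \<le> e * (\<Prod>i<p. DIM(real ^ 'n) / sqrt r * sqrt (G (v' i) (v' i)))"
    using norm_le e(2) by (intro mult_left_mono prod_mono) (auto intro: sum_nonneg)
  also have "\<dots> = (DIM(real ^ 'n) / sqrt r) ^ p * e * (\<Prod>i<p. sqrt (G (v' i) (v' i)))"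
    unfolding prod.distrib by simp
  also have "(\<Prod>i<p. sqrt (G (v' i) (v' i))) = 1"
  proof -
    have "(\<Prod>i<p. sqrt (G (v' i) (v' i)))\<^sup>2 = 1"
      using prod1 nn by (simp add: prod_power_distrib)
    moreover have "(\<Prod>i<p. sqrt (G (v' i) (v' i))) \<ge> 0" using nn by (intro prod_nonneg) simp
    ultimately show ?thesis by (simp add: power2_eq_1_iff)
  qed
  finally show ?thesis by simp
qed

section \<open>Comass of compactly supported forms\<close>

lemma riemannian_metricD:
  assumes "riemannian_metric A g" "c \<in> A"
  shows "y \<in> chart_image c \<Longrightarrow> bilinear (g c y)" "y \<in> chart_image c \<Longrightarrow> g c y u v = g c y v u"
    "y \<in> chart_image c \<Longrightarrow> u \<noteq> 0 \<Longrightarrow> g c y u u > 0"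
    "smooth_on (chart_image c) (\<lambda>y. g c y u v)"
    "c' \<in> A \<Longrightarrow> x \<in> fst c \<Longrightarrow> x \<in> fst c' \<Longrightarrow>
      g c (snd c x) u v = g c' (snd c' x) (transition_deriv c c' x u) (transition_deriv c c' x v)"
  using assms unfolding riemannian_metric_def by blast+

text \<open>
  By homogeneity it suffices to treat unit vectors, where \<open>g c y u u\<close> has a positive minimum by
  compactness.
\<close>
lemma metric_lower_bound:
  fixes c :: "('a, 'n::finite) chart"
  assumes g: "riemannian_metric A g" and c: "c \<in> A" and L: "compact L" "L \<subseteq> chart_image c"
  obtains r where "r > 0" "\<And>y u. y \<in> L \<Longrightarrow> r * (norm u)\<^sup>2 \<le> g c y u u"
proof (cases "L = {}")
  case True
  then show thesis using that[of 1] by simp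
next
  case False
  let ?S = "L \<times> sphere (0 :: real ^ 'n) 1"
  have expand: "g c y u u = (\<Sum>a\<in>Basis. \<Sum>b\<in>Basis. (u \<bullet> a) * ((u \<bullet> b) * g c y a b))"
    if y: "y \<in> L" for y u
  proof -
    have bil: "bilinear (g c y)" using riemannian_metricD(1)[OF g c] y L by blast
    have "g c y u u = (\<Sum>a\<in>Basis. (u \<bullet> a) * g c y a u)"
      using bil unfolding bilinear_def by (intro linear_expand_basis) blast
    also have "\<dots> = (\<Sum>a\<in>Basis. (u \<bullet> a) * (\<Sum>b\<in>Basis. (u \<bullet> b) * g c y a b))"
    proof (intro sum.cong refl arg_cong2[of _ _ _ _ "(*)"])
      fix a
      show "g c y a u = (\<Sum>b\<in>Basis. (u \<bullet> b) * g c y a b)"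
        using bil unfolding bilinear_def by (intro linear_expand_basis) blast
    qed
    finally show ?thesis by (simp add: sum_distrib_left)
  qed
  have "continuous_on ?S (\<lambda>x. g c (fst x) a b)" for a b
  proof (rule continuous_on_compose2[OF _ continuous_on_fst[OF continuous_on_id]])
    show "continuous_on L (\<lambda>y. g c y a b)"
      using smooth_onD(3)[OF riemannian_metricD(4)[OF g c]] L(2) continuous_on_subset by blast
  qed auto
  then have "continuous_on ?S (\<lambda>x. \<Sum>a\<in>Basis. \<Sum>b\<in>Basis. (snd x \<bullet> a) * ((snd x \<bullet> b) * g c (fst x) a b))"
    by (intro continuous_intros)
  then have cont: "continuous_on ?S (\<lambda>x. g c (fst x) (snd x) (snd x))"
    by (rule continuous_on_eq) (auto simp: expand)
  have ne: "?S \<noteq> {}" using False by simp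
  have "compact ?S" using L(1) by (intro compact_Times compact_sphere)
  from continuous_attains_inf[OF this ne cont] obtain z where z: "z \<in> ?S"
      "\<And>x. x \<in> ?S \<Longrightarrow> g c (fst z) (snd z) (snd z) \<le> g c (fst x) (snd x) (snd x)"
    by blast
  define r where "r = g c (fst z) (snd z) (snd z)"
  have "snd z \<noteq> 0" "fst z \<in> chart_image c" using z(1) L(2) by auto
  then have "r > 0" unfolding r_def using riemannian_metricD(3)[OF g c] by blast
  moreover have "r * (norm u)\<^sup>2 \<le> g c y u u" if y: "y \<in> L" for y u
  proof (cases "u = 0")
    case True
    then show ?thesis using expand[OF y, of 0] by simp
  next
    case False
    have bil: "bilinear (g c y)" using riemannian_metricD(1)[OF g c] y L by blast
    let ?e = "u /\<^sub>R norm u"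
    have "(y, ?e) \<in> ?S" using False y by simp
    from z(2)[OF this] have "r \<le> g c y ?e ?e" by (simp add: r_def)
    then have "r * (norm u)\<^sup>2 \<le> g c y ?e ?e * (norm u)\<^sup>2" by (intro mult_right_mono) auto
    also have "\<dots> = g c y u u"
      using False by (simp add: bilinear_lmul[OF bil] bilinear_rmul[OF bil] power2_eq_square field_simps)
    finally show ?thesis .
  qed
  ultimately show thesis using that by blast
qed

text \<open>
  An alternating \<open>p\<close>-form is determined by its values on these finitely many tuples.
\<close>
definition basis_tuples :: "nat \<Rightarrow> (nat \<Rightarrow> real ^ 'n::finite) set"
  where "basis_tuples p = PiE {..<p} (\<lambda>_. Basis)"

lemma finite_basis_tuples: "finite (basis_tuples p)"
  unfolding basis_tuples_def by (intro finite_PiE) auto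

lemma comass_bound_on_compact:
  fixes A :: "('a, 'n::finite) chart set"
  assumes g: "riemannian_metric A g" and c: "c \<in> A" and L: "compact L" "L \<subseteq> chart_image c"
  obtains C where "C > 0" "\<And>y (w :: (nat \<Rightarrow> real ^ 'n) \<Rightarrow> real) e v. y \<in> L \<Longrightarrow> alternating_form p w \<Longrightarrow> e \<ge> 0 \<Longrightarrow>
    (\<And>s. s \<in> basis_tuples p \<Longrightarrow> \<bar>w s\<bar> \<le> e) \<Longrightarrow> v \<in> unit_simple g p c y \<Longrightarrow> \<bar>w v\<bar> \<le> C * e"
proof -
  obtain r where r: "r > 0" "\<And>y u. y \<in> L \<Longrightarrow> r * (norm u)\<^sup>2 \<le> g c y u u"
    using metric_lower_bound[OF g c L] by blast
  show thesis
  proof (rule that)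
    show "(DIM(real ^ 'n) / sqrt r) ^ p > 0" using r(1) by simp
    fix y e v and w :: "(nat \<Rightarrow> real ^ 'n) \<Rightarrow> real" assume y: "y \<in> L" and w: "alternating_form p w" and e: "e \<ge> 0"
      "\<And>s. s \<in> basis_tuples p \<Longrightarrow> \<bar>w s\<bar> \<le> e" and v: "v \<in> unit_simple g p c y"
    have y': "y \<in> chart_image c" using y L by blast
    have "\<bar>w s\<bar> \<le> e" if s: "\<And>i. i < p \<Longrightarrow> s i \<in> Basis" for s
    proof -
      have "w s = w (restrict s {..<p})" by (rule alternating_form_cong[OF w]) simp
      moreover have "restrict s {..<p} \<in> basis_tuples p" using s by (auto simp: basis_tuples_def)
      ultimately show ?thesis using e(2) by simp
    qed
    then show "\<bar>w v\<bar> \<le> (DIM(real ^ 'n) / sqrt r) ^ p * e"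
      using v e(1) by (intro alternating_form_bound_gram[OF riemannian_metricD(1,2)[OF g c y'] r(1) r(2)[OF y] w])
        (auto simp: unit_simple_def gram_det_eq_mixed)
  qed
qed

lemma unit_simple_transition:
  assumes g: "riemannian_metric A g" and c: "c \<in> A" "c' \<in> A" and x: "x \<in> fst c" "x \<in> fst c'"
    and v: "v \<in> unit_simple g p c (snd c x)"
  shows "(\<lambda>i. transition_deriv c c' x (v i)) \<in> unit_simple g p c' (snd c' x)"
  using v unfolding unit_simple_def gram_det_def by (simp add: riemannian_metricD(5)[OF g c x])

text \<open>
  The absolute value makes this a bound by a seminorm also for \<open>p = 0\<close>, where a simple vector has no
  negative.
\<close>
definition abs_comass_le ::
    "('a, 'n::finite) chart set \<Rightarrow> ('a, 'n) metric_field \<Rightarrow> nat \<Rightarrow> real \<Rightarrow> ('a, 'n) form \<Rightarrow> bool"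
  where "abs_comass_le A g p t \<omega> \<longleftrightarrow>
    (\<forall>c\<in>A. \<forall>y\<in>chart_image c. \<forall>v\<in>unit_simple g p c y. \<bar>\<omega> c y v\<bar> \<le> t)"

text \<open>
  Finitely many charts with compact sets \<open>L\<close> cover \<open>K\<close>.  The comass at a point of \<open>K\<close> may be computed in
  any chart around it, because the transition maps preserve both the form and the Gram determinant;
  and outside \<open>K\<close> the form vanishes.
\<close>
lemma comass_controlled_by_coefficients:
  fixes A :: "('a, 'n::finite) chart set"
  assumes M: "oriented_manifold X A" and g: "riemannian_metric A g" and K: "compactin X K"
  obtains Q and C :: real where "finite Q" "C > 0"
    "\<And>c L. (c, L) \<in> Q \<Longrightarrow> c \<in> A \<and> compact L \<and> L \<subseteq> chart_image c"
    "\<And>\<omega> e. \<omega> \<in> smooth_forms A p \<Longrightarrow> form_support X A \<omega> \<subseteq> K \<Longrightarrow> e \<ge> 0 \<Longrightarrow>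
      (\<And>c L y s. (c, L) \<in> Q \<Longrightarrow> y \<in> L \<Longrightarrow> s \<in> basis_tuples p \<Longrightarrow> \<bar>\<omega> c y s\<bar> \<le> e) \<Longrightarrow>
      abs_comass_le A g p (C * e) \<omega>"
proof -
  have "\<exists>c r. c \<in> A \<and> x \<in> fst c \<and> r > 0 \<and> cball (snd c x) r \<subseteq> chart_image c" if x: "x \<in> K" for x
  proof -
    obtain c where c: "c \<in> A" "x \<in> fst c"
      using oriented_manifoldD(3)[OF M] compactin_subset_topspace[OF K] x by blast
    then have "snd c x \<in> chart_image c" unfolding chart_image_def by blast
    then show ?thesis using c oriented_manifoldD(2)[OF M c(1)] open_contains_cball by blast
  qed
  then obtain c r where cr: "\<And>x. x \<in> K \<Longrightarrow> c x \<in> A" "\<And>x. x \<in> K \<Longrightarrow> x \<in> fst (c x)"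
      "\<And>x. x \<in> K \<Longrightarrow> r x > 0" "\<And>x. x \<in> K \<Longrightarrow> cball (snd (c x) x) (r x) \<subseteq> chart_image (c x)"
    by metis
  define L where "L = (\<lambda>x. cball (snd (c x) x) (r x))"
  define U where "U = (\<lambda>x. {z \<in> fst (c x). snd (c x) z \<in> ball (snd (c x) x) (r x)})"
  have U: "openin X (U x) \<and> x \<in> U x" if "x \<in> K" for x
    using chart_open_vimage[OF oriented_manifoldD(1)[OF M cr(1)[OF that]] open_ball] cr(2,3)[OF that]
    unfolding U_def by simp
  obtain I where I: "finite I" "I \<subseteq> K" "K \<subseteq> (\<Union>x\<in>I. U x)"
    using finite_subcover_by_points[OF K U] .
  have "\<exists>C>0. \<forall>y (w :: (nat \<Rightarrow> real ^ 'n) \<Rightarrow> real) e v. y \<in> L x \<longrightarrow> alternating_form p w \<longrightarrow> e \<ge> 0 \<longrightarrow>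
    (\<forall>s \<in> basis_tuples p. \<bar>w s\<bar> \<le> e) \<longrightarrow> v \<in> unit_simple g p (c x) y \<longrightarrow> \<bar>w v\<bar> \<le> C * e" if x: "x \<in> K" for x
  proof -
    obtain C where C: "C > 0" "\<And>y (w :: (nat \<Rightarrow> real ^ 'n) \<Rightarrow> real) e v. y \<in> L x \<Longrightarrow> alternating_form p w \<Longrightarrow> e \<ge> 0 \<Longrightarrow>
        (\<And>s. s \<in> basis_tuples p \<Longrightarrow> \<bar>w s\<bar> \<le> e) \<Longrightarrow> v \<in> unit_simple g p (c x) y \<Longrightarrow> \<bar>w v\<bar> \<le> C * e"
      using comass_bound_on_compact[OF g cr(1)[OF x] compact_cball cr(4)[OF x]] unfolding L_def by blast
    show ?thesis using C(1) by (intro exI[of _ C] conjI allI impI C(2)) auto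
  qed
  then have "\<forall>x\<in>K. \<exists>C>0. \<forall>y (w :: (nat \<Rightarrow> real ^ 'n) \<Rightarrow> real) e v. y \<in> L x \<longrightarrow> alternating_form p w \<longrightarrow> e \<ge> 0 \<longrightarrow>
    (\<forall>s \<in> basis_tuples p. \<bar>w s\<bar> \<le> e) \<longrightarrow> v \<in> unit_simple g p (c x) y \<longrightarrow> \<bar>w v\<bar> \<le> C * e"
    by blast
  from bchoice[OF this] obtain C where "\<forall>x\<in>K. C x > 0 \<and> (\<forall>y (w :: (nat \<Rightarrow> real ^ 'n) \<Rightarrow> real) e v. y \<in> L x \<longrightarrow> alternating_form p w \<longrightarrow> e \<ge> 0 \<longrightarrow>
    (\<forall>s \<in> basis_tuples p. \<bar>w s\<bar> \<le> e) \<longrightarrow> v \<in> unit_simple g p (c x) y \<longrightarrow> \<bar>w v\<bar> \<le> C x * e)"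
    by blast
  then have C: "\<And>x. x \<in> K \<Longrightarrow> C x > 0"
      "\<And>x y (w :: (nat \<Rightarrow> real ^ 'n) \<Rightarrow> real) e v. x \<in> K \<Longrightarrow> y \<in> L x \<Longrightarrow> alternating_form p w \<Longrightarrow> e \<ge> 0 \<Longrightarrow>
        (\<forall>s \<in> basis_tuples p. \<bar>w s\<bar> \<le> e) \<Longrightarrow> v \<in> unit_simple g p (c x) y \<Longrightarrow> \<bar>w v\<bar> \<le> C x * e"
    by blast+
  \<comment> \<open>The summand \<open>1\<close> keeps the constant positive if \<open>I\<close> is empty.\<close>
  define C' where "C' = 1 + (\<Sum>x\<in>I. C x)"
  have C_le: "C x \<le> C'" if "x \<in> I" for x
  proof -
    have "C x \<le> sum C I"
    proof (rule member_le_sum[OF that _ I(1)])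
      fix z assume "z \<in> I - {x}"
      then have "C z > 0" using C(1) I(2) by blast
      then show "0 \<le> C z" by simp
    qed
    then show ?thesis unfolding C'_def by simp
  qed
  have C'_pos: "C' > 0"
  proof -
    have "0 \<le> C x" if "x \<in> I" for x using C(1)[of x] I(2) that by (auto intro: less_imp_le)
    then show ?thesis unfolding C'_def by (intro add_pos_nonneg sum_nonneg) simp_all
  qed
  show thesis
  proof (rule that)
    show "finite ((\<lambda>x. (c x, L x)) ` I)" using I by simp
    show "C' > 0" by (rule C'_pos)
    show "c' \<in> A \<and> compact L' \<and> L' \<subseteq> chart_image c'" if cL: "(c', L') \<in> (\<lambda>x. (c x, L x)) ` I" for c' L'
    proof -
      obtain x where x: "x \<in> I" "c' = c x" "L' = L x" using cL by blast
      then have "x \<in> K" using I(2) by blast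
      then show ?thesis using cr(1,4)[of x] unfolding x(2,3) L_def by simp
    qed
  next
    fix \<omega> :: "('a, 'n) form" and e :: real
    assume \<omega>: "\<omega> \<in> smooth_forms A p" "form_support X A \<omega> \<subseteq> K" and e: "e \<ge> 0"
      and coeff: "\<And>c' L' y s. (c', L') \<in> (\<lambda>x. (c x, L x)) ` I \<Longrightarrow> y \<in> L' \<Longrightarrow> s \<in> basis_tuples p \<Longrightarrow> \<bar>\<omega> c' y s\<bar> \<le> e"
    show "abs_comass_le A g p (C' * e) \<omega>"
      unfolding abs_comass_le_def
    proof (intro ballI)
      fix d y v assume d: "d \<in> A" and y: "y \<in> chart_image d" and v: "v \<in> unit_simple g p d y"
      obtain z where z: "y = snd d z" "z \<in> fst d" using y unfolding chart_image_def by blast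
      show "\<bar>\<omega> d y v\<bar> \<le> C' * e"
      proof (cases "z \<in> K")
        case False
        then have "\<omega> d y = 0" using form_support_outside[OF M d z(2)] \<omega>(2) z(1) by blast
        then show ?thesis using C'_pos e by simp
      next
        case True
        then obtain x where x: "x \<in> I" "z \<in> U x" using I(3) by blast
        then have xK: "x \<in> K" using I by blast
        have zx: "z \<in> fst (c x)" "snd (c x) z \<in> L x" using x(2) unfolding U_def L_def by auto
        have im: "snd (c x) z \<in> chart_image (c x)" using zx(1) unfolding chart_image_def by blast
        have "\<bar>\<omega> (c x) (snd (c x) z) (\<lambda>i. transition_deriv d (c x) z (v i))\<bar> \<le> C x * e"
        proof (rule C(2)[OF xK zx(2) smooth_formsD(2)[OF \<omega>(1) cr(1)[OF xK] im] e])
          show "\<forall>s\<in>basis_tuples p. \<bar>\<omega> (c x) (snd (c x) z) s\<bar> \<le> e" using coeff x(1) zx(2) by blast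
          show "(\<lambda>i. transition_deriv d (c x) z (v i)) \<in> unit_simple g p (c x) (snd (c x) z)"
            using unit_simple_transition[OF g d cr(1)[OF xK] z(2) zx(1)] v unfolding z(1) .
        qed
        also have "\<dots> \<le> C' * e" using C_le[OF x(1)] e by (rule mult_right_mono)
        finally show ?thesis
          using smooth_formsD(4)[OF \<omega>(1) d cr(1)[OF xK] z(2) zx(1)] unfolding z(1) by simp
      qed
    qed
  qed
qed

lemma test_form_comass_finite:
  fixes A :: "('a, 'n::finite) chart set"
  assumes M: "oriented_manifold X A" and g: "riemannian_metric A g" and \<omega>: "\<omega> \<in> test_forms X A p"
  obtains t where "t \<ge> 0" "abs_comass_le A g p t \<omega>"
proof -
  obtain Q C where Q: "finite Q" "C > 0"
    "\<And>c L. (c, L) \<in> Q \<Longrightarrow> c \<in> A \<and> compact L \<and> L \<subseteq> chart_image c"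
    "\<And>\<eta> e. \<eta> \<in> smooth_forms A p \<Longrightarrow> form_support X A \<eta> \<subseteq> form_support X A \<omega> \<Longrightarrow> e \<ge> 0 \<Longrightarrow>
      (\<And>c L y s. (c, L) \<in> Q \<Longrightarrow> y \<in> L \<Longrightarrow> s \<in> basis_tuples p \<Longrightarrow> \<bar>\<eta> c y s\<bar> \<le> e) \<Longrightarrow>
      abs_comass_le A g p (C * e) \<eta>"
    using comass_controlled_by_coefficients[OF M g test_formsD(2)[OF \<omega>]] by metis
  let ?B = "\<Union>q\<in>Q. \<Union>s\<in>basis_tuples p. (\<lambda>y. \<omega> (fst q) y s) ` snd q"
  have "compact ((\<lambda>y. \<omega> (fst q) y s) ` snd q)" if "q \<in> Q" for q s
  proof (rule compact_continuous_image)
    have q: "fst q \<in> A" "compact (snd q)" "snd q \<subseteq> chart_image (fst q)"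
      using that Q(3)[of "fst q" "snd q"] by simp_all
    show "continuous_on (snd q) (\<lambda>y. \<omega> (fst q) y s)"
      by (rule continuous_on_subset[OF smooth_onD(3)[OF smooth_formsD(3)[OF test_formsD(1)[OF \<omega>] q(1)]] q(3)])
    show "compact (snd q)" by (rule q(2))
  qed
  then have "bounded ?B"
    using Q(1) finite_basis_tuples by (intro bounded_UN ballI compact_imp_bounded)
  then obtain b where b: "b > 0" "\<And>t. t \<in> ?B \<Longrightarrow> \<bar>t\<bar> \<le> b" unfolding bounded_pos by auto
  show thesis
  proof (rule that)
    show "C * b \<ge> 0" using b Q by simp
    show "abs_comass_le A g p (C * b) \<omega>"
    proof (rule Q(4)[OF test_formsD(1)[OF \<omega>] order_refl less_imp_le[OF b(1)]])
      fix c L y and s :: "nat \<Rightarrow> real ^ 'n" assume "(c, L) \<in> Q" "y \<in> L" "s \<in> basis_tuples p"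
      then show "\<bar>\<omega> c y s\<bar> \<le> b" by (intro b(2)) force
    qed
  qed
qed

lemma comass_ball_zero_nhd:
  fixes A :: "('a, 'n::finite) chart set"
  assumes M: "oriented_manifold X A" and g: "riemannian_metric A g" and K: "compactin X K" and t: "t > 0"
  shows "zero_nhd_in X A p K {\<omega> \<in> test_forms X A p. abs_comass_le A g p t \<omega>}"
proof -
  obtain Q C where Q: "finite Q" "C > 0"
    "\<And>c L. (c, L) \<in> Q \<Longrightarrow> c \<in> A \<and> compact L \<and> L \<subseteq> chart_image c"
    "\<And>\<eta> e. \<eta> \<in> smooth_forms A p \<Longrightarrow> form_support X A \<eta> \<subseteq> K \<Longrightarrow> e \<ge> 0 \<Longrightarrow>
      (\<And>c L y s. (c, L) \<in> Q \<Longrightarrow> y \<in> L \<Longrightarrow> s \<in> basis_tuples p \<Longrightarrow> \<bar>\<eta> c y s\<bar> \<le> e) \<Longrightarrow>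
      abs_comass_le A g p (C * e) \<eta>"
    using comass_controlled_by_coefficients[OF M g K] by metis
  define F where "F = (\<lambda>(q, s). (fst q, snd q, [] :: (real ^ 'n) list, s)) ` (Q \<times> (basis_tuples p :: (nat \<Rightarrow> real ^ 'n) set))"
  have "\<omega> \<in> test_forms X A p \<and> abs_comass_le A g p t \<omega>"
    if \<omega>: "\<omega> \<in> smooth_forms A p" "form_support X A \<omega> \<subseteq> K"
      and small: "\<forall>(c, L, us, v)\<in>F. \<forall>y\<in>L. \<bar>iter_deriv us (\<lambda>z. \<omega> c z v) y\<bar> < t / C" for \<omega>
  proof
    show "\<omega> \<in> test_forms X A p"
      using \<omega> closed_compactin[OF K \<omega>(2) closedin_form_support] by (simp add: test_forms_def)
    have "\<bar>\<omega> c y s\<bar> \<le> t / C" if "(c, L) \<in> Q" "y \<in> L" "s \<in> basis_tuples p" for c L y s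
    proof -
      have "(c, L, [], s) \<in> F" unfolding F_def using that by force
      then show ?thesis using small that(2) by fastforce
    qed
    then have "abs_comass_le A g p (C * (t / C)) \<omega>"
      using t Q(2) by (intro Q(4)[OF \<omega>]) auto
    then show "abs_comass_le A g p t \<omega>" using Q(2) by simp
  qed
  moreover have "finite F" unfolding F_def using Q(1) finite_basis_tuples by blast
  moreover have "\<forall>(c, L, us, v)\<in>F. c \<in> A \<and> compact L \<and> L \<subseteq> chart_image c"
    unfolding F_def using Q(3) by fastforce
  ultimately show ?thesis
    unfolding zero_nhd_in_def using t Q(2)
    by (intro exI[of _ F] exI[of _ "t / C"]) auto
qed

text \<open>
  A set \<open>{\<omega>. \<bar>T \<omega>\<bar> < e}\<close> is convex and balanced and contains a comass ball, which traces a
  neighbourhood of zero on the forms supported in any compact set.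
\<close>
lemma continuous_if_comass_bounded:
  assumes M: "oriented_manifold X A" and g: "riemannian_metric A g"
    and add: "\<And>\<omega> \<eta>. \<omega> \<in> test_forms X A p \<Longrightarrow> \<eta> \<in> test_forms X A p \<Longrightarrow> T (\<omega> + \<eta>) = T \<omega> + T \<eta>"
    and scale: "\<And>\<omega> r. \<omega> \<in> test_forms X A p \<Longrightarrow> T (r *\<^sub>R \<omega>) = r * T \<omega>"
    and bound: "\<And>\<omega>. \<omega> \<in> test_forms X A p \<Longrightarrow> abs_comass_le A g p 1 \<omega> \<Longrightarrow> T \<omega> \<le> b"
    and b: "b > 0"
  shows "continuous_map (test_topology X A p) euclideanreal T"
proof -
  note E = subspace_test_forms[OF M, of p]
  have nhd: "{\<omega> \<in> test_forms X A p. \<bar>T \<omega>\<bar> < e} \<in> convex_zero_nhds X A p" if e: "e > 0" for e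
    unfolding convex_zero_nhds_def mem_Collect_eq
  proof (intro conjI allI impI)
    let ?W = "{\<omega> \<in> test_forms X A p. \<bar>T \<omega>\<bar> < e}"
    show "?W \<subseteq> test_forms X A p" by blast
    show "convex ?W"
      unfolding convex_def
    proof (intro ballI allI impI)
      fix \<omega> \<eta> and u v :: real assume W: "\<omega> \<in> ?W" "\<eta> \<in> ?W" and uv: "0 \<le> u" "0 \<le> v" "u + v = 1"
      have "T (u *\<^sub>R \<omega> + v *\<^sub>R \<eta>) = u * T \<omega> + v * T \<eta>"
        using W subspace_scale[OF E] by (simp add: add scale)
      moreover have "\<bar>u * T \<omega> + v * T \<eta>\<bar> < e"
        using W uv convex_bound_lt[of "\<bar>T \<omega>\<bar>" e "\<bar>T \<eta>\<bar>" u v]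
          abs_triangle_ineq[of "u * T \<omega>" "v * T \<eta>"] by (simp add: abs_mult)
      ultimately show "u *\<^sub>R \<omega> + v *\<^sub>R \<eta> \<in> ?W"
        using W subspace_add[OF E subspace_scale[OF E] subspace_scale[OF E]] by simp
    qed
    show "(*\<^sub>R) a ` ?W \<subseteq> ?W" if "\<bar>a\<bar> \<le> 1" for a :: real
    proof -
      have "\<bar>a\<bar> * \<bar>T \<omega>\<bar> < e" if "\<bar>T \<omega>\<bar> < e" for \<omega>
        using mult_right_mono[OF \<open>\<bar>a\<bar> \<le> 1\<close>, of "\<bar>T \<omega>\<bar>"] that by simp
      then show ?thesis using subspace_scale[OF E] by (auto simp: scale abs_mult)
    qed
    fix K assume K: "compactin X K"
    have "\<bar>T \<omega>\<bar> < e" if \<omega>: "\<omega> \<in> test_forms X A p" "abs_comass_le A g p (e / (2 * b)) \<omega>" for \<omega>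
    proof -
      have "T (r *\<^sub>R \<omega>) \<le> b" if "\<bar>r\<bar> = 2 * b / e" for r
      proof (rule bound[OF subspace_scale[OF E \<omega>(1)]])
        have "\<bar>r\<bar> * \<bar>\<omega> c y v\<bar> \<le> 1" if "c \<in> A" "y \<in> chart_image c" "v \<in> unit_simple g p c y" for c y v
        proof -
          have "\<bar>\<omega> c y v\<bar> \<le> e / (2 * b)" using \<omega>(2) that unfolding abs_comass_le_def by blast
          then have "\<bar>r\<bar> * \<bar>\<omega> c y v\<bar> \<le> \<bar>r\<bar> * (e / (2 * b))" by (rule mult_left_mono) simp
          also have "\<dots> = 1" unfolding \<open>\<bar>r\<bar> = 2 * b / e\<close> using b e by simp
          finally show ?thesis .
        qed
        then show "abs_comass_le A g p 1 (r *\<^sub>R \<omega>)" unfolding abs_comass_le_def by (simp add: abs_mult)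
      qed
      \<comment> \<open>Both signs are needed, since \<open>T\<close> is only bounded from above.\<close>
      from this[of "2 * b / e"] this[of "- (2 * b / e)"]
      have "2 * b / e * T \<omega> \<le> b" "- (2 * b / e) * T \<omega> \<le> b"
        unfolding scale[OF \<omega>(1)] using b e by simp_all
      then have "2 * b / e * \<bar>T \<omega>\<bar> \<le> b" by (cases "T \<omega> \<ge> 0") (simp_all only: abs_of_nonneg abs_of_neg not_le mult_minus_right mult_minus_left)
      then have "\<bar>T \<omega>\<bar> \<le> e / 2" using b e by (simp add: field_simps)
      then show ?thesis using e by simp
    qed
    then have "{\<omega> \<in> test_forms X A p. abs_comass_le A g p (e / (2 * b)) \<omega>} \<subseteq> ?W" by blast
    moreover have "zero_nhd_in X A p K {\<omega> \<in> test_forms X A p. abs_comass_le A g p (e / (2 * b)) \<omega>}"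
      using b e by (intro comass_ball_zero_nhd[OF M g K]) simp
    ultimately show "zero_nhd_in X A p K ?W"
      unfolding zero_nhd_in_def by (meson subset_trans)
  qed
  have T_open: "openin (test_topology X A p) {\<omega> \<in> test_forms X A p. T \<omega> \<in> U}" if U: "open U" for U
    unfolding openin_test_topology
  proof (intro conjI ballI)
    fix \<omega> assume "\<omega> \<in> {\<omega> \<in> test_forms X A p. T \<omega> \<in> U}"
    then have \<omega>: "\<omega> \<in> test_forms X A p" "T \<omega> \<in> U" by auto
    then obtain e where e: "e > 0" "ball (T \<omega>) e \<subseteq> U" using U open_contains_ball by blast
    have "\<omega> + \<eta> \<in> test_forms X A p \<and> T (\<omega> + \<eta>) \<in> U" if "\<eta> \<in> test_forms X A p" "\<bar>T \<eta>\<bar> < e" for \<eta>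
      using that \<omega>(1) e(2) subspace_add[OF E] by (auto simp: add dist_real_def subset_eq)
    then show "\<exists>W\<in>convex_zero_nhds X A p. (\<lambda>\<eta>. \<omega> + \<eta>) ` W \<subseteq> {\<omega> \<in> test_forms X A p. T \<omega> \<in> U}"
      using nhd[OF e(1)] by (intro bexI[of _ "{\<eta> \<in> test_forms X A p. \<bar>T \<eta>\<bar> < e}"]) auto
  qed blast
  have "topspace (test_topology X A p) = test_forms X A p"
  proof (rule antisym)
    show "topspace (test_topology X A p) \<subseteq> test_forms X A p"
      using openin_topspace openin_test_topology by blast
    show "test_forms X A p \<subseteq> topspace (test_topology X A p)"
      using openin_subset[OF T_open[OF open_UNIV]] by simp
  qed
  then show ?thesis using T_open unfolding continuous_map_def by simp
qed

section \<open>The duality\<close>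

text \<open>
  The epigraph of \<open>\<psi> \<mapsto> inf lam * comass (\<psi> + \<beta>)\<close>, with \<open>\<beta>\<close> ranging over the positive test forms, up to
  the infimum being attained.  Taking \<open>\<beta> = - \<psi>\<close> shows that a dominated functional is nonnegative on
  positive forms, and taking \<open>\<beta> = 0\<close> that it is at most \<open>lam\<close> on forms of comass at most one.
\<close>
definition phi_domination ::
    "'a topology \<Rightarrow> ('a, 'n::finite) chart set \<Rightarrow> ('a, 'n) metric_field \<Rightarrow> nat \<Rightarrow>
      ('a, 'n) form \<Rightarrow> real \<Rightarrow> (('a, 'n) form \<times> real) set"
  where "phi_domination X A g p \<phi> lam = {(\<psi>, s). \<psi> \<in> test_forms X A p \<and> s \<ge> 0 \<and>
    (\<exists>\<beta>\<in>test_forms X A p. positive_form A g p \<phi> \<beta> \<and>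
      (\<forall>c\<in>A. \<forall>y\<in>chart_image c. \<forall>v\<in>unit_simple g p c y. lam * (\<psi> + \<beta>) c y v \<le> s))}"

lemma phi_dominationI:
  assumes "\<psi> \<in> test_forms X A p" "s \<ge> 0" "\<beta> \<in> test_forms X A p" "positive_form A g p \<phi> \<beta>"
    "\<And>c y v. c \<in> A \<Longrightarrow> y \<in> chart_image c \<Longrightarrow> v \<in> unit_simple g p c y \<Longrightarrow> lam * (\<psi> c y v + \<beta> c y v) \<le> s"
  shows "(\<psi>, s) \<in> phi_domination X A g p \<phi> lam"
  unfolding phi_domination_def using assms by auto

lemma phi_dominationE:
  assumes "(\<psi>, s) \<in> phi_domination X A g p \<phi> lam"
  obtains \<beta> where "\<psi> \<in> test_forms X A p" "s \<ge> 0" "\<beta> \<in> test_forms X A p" "positive_form A g p \<phi> \<beta>"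
    "\<And>c y v. c \<in> A \<Longrightarrow> y \<in> chart_image c \<Longrightarrow> v \<in> unit_simple g p c y \<Longrightarrow> lam * (\<psi> c y v + \<beta> c y v) \<le> s"
  using assms unfolding phi_domination_def by auto

lemma positive_formI:
  assumes "\<beta> \<in> smooth_forms A p"
    "\<And>c y \<xi>. c \<in> A \<Longrightarrow> y \<in> chart_image c \<Longrightarrow> \<xi> \<in> unit_simple g p c y \<Longrightarrow> \<phi> c y \<xi> = 1 \<Longrightarrow> \<beta> c y \<xi> \<ge> 0"
  shows "positive_form A g p \<phi> \<beta>"
  using assms unfolding positive_form_def phi_planes_def by blast

lemma positive_formD:
  assumes "positive_form A g p \<phi> \<beta>" "c \<in> A" "y \<in> chart_image c" "\<xi> \<in> unit_simple g p c y" "\<phi> c y \<xi> = 1"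
  shows "\<beta> c y \<xi> \<ge> 0"
  using assms unfolding positive_form_def phi_planes_def by blast

lemma positive_form_zero: "positive_form A g p \<phi> 0"
  by (rule positive_formI[OF zero_in_smooth_forms]) simp

lemma phi_domination_cone:
  assumes M: "oriented_manifold X A"
  shows "(0, 0) \<in> phi_domination X A g p \<phi> lam"
    and "(\<psi>, s) \<in> phi_domination X A g p \<phi> lam \<Longrightarrow> (\<psi>', s') \<in> phi_domination X A g p \<phi> lam \<Longrightarrow>
      (\<psi> + \<psi>', s + s') \<in> phi_domination X A g p \<phi> lam"
    and "r > 0 \<Longrightarrow> (\<psi>, s) \<in> phi_domination X A g p \<phi> lam \<Longrightarrow>
      (r *\<^sub>R \<psi>, r * s) \<in> phi_domination X A g p \<phi> lam"
proof -
  note E = subspace_test_forms[OF M, of p]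
  show "(0, 0) \<in> phi_domination X A g p \<phi> lam"
    by (rule phi_dominationI[OF subspace_0[OF E] order_refl subspace_0[OF E] positive_form_zero]) simp
  show "(\<psi> + \<psi>', s + s') \<in> phi_domination X A g p \<phi> lam"
    if "(\<psi>, s) \<in> phi_domination X A g p \<phi> lam" "(\<psi>', s') \<in> phi_domination X A g p \<phi> lam"
  proof -
    from that(1) obtain \<beta> where \<beta>: "\<psi> \<in> test_forms X A p" "s \<ge> 0" "\<beta> \<in> test_forms X A p" "positive_form A g p \<phi> \<beta>"
        "\<And>c y v. c \<in> A \<Longrightarrow> y \<in> chart_image c \<Longrightarrow> v \<in> unit_simple g p c y \<Longrightarrow> lam * (\<psi> c y v + \<beta> c y v) \<le> s"
      by (rule phi_dominationE) blast
    from that(2) obtain \<beta>' where \<beta>': "\<psi>' \<in> test_forms X A p" "s' \<ge> 0" "\<beta>' \<in> test_forms X A p" "positive_form A g p \<phi> \<beta>'"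
        "\<And>c y v. c \<in> A \<Longrightarrow> y \<in> chart_image c \<Longrightarrow> v \<in> unit_simple g p c y \<Longrightarrow> lam * (\<psi>' c y v + \<beta>' c y v) \<le> s'"
      by (rule phi_dominationE) blast
    show ?thesis
    proof (rule phi_dominationI)
      show \<beta>\<beta>': "\<beta> + \<beta>' \<in> test_forms X A p" by (rule subspace_add[OF E \<beta>(3) \<beta>'(3)])
      show "positive_form A g p \<phi> (\<beta> + \<beta>')"
        using positive_formD[OF \<beta>(4)] positive_formD[OF \<beta>'(4)]
        by (intro positive_formI[OF test_formsD(1)[OF \<beta>\<beta>']]) (simp add: add_nonneg_nonneg)
      fix c y v assume "c \<in> A" "y \<in> chart_image c" "v \<in> unit_simple g p c y"
      from \<beta>(5)[OF this] \<beta>'(5)[OF this]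
      show "lam * ((\<psi> + \<psi>') c y v + (\<beta> + \<beta>') c y v) \<le> s + s'" by (simp add: algebra_simps)
    qed (use \<beta> \<beta>' subspace_add[OF E] in auto)
  qed
  show "(r *\<^sub>R \<psi>, r * s) \<in> phi_domination X A g p \<phi> lam"
    if r: "r > 0" and D: "(\<psi>, s) \<in> phi_domination X A g p \<phi> lam"
  proof -
    from D obtain \<beta> where \<beta>: "\<psi> \<in> test_forms X A p" "s \<ge> 0" "\<beta> \<in> test_forms X A p" "positive_form A g p \<phi> \<beta>"
        "\<And>c y v. c \<in> A \<Longrightarrow> y \<in> chart_image c \<Longrightarrow> v \<in> unit_simple g p c y \<Longrightarrow> lam * (\<psi> c y v + \<beta> c y v) \<le> s"
      by (rule phi_dominationE) blast
    show ?thesis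
    proof (rule phi_dominationI)
      show r\<beta>: "r *\<^sub>R \<beta> \<in> test_forms X A p" by (rule subspace_scale[OF E \<beta>(3)])
      show "positive_form A g p \<phi> (r *\<^sub>R \<beta>)"
        using positive_formD[OF \<beta>(4)] r by (intro positive_formI[OF test_formsD(1)[OF r\<beta>]]) simp
      fix c y v assume "c \<in> A" "y \<in> chart_image c" "v \<in> unit_simple g p c y"
      from mult_left_mono[OF \<beta>(5)[OF this] less_imp_le[OF r]]
      show "lam * ((r *\<^sub>R \<psi>) c y v + (r *\<^sub>R \<beta>) c y v) \<le> r * s" by (simp add: algebra_simps)
    qed (use \<beta> r subspace_scale[OF E] in auto)
  qed
qed

lemma phi_domination_total:
  assumes M: "oriented_manifold X A" and g: "riemannian_metric A g" and lam: "lam > 0"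
    and \<psi>: "\<psi> \<in> test_forms X A p"
  shows "\<exists>s. (\<psi>, s) \<in> phi_domination X A g p \<phi> lam"
proof -
  note E = subspace_test_forms[OF M, of p]
  obtain t where t: "t \<ge> 0" "abs_comass_le A g p t \<psi>" using test_form_comass_finite[OF M g \<psi>] .
  have "(\<psi>, lam * t) \<in> phi_domination X A g p \<phi> lam"
  proof (rule phi_dominationI[OF \<psi> _ subspace_0[OF E] positive_form_zero])
    show "0 \<le> lam * t" using lam t by simp
    fix c y v assume "c \<in> A" "y \<in> chart_image c" "v \<in> unit_simple g p c y"
    then have "\<psi> c y v \<le> t" using t(2) unfolding abs_comass_le_def by fastforce
    then show "lam * (\<psi> c y v + 0 c y v) \<le> lam * t" using lam by simp
  qed
  then show ?thesis ..
qed

text \<open>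
  With \<open>lam * comass (d\<alpha> + \<beta>) \<le> s\<close> and \<open>e > 0\<close>, the form \<open>- (lam / (s + e)) d\<alpha>\<close> is at least \<open>-1\<close> on
  \<open>\<phi>\<close>-planes, since \<open>\<beta>\<close> is nonnegative there.  Adding \<open>\<phi>\<close>, which is \<open>1\<close> there, gives a positive form.
  The slack \<open>e\<close> is what permits \<open>s = 0\<close>.
\<close>
lemma dominated_on_exact_forms:
  assumes M: "oriented_manifold X A" and \<phi>: "\<phi> \<in> smooth_forms A (Suc k)" and lam: "lam > 0"
    and S_scale: "\<And>\<alpha> r. \<alpha> \<in> test_forms X A k \<Longrightarrow> S (r *\<^sub>R \<alpha>) = r * S \<alpha>"
    and S: "\<And>\<alpha>. \<alpha> \<in> test_forms X A k \<Longrightarrow> positive_form A g (Suc k) \<phi> (ext_deriv A k \<alpha> + \<phi>) \<Longrightarrow> S \<alpha> \<ge> - lam"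
    and \<alpha>: "\<alpha> \<in> test_forms X A k" and D: "(ext_deriv A k \<alpha>, s) \<in> phi_domination X A g (Suc k) \<phi> lam"
  shows "S \<alpha> \<le> s"
proof (rule field_le_epsilon)
  fix e :: real assume e: "e > 0"
  from D obtain \<beta> where \<beta>: "ext_deriv A k \<alpha> \<in> test_forms X A (Suc k)" "s \<ge> 0" "\<beta> \<in> test_forms X A (Suc k)"
      "positive_form A g (Suc k) \<phi> \<beta>"
      "\<And>c y v. c \<in> A \<Longrightarrow> y \<in> chart_image c \<Longrightarrow> v \<in> unit_simple g (Suc k) c y \<Longrightarrow>
        lam * (ext_deriv A k \<alpha> c y v + \<beta> c y v) \<le> s"
    by (rule phi_dominationE) blast
  define r where "r = - (lam / (s + e))"
  have r: "r < 0" "r * (s + e) = - lam" using e \<beta>(2) lam unfolding r_def by (simp_all add: divide_pos_pos)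
  have r\<alpha>: "r *\<^sub>R \<alpha> \<in> test_forms X A k" by (rule subspace_scale[OF subspace_test_forms[OF M] \<alpha>])
  have "positive_form A g (Suc k) \<phi> (ext_deriv A k (r *\<^sub>R \<alpha>) + \<phi>)"
  proof (rule positive_formI)
    show "ext_deriv A k (r *\<^sub>R \<alpha>) + \<phi> \<in> smooth_forms A (Suc k)"
      by (intro smooth_forms_add[OF M _ \<phi>] ext_deriv_in_smooth_forms[OF M] test_formsD(1)[OF r\<alpha>])
    fix c y \<xi> assume cy: "c \<in> A" "y \<in> chart_image c" "\<xi> \<in> unit_simple g (Suc k) c y" "\<phi> c y \<xi> = 1"
    have "lam * ext_deriv A k \<alpha> c y \<xi> \<le> s + e"
      using \<beta>(5)[OF cy(1-3)] mult_nonneg_nonneg[OF less_imp_le[OF lam] positive_formD[OF \<beta>(4) cy]] e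
      by (simp add: distrib_left)
    then have "ext_deriv A k \<alpha> c y \<xi> * (lam / (s + e)) \<le> 1"
      using e \<beta>(2) by (simp add: field_simps)
    then show "(ext_deriv A k (r *\<^sub>R \<alpha>) + \<phi>) c y \<xi> \<ge> 0"
      unfolding ext_deriv_scale[OF M test_formsD(1)[OF \<alpha>]] r_def using cy(4) by (simp add: mult.commute)
  qed
  from S[OF r\<alpha> this] have "r * (s + e) \<le> r * S \<alpha>" unfolding r(2) S_scale[OF \<alpha>] .
  then show "S \<alpha> \<le> s + e" using r(1) by simp
qed

text \<open>
  The form \<open>\<rho>\<phi>\<close> for a cutoff function \<open>\<rho>\<close> that is \<open>1\<close> on the support of \<open>\<alpha>\<close>: then
  \<open>d\<alpha> + \<rho>\<phi> = \<rho>(d\<alpha> + \<phi>)\<close>.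
\<close>
lemma positive_form_cutoff:
  assumes M: "oriented_manifold X A" and \<phi>: "\<phi> \<in> smooth_forms A (Suc k)" "comass_le_one A g (Suc k) \<phi>"
    and \<alpha>: "\<alpha> \<in> test_forms X A k" and pos: "positive_form A g (Suc k) \<phi> (ext_deriv A k \<alpha> + \<phi>)"
  obtains \<psi> where "\<psi> \<in> test_forms X A (Suc k)" "comass_le_one A g (Suc k) \<psi>"
    "positive_form A g (Suc k) \<phi> (ext_deriv A k \<alpha> + \<psi>)"
proof -
  obtain \<rho> K where \<rho>: "compactin X K" "smooth_fun A \<rho>" "\<And>x. 0 \<le> \<rho> x" "\<And>x. \<rho> x \<le> 1"
      "\<And>x. x \<in> form_support X A \<alpha> \<Longrightarrow> \<rho> x = 1" "\<And>x. x \<notin> K \<Longrightarrow> \<rho> x = 0"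
    using cutoff[OF M test_formsD(2)[OF \<alpha>]] by metis
  have pt: "inv_into (fst c) (snd c) (snd c x) = x" if "c \<in> A" "x \<in> fst c" for c x
    by (rule chart_inverse[OF oriented_manifoldD(1)[OF M that(1)] that(2)])
  let ?\<psi> = "mult_form \<rho> \<phi>"
  have \<psi>: "?\<psi> \<in> smooth_forms A (Suc k)" by (rule mult_form_in_smooth_forms[OF M \<rho>(2) \<phi>(1)])
  have d\<alpha>: "ext_deriv A k \<alpha> \<in> smooth_forms A (Suc k)"
    by (rule ext_deriv_in_smooth_forms[OF M test_formsD(1)[OF \<alpha>]])
  show thesis
  proof (rule that)
    show "?\<psi> \<in> test_forms X A (Suc k)"
      by (rule test_formsI[OF M \<psi> \<rho>(1)]) (simp add: mult_form_def pt \<rho>(6) fun_eq_iff)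
    show "comass_le_one A g (Suc k) ?\<psi>"
      unfolding comass_le_one_def
    proof (intro ballI)
      fix c y v assume cyv: "c \<in> A" "y \<in> chart_image c" "v \<in> unit_simple g (Suc k) c y"
      then have "\<phi> c y v \<le> 1" using \<phi>(2) unfolding comass_le_one_def by blast
      then have "\<rho> (inv_into (fst c) (snd c) y) * \<phi> c y v \<le> \<rho> (inv_into (fst c) (snd c) y) * 1"
        using \<rho>(3) by (intro mult_left_mono)
      then show "?\<psi> c y v \<le> 1" using \<rho>(4)[of "inv_into (fst c) (snd c) y"] by (simp add: mult_form_def)
    qed
    show "positive_form A g (Suc k) \<phi> (ext_deriv A k \<alpha> + ?\<psi>)"
    proof (rule positive_formI[OF smooth_forms_add[OF M d\<alpha> \<psi>]])
      fix c y \<xi> assume c: "c \<in> A" "y \<in> chart_image c" "\<xi> \<in> unit_simple g (Suc k) c y" "\<phi> c y \<xi> = 1"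
      from c(2) obtain x where x: "x \<in> fst c" "y = snd c x" unfolding chart_image_def by blast
      have "0 \<le> \<rho> x * (ext_deriv A k \<alpha> + \<phi>) c y \<xi>" using \<rho>(3) positive_formD[OF pos c] by (rule mult_nonneg_nonneg)
      also have "\<dots> = (ext_deriv A k \<alpha> + ?\<psi>) c y \<xi>"
      proof (cases "x \<in> form_support X A \<alpha>")
        case True
        then show ?thesis using \<rho>(5) pt[OF c(1) x(1)] by (simp add: mult_form_def x(2))
      next
        case False
        then have "ext_deriv A k \<alpha> c y = 0"
          unfolding x(2) by (rule ext_deriv_outside_support[OF M c(1) x(1)])
        then show ?thesis using pt[OF c(1) x(1)] by (simp add: mult_form_def x(2))
      qed
      finally show "0 \<le> (ext_deriv A k \<alpha> + ?\<psi>) c y \<xi>" .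
    qed
  qed
qed

lemma currentsD:
  assumes "T \<in> currents X A k"
  shows "T \<in> extensional (test_forms X A k)"
    "\<omega> \<in> test_forms X A k \<Longrightarrow> \<eta> \<in> test_forms X A k \<Longrightarrow> T (\<omega> + \<eta>) = T \<omega> + T \<eta>"
    "\<omega> \<in> test_forms X A k \<Longrightarrow> T (r *\<^sub>R \<omega>) = r * T \<omega>"
  using assms unfolding currents_def by auto

lemma boundary_lower_bound:
  assumes cal: "calibrated_manifold X A g (Suc k) \<phi>"
    and T: "positive_current X A g (Suc k) \<phi> T" "mass X A g (Suc k) T \<le> ereal lam"
    and \<alpha>: "\<alpha> \<in> test_forms X A k" and pos: "positive_form A g (Suc k) \<phi> (ext_deriv A k \<alpha> + \<phi>)"
  shows "boundary X A k T \<alpha> \<ge> - lam"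
proof -
  have M: "oriented_manifold X A" and \<phi>: "\<phi> \<in> smooth_forms A (Suc k)" "comass_le_one A g (Suc k) \<phi>"
    using cal unfolding calibrated_manifold_def by auto
  have T_cur: "T \<in> currents X A (Suc k)" using T(1) unfolding positive_current_def by blast
  obtain \<psi> where \<psi>: "\<psi> \<in> test_forms X A (Suc k)" "comass_le_one A g (Suc k) \<psi>"
      "positive_form A g (Suc k) \<phi> (ext_deriv A k \<alpha> + \<psi>)"
    using positive_form_cutoff[OF M \<phi> \<alpha> pos] .
  note d\<alpha> = ext_deriv_in_test_forms[OF M \<alpha>]
  have "ereal (T \<psi>) \<le> mass X A g (Suc k) T"
    unfolding mass_def using \<psi>(1,2) by (intro SUP_upper) simp
  then have "T \<psi> \<le> lam" using T(2) order_trans by (metis ereal_less_eq(3))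
  moreover have "0 \<le> T (ext_deriv A k \<alpha> + \<psi>)"
    using T(1) \<psi>(3) subspace_add[OF subspace_test_forms[OF M] d\<alpha> \<psi>(1)] unfolding positive_current_def by blast
  ultimately show ?thesis
    using currentsD(2)[OF T_cur d\<alpha> \<psi>(1)] \<alpha> by (simp add: boundary_def)
qed

lemma positive_current_with_boundary:
  fixes \<phi> :: "('a, 'n::finite) form"
  assumes cal: "calibrated_manifold X A g (Suc k) \<phi>" and lam: "lam > 0"
    and S_cur: "S \<in> currents X A k"
    and S: "\<And>\<alpha>. \<alpha> \<in> test_forms X A k \<Longrightarrow> positive_form A g (Suc k) \<phi> (ext_deriv A k \<alpha> + \<phi>) \<Longrightarrow> S \<alpha> \<ge> - lam"
  shows "\<exists>T. positive_current X A g (Suc k) \<phi> T \<and> S = boundary X A k T \<and> mass X A g (Suc k) T \<le> ereal lam"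
proof -
  have M: "oriented_manifold X A" and g: "riemannian_metric A g" and \<phi>: "\<phi> \<in> smooth_forms A (Suc k)"
    using cal unfolding calibrated_manifold_def by auto
  let ?E = "test_forms X A (Suc k)" and ?D = "phi_domination X A g (Suc k) \<phi> lam"
  note E = subspace_test_forms[OF M, of "Suc k"] and E' = subspace_test_forms[OF M, of k]
  \<comment> \<open>The graph of \<open>d\<alpha> \<mapsto> S \<alpha>\<close>.  That it is single-valued is a consequence of its being dominated.\<close>
  define G where "G = (\<lambda>\<alpha>. (ext_deriv A k \<alpha>, S \<alpha>)) ` test_forms X A k"
  have G: "subspace G"
  proof (rule subspaceI)
    have "ext_deriv A k (0 *\<^sub>R 0) = 0 *\<^sub>R ext_deriv A k (0 :: ('a, 'n) form)"
      by (rule ext_deriv_scale[OF M zero_in_smooth_forms])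
    moreover have "S (0 *\<^sub>R 0) = 0 * S 0" by (rule currentsD(3)[OF S_cur subspace_0[OF E']])
    ultimately have "0 = (ext_deriv A k 0, S 0)" by (simp add: zero_prod_def)
    then show "0 \<in> G" unfolding G_def using subspace_0[OF E'] by blast
    fix x y assume "x \<in> G" "y \<in> G"
    then obtain \<alpha> \<beta> where ab: "\<alpha> \<in> test_forms X A k" "\<beta> \<in> test_forms X A k"
        "x = (ext_deriv A k \<alpha>, S \<alpha>)" "y = (ext_deriv A k \<beta>, S \<beta>)"
      unfolding G_def by blast
    have "x + y = (ext_deriv A k (\<alpha> + \<beta>), S (\<alpha> + \<beta>))"
      unfolding ab(3,4) ext_deriv_add[OF M test_formsD(1)[OF ab(1)] test_formsD(1)[OF ab(2)]]
        currentsD(2)[OF S_cur ab(1,2)] by simp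
    then show "x + y \<in> G" unfolding G_def using subspace_add[OF E' ab(1,2)] by blast
  next
    fix r x assume "x \<in> G"
    then obtain \<alpha> where a: "\<alpha> \<in> test_forms X A k" "x = (ext_deriv A k \<alpha>, S \<alpha>)" unfolding G_def by blast
    have "r *\<^sub>R x = (ext_deriv A k (r *\<^sub>R \<alpha>), S (r *\<^sub>R \<alpha>))"
      unfolding a(2) ext_deriv_scale[OF M test_formsD(1)[OF a(1)]] currentsD(3)[OF S_cur a(1)] by simp
    then show "r *\<^sub>R x \<in> G" unfolding G_def using subspace_scale[OF E' a(1)] by blast
  qed
  have G_E: "fst ` G \<subseteq> ?E" unfolding G_def using ext_deriv_in_test_forms[OF M] by auto
  have G_D: "a \<le> s" if "(x, a) \<in> G" "(x, s) \<in> ?D" for x a s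
    using that dominated_on_exact_forms[OF M \<phi> lam currentsD(3)[OF S_cur] S] unfolding G_def by blast
  obtain T0 where T0: "\<And>x y. x \<in> ?E \<Longrightarrow> y \<in> ?E \<Longrightarrow> T0 (x + y) = T0 x + T0 y"
      "\<And>x r. x \<in> ?E \<Longrightarrow> T0 (r *\<^sub>R x) = r * T0 x" "\<And>x a. (x, a) \<in> G \<Longrightarrow> T0 x = a"
      "\<And>x s. x \<in> ?E \<Longrightarrow> (x, s) \<in> ?D \<Longrightarrow> T0 x \<le> s"
    by (rule hahn_banach_cone[OF E phi_domination_cone(1)[OF M] phi_domination_cone(2)[OF M]
        phi_domination_cone(3)[OF M] phi_domination_total[OF M g lam] G G_E G_D]) blast+
  define T where "T = restrict T0 ?E"
  have T_eq: "T x = T0 x" if "x \<in> ?E" for x using that by (simp add: T_def)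
  have T_add: "T (x + y) = T x + T y" if "x \<in> ?E" "y \<in> ?E" for x y
    using that T0(1) subspace_add[OF E] by (simp add: T_eq)
  have T_scale: "T (r *\<^sub>R x) = r * T x" if "x \<in> ?E" for x r
    using that T0(2) subspace_scale[OF E] by (simp add: T_eq)
  have T_comass: "T \<psi> \<le> lam" if \<psi>: "\<psi> \<in> ?E" "comass_le_one A g (Suc k) \<psi>" for \<psi>
  proof -
    have "(\<psi>, lam) \<in> ?D"
      using \<psi>(2) lam unfolding comass_le_one_def
      by (intro phi_dominationI[OF \<psi>(1) _ subspace_0[OF E] positive_form_zero]) auto
    then show ?thesis using T0(4) \<psi>(1) T_eq by simp
  qed
  have T_pos: "0 \<le> T \<beta>" if \<beta>: "\<beta> \<in> ?E" "positive_form A g (Suc k) \<phi> \<beta>" for \<beta>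
  proof -
    have n\<beta>: "(-1) *\<^sub>R \<beta> \<in> ?E" by (rule subspace_scale[OF E \<beta>(1)])
    have "((-1) *\<^sub>R \<beta>, 0) \<in> ?D"
      by (rule phi_dominationI[OF n\<beta> order_refl \<beta>]) simp
    then have "T ((-1) *\<^sub>R \<beta>) \<le> 0" using T0(4)[OF n\<beta>] T_eq[OF n\<beta>] by simp
    then show ?thesis by (simp only: T_scale[OF \<beta>(1)])
  qed
  have "continuous_map (test_topology X A (Suc k)) euclideanreal T"
  proof (rule continuous_if_comass_bounded[OF M g T_add T_scale _ lam])
    fix \<omega> assume \<omega>: "\<omega> \<in> ?E" "abs_comass_le A g (Suc k) 1 \<omega>"
    have "comass_le_one A g (Suc k) \<omega>"
      using \<omega>(2) unfolding abs_comass_le_def comass_le_one_def by fastforce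
    then show "T \<omega> \<le> lam" by (rule T_comass[OF \<omega>(1)])
  qed
  then have "T \<in> currents X A (Suc k)"
    unfolding currents_def using T_add T_scale by (simp add: T_def)
  then have "positive_current X A g (Suc k) \<phi> T" unfolding positive_current_def using T_pos by blast
  moreover have "S = boundary X A k T"
  proof (rule extensionalityI[OF currentsD(1)[OF S_cur]])
    show "boundary X A k T \<in> extensional (test_forms X A k)" by (simp add: boundary_def)
    fix \<alpha> assume \<alpha>: "\<alpha> \<in> test_forms X A k"
    then have "T0 (ext_deriv A k \<alpha>) = S \<alpha>" by (intro T0(3)) (simp add: G_def)
    then show "S \<alpha> = boundary X A k T \<alpha>"
      using \<alpha> T_eq[OF ext_deriv_in_test_forms[OF M \<alpha>]] by (simp add: boundary_def)
  qed
  moreover have "mass X A g (Suc k) T \<le> ereal lam"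
    unfolding mass_def using T_comass by (intro SUP_least) simp
  ultimately show ?thesis by blast
qed

theorem theorem4p4:
  fixes X :: "'a topology"
    and A :: "('a, 'n::finite) chart set"
    and g :: "('a, 'n) metric_field"
    and p :: nat
    and \<phi> :: "('a, 'n) form"
    and S :: "('a, 'n) form \<Rightarrow> real"
    and lam :: real
  assumes "p \<ge> 1"
    and "calibrated_manifold X A g p \<phi>"
    and "S \<in> currents X A (p - 1)"
    and "lam > 0"
  shows "(\<exists>T. positive_current X A g p \<phi> T \<and> S = boundary X A (p - 1) T \<and>
              mass X A g p T \<le> ereal lam)
     \<longleftrightarrow> (\<forall>\<alpha>\<in>test_forms X A (p - 1).
            positive_form A g p \<phi> (ext_deriv A (p - 1) \<alpha> + \<phi>) \<longrightarrow> S \<alpha> \<ge> - lam)"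
proof -
  from assms(1) obtain k where p: "p = Suc k" by (cases p) auto
  show ?thesis
    using boundary_lower_bound[of X A g k \<phi> _ lam] positive_current_with_boundary[of X A g k \<phi> lam S] assms(2-4)
    unfolding p diff_Suc_1 by blast
qed

end
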